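(* Let $D$ be a strongly discrete Prüfer domain and let $X\subseteq\mathrm{Max}(D)$. (a) If ${}^{\omega}\mathrm{Crit}_X(D)=\emptyset$, then $\mathrm{Div}_X(D)$ is a free abelian group. (b) If $\mathrm{Crit}_X(D)=\emptyset$, then $\mathrm{Div}_X(D)/\mathrm{Inv}_X(D)$ is a free abelian group.
   Context: A Prüfer domain is an integral domain all of whose localizations at primes are valuation domains; it is strongly discrete if $P\neq P^2$ for every nonzero prime $P$. Let $K$ be the quotient field of $D$. A fractional ideal is a nonzero $D$-submodule $I\subseteq K$ with $dI\subseteq D$ for some nonzero $d\in K$. Put $(D:I)=\{d\in K\mid dI\subseteq D\}$ and $I^v=(D:(D:I))$. $I$ is divisorial if $I=I^v$, $v$-invertible if $(I(D:I))^v=D$, and invertible if $I(D:I)=D$. $\mathrm{Div}(D)$ is the abelian group of divisorial $v$-invertible fractional ideals under $I\times_v J=(IJ)^v$; the group $\mathrm{Inv}(D)$ of invertible fractional ideals under product is a subgroup of it. The support of $I$ is $\mathrm{supp}(I)=\{P\in\mathrm{Spec}(D)\mid ID_P\neq D_P\}$. For $X\subseteq\mathrm{Spec}(D)$, $\mathrm{Div}_X(D)$ is the subgroup of those $I\in\mathrm{Div}(D)$ with $\mathrm{supp}(I)\subseteq X$ and $\mathrm{supp}((D:I))\subseteq X$, and $\mathrm{Inv}_X(D)=\mathrm{Inv}(D)\cap\mathrm{Div}_X(D)$. If $P$ is a nonzero non-idempotent prime, then $Q:=\bigcap_{n\geq1}P^n$ is the largest prime properly contained in $P$, $QD_P=QD_Q$,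 and $D_P/QD_P$ is a discrete valuation ring with quotient field $D_Q/QD_P$ and maximal ideal $\mathfrak{m}=PD_P/QD_P$. If $I$ is a fractional ideal with $QD_P\subsetneq ID_P\subsetneq D_Q$, let $w_P(I)\in\mathbb{Z}$ be the integer $n$ such that $ID_P/QD_P=\mathfrak{m}^n$. Each $I\in\mathrm{Inv}_X(D)$ (with $X\subseteq\mathrm{Max}(D)$) satisfies this condition at all $P\in X$, and its ideal function is $\nu_I:X\to\mathbb{Z}$, $\nu_I(P)=w_P(I)$. A prime $P\in X$ is critical (with respect to $X$) if there is no radical ideal $I\in\mathrm{Inv}_X(D)$ (with $I\subseteq D$) such that $I\subseteq P$; it is bounded-critical (with respect to $X$) if there is no ideal $I\in\mathrm{Inv}_X(D)$ (with $I\subseteq D$) such that $I\subseteq P$ and $\nu_I$ is bounded. $\mathrm{Crit}_X(D)$ and ${}^{\omega}\mathrm{Crit}_X(D)$ denote respectively the sets of critical and of bounded-critical primes in $X$. *)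

theory Defs
  imports "HOL-Algebra.Algebra" "HOL-Algebra.Algebraic_Closure_Type"
begin

text \<open>
  The quotient field \<open>K\<close> of the domain is a type \<open>'a :: field\<close>, and the domain \<open>D\<close> is a subset of it,
  so that localizations, fractional ideals and supports all consist of subsets of one type.
  \<open>ring_of_type_algebra\<close> is the library's ring record of a type; \<open>ring_on A\<close> is the subring \<open>A\<close> of
  \<open>K\<close> as a ring record, to which the library notions of ideals, primes and quotients apply.
\<close>

abbreviation fld :: "'a::field ring" where
  "fld \<equiv> ring_of_type_algebra"

abbreviation ring_on :: "'a::field set \<Rightarrow> 'a ring" where
  "ring_on A \<equiv> fld\<lparr>carrier := A\<rparr>"

definition has_quotient_field :: "'a::field set \<Rightarrow> bool" where
  "has_quotient_field D \<longleftrightarrow> (\<forall>x. \<exists>a\<in>D. \<exists>b\<in>D - {0}. x = a / b)"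

definition Spec :: "'a::field set \<Rightarrow> 'a set set" where
  "Spec D = {P. primeideal P (ring_on D)}"

definition MaxSpec :: "'a::field set \<Rightarrow> 'a set set" where
  "MaxSpec D = {P. maximalideal P (ring_on D)}"

definition localization :: "'a::field set \<Rightarrow> 'a set \<Rightarrow> 'a set" where
  "localization D P = {a / s | a s. a \<in> D \<and> s \<in> D - P}"

text \<open>To be used for subrings \<open>V\<close> whose quotient field is the whole type.\<close>

definition valuation_domain :: "'a::field set \<Rightarrow> bool" where
  "valuation_domain V \<longleftrightarrow> subdomain V fld \<and> (\<forall>x. x \<noteq> 0 \<longrightarrow> x \<in> V \<or> inverse x \<in> V)"

definition prufer_domain :: "'a::field set \<Rightarrow> bool" where
  "prufer_domain D \<longleftrightarrow>
     subdomain D fld \<and> has_quotient_field D \<and> (\<forall>P\<in>Spec D. valuation_domain (localization D P))"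

text \<open>
  \<open>ideal_prod\<close> forms the set of finite nonempty sums of products from any two subsets of a ring; the
  library states it for ideals, but over \<open>fld\<close> it is equally the product of submodules of \<open>K\<close>.
\<close>

abbreviation mprod :: "'a::field set \<Rightarrow> 'a set \<Rightarrow> 'a set" where
  "mprod I J \<equiv> ideal_prod fld I J"

definition strongly_discrete :: "'a::field set \<Rightarrow> bool" where
  "strongly_discrete D \<longleftrightarrow> (\<forall>P\<in>Spec D. P \<noteq> {0} \<longrightarrow> P \<noteq> mprod P P)"

definition field_module :: "('a::field, 'a) module" where
  "field_module = \<lparr>carrier = UNIV, monoid.mult = (*), one = 1, ring.zero = 0, add = (+), module.smult = (*)\<rparr>"

definition fractional_ideal :: "'a::field set \<Rightarrow> 'a set \<Rightarrow> bool" where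
  "fractional_ideal D I \<longleftrightarrow>
     submodule I (ring_on D) field_module \<and> I \<noteq> {0} \<and> (\<exists>d. d \<noteq> 0 \<and> (\<forall>x\<in>I. d * x \<in> D))"

definition colon :: "'a::field set \<Rightarrow> 'a set \<Rightarrow> 'a set" where
  "colon D I = {d. \<forall>x\<in>I. d * x \<in> D}"

definition v_closure :: "'a::field set \<Rightarrow> 'a set \<Rightarrow> 'a set" where
  "v_closure D I = colon D (colon D I)"

definition divisorial :: "'a::field set \<Rightarrow> 'a set \<Rightarrow> bool" where
  "divisorial D I \<longleftrightarrow> I = v_closure D I"

definition v_invertible :: "'a::field set \<Rightarrow> 'a set \<Rightarrow> bool" where
  "v_invertible D I \<longleftrightarrow> v_closure D (mprod I (colon D I)) = D"

definition invertible :: "'a::field set \<Rightarrow> 'a set \<Rightarrow> bool" where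
  "invertible D I \<longleftrightarrow> mprod I (colon D I) = D"

definition Div :: "'a::field set \<Rightarrow> 'a set monoid" where
  "Div D = \<lparr>carrier = {I. fractional_ideal D I \<and> divisorial D I \<and> v_invertible D I},
            monoid.mult = (\<lambda>I J. v_closure D (mprod I J)), one = D\<rparr>"

definition Inv :: "'a::field set \<Rightarrow> 'a set set" where
  "Inv D = {I. fractional_ideal D I \<and> invertible D I}"

definition supp :: "'a::field set \<Rightarrow> 'a set \<Rightarrow> 'a set set" where
  "supp D I = {P \<in> Spec D. mprod I (localization D P) \<noteq> localization D P}"

definition Div_on :: "'a::field set \<Rightarrow> 'a set set \<Rightarrow> 'a set monoid" where
  "Div_on D Y =
     (Div D)\<lparr>carrier := {I \<in> carrier (Div D). supp D I \<subseteq> Y \<and> supp D (colon D I) \<subseteq> Y}\<rparr>"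

definition Inv_on :: "'a::field set \<Rightarrow> 'a set set \<Rightarrow> 'a set set" where
  "Inv_on D Y = Inv D \<inter> carrier (Div_on D Y)"

definition ideal_power :: "('b, 'c) ring_scheme \<Rightarrow> 'b set \<Rightarrow> nat \<Rightarrow> 'b set" where
  "ideal_power R J n = ((\<lambda>A. ideal_prod R A J) ^^ n) (carrier R)"

text \<open>
  The \<open>n\<close>-th power of a maximal ideal \<open>m\<close> of a discrete valuation ring \<open>V\<close> with quotient field \<open>F\<close>,
  where \<open>V\<close> is a subring of \<open>F\<close>; for negative \<open>n\<close> this is the fractional ideal \<open>(V : m^(-n))\<close>.
\<close>

definition int_power :: "'b ring \<Rightarrow> 'b ring \<Rightarrow> 'b set \<Rightarrow> int \<Rightarrow> 'b set" where
  "int_power F V m n =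
     (if n \<ge> 0 then ideal_power V m (nat n)
      else {x \<in> carrier F. \<forall>y \<in> ideal_power V m (nat (- n)). x \<otimes>\<^bsub>F\<^esub> y \<in> carrier V})"

definition prime_below :: "'a::field set \<Rightarrow> 'a set \<Rightarrow> 'a set" where
  "prime_below D P = (\<Inter>n\<in>{1..}. ideal_power (ring_on D) P n)"

definition cosets_of :: "'a::field set \<Rightarrow> 'a set \<Rightarrow> 'a set set" where
  "cosets_of N A = (\<lambda>x. N +>\<^bsub>fld\<^esub> x) ` A"

text \<open>
  Below, \<open>V\<close> is \<open>D\<^sub>P/QD\<^sub>P\<close> and \<open>F\<close> is \<open>D\<^sub>Q/QD\<^sub>P\<close>.  The value is meaningful only when
  \<open>ID\<^sub>P\<close> lies strictly between \<open>QD\<^sub>P\<close> and \<open>D\<^sub>Q\<close>, as it does for invertible \<open>I\<close> whose support consists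
  of maximal ideals and \<open>P\<close> nonzero maximal.
\<close>

definition w_val :: "'a::field set \<Rightarrow> 'a set \<Rightarrow> 'a set \<Rightarrow> int" where
  "w_val D P I =
     (let Q = prime_below D P;
          DP = localization D P;
          N = mprod Q DP;
          V = ring_on DP Quot N;
          F = ring_on (localization D Q) Quot N;
          m = cosets_of N (mprod P DP)
      in THE n. cosets_of N (mprod I DP) = int_power F V m n)"

definition ideal_function :: "'a::field set \<Rightarrow> 'a set \<Rightarrow> 'a set \<Rightarrow> int" where
  "ideal_function D I = (\<lambda>P. w_val D P I)"

definition radical_ideal :: "'a::field set \<Rightarrow> 'a set \<Rightarrow> bool" where
  "radical_ideal D I \<longleftrightarrow> I = {x \<in> D. \<exists>n::nat. n \<ge> 1 \<and> x ^ n \<in> I}"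

definition Crit :: "'a::field set \<Rightarrow> 'a set set \<Rightarrow> 'a set set" where
  "Crit D Y = {P \<in> Y. \<not> (\<exists>I \<in> Inv_on D Y. I \<subseteq> D \<and> radical_ideal D I \<and> I \<subseteq> P)}"

definition bounded_Crit :: "'a::field set \<Rightarrow> 'a set set \<Rightarrow> 'a set set" where
  "bounded_Crit D Y =
     {P \<in> Y. \<not> (\<exists>I \<in> Inv_on D Y. I \<subseteq> D \<and> I \<subseteq> P \<and>
                 (\<exists>B. \<forall>M\<in>Y. \<bar>ideal_function D I M\<bar> \<le> B))}"

text \<open>
  A basis may be taken inside the group itself, so quantifying over subsets of the element
  type of \<open>G\<close> loses no generality.
\<close>

definition free_abelian :: "('b, 'c) monoid_scheme \<Rightarrow> bool" where
  "free_abelian G \<longleftrightarrow> comm_group G \<and> (\<exists>S :: 'b set. G \<cong> free_Abelian_group S)"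

end

theory Submission
  imports Defs "HOL-Library.Function_Algebras"
begin

text \<open>
Locally at a nonzero maximal ideal \<open>P \<in> Y\<close>, every member \<open>I\<close> of \<open>Div_on D Y\<close> is a power, with an integer exponent
\<open>nu I P\<close>, of the maximal ideal of \<open>D\<^sub>P\<close>; away from \<open>Y\<close> it is trivial.  So \<open>I\<close> is described by the function
\<open>nu I\<close>.  For invertible ideals \<open>nu\<close> is a homomorphism, but for divisorial ones it need not be, because the
\<open>v\<close>-closure of \<open>I J\<close> can be larger than \<open>I J\<close>.  The point is that it is larger only on a small set of
primes: call a set of primes small if it is nowhere dense for the topology whose basic open sets are the
sets \<open>{P \<in> Y. L \<subseteq> P}\<close> with \<open>L\<close> an invertible ideal supported in \<open>Y\<close>.  Modulo functions with small support
\<open>nu\<close> is an injective homomorphism (\<open>nu_mult_small\<close>, \<open>small_support_trivial\<close>).  The crucial fact is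
\<open>noninvertible_locus_small\<close>: if \<open>T = I (D:I)\<close> vanished on all of \<open>{P \<in> Y. L \<subseteq> P}\<close>, then a power of \<open>T\<close> would lie
in \<open>L\<close>, since the values of \<open>L\<close> are bounded; but \<open>(D:T) = D\<close>, so this would force \<open>L = D\<close>.

The absence of (bounded-)critical primes enters through one prime avoidance argument
(\<open>exists_in_family_below\<close>): if every \<open>P \<in> Y\<close> contains a member of a multiplicative family of invertible ideals,
then so does every ideal whose zeros lie in \<open>Y\<close>.  Applied to ideals with bounded values it shows that
all functions \<open>nu I\<close> are bounded, so \<open>Div_on D Y\<close> embeds into the group \<open>B/N\<close> of bounded integer functions modulo
those with small support.  Applied to radical ideals it shows that the functions \<open>nu I\<close> of invertible
ideals are exactly the integral combinations of indicator functions of a family \<open>\<C>\<close> of sets closed under intersection,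
so the quotient by \<open>Inv_on D Y\<close> embeds into \<open>B/(span \<C> + N)\<close>.

It remains to see that subgroups of such quotients are free (\<open>free_abelian_modulo_sets\<close>).  This is Noebeling's
theorem, in Bergman's form: well-order the subsets of the underlying set, starting with \<open>\<C>\<close>, and order the
monomials, that is the finite products of indicator functions, lexicographically.  A monomial that has a
nonzero integer multiple in the span of smaller ones modulo \<open>N\<close> lies in that span itself (\<open>smaller_monomials_pure\<close>), and an argument with
leading coefficients (\<open>free_abelian_of_leading_terms\<close>) then yields a basis of any subgroup.
\<close>

section \<open>Free abelian groups from leading coefficients\<close>

text \<open>
The subgroups of an additive group given as a type; closure under differences is the one-step subgroup
criterion.
\<close>

definition diff_closed :: "'b::ab_group_add set \<Rightarrow> bool" where
  "diff_closed A \<longleftrightarrow> 0 \<in> A \<and> (\<forall>x\<in>A. \<forall>y\<in>A. x - y \<in> A)"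

lemma diff_closedD:
  assumes "diff_closed A"
  shows diff_closed_0: "0 \<in> A"
    and diff_closed_diff: "x \<in> A \<Longrightarrow> y \<in> A \<Longrightarrow> x - y \<in> A"
    and diff_closed_neg: "x \<in> A \<Longrightarrow> - x \<in> A"
    and diff_closed_add: "x \<in> A \<Longrightarrow> y \<in> A \<Longrightarrow> x + y \<in> A"
proof -
  show z: "0 \<in> A" and d: "x \<in> A \<Longrightarrow> y \<in> A \<Longrightarrow> x - y \<in> A" for x y
    using assms by (auto simp: diff_closed_def)
  show n: "x \<in> A \<Longrightarrow> - x \<in> A" for x
    using d[OF z, of x] by simp
  show "x \<in> A \<Longrightarrow> y \<in> A \<Longrightarrow> x + y \<in> A"
    using d[of x "- y"] n[of y] by simp
qed

lemma diff_closed_of_int_mult: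
  fixes A :: "'b::comm_ring_1 set"
  assumes A: "diff_closed A" and x: "x \<in> A"
  shows "of_int k * x \<in> A"
proof -
  have nat: "of_nat n * x \<in> A" for n
    by (induction n) (auto simp: algebra_simps intro: diff_closedD[OF A] x)
  show ?thesis
  proof (cases k rule: int_cases2)
    case (nonneg n)
    then show ?thesis using nat by simp
  next
    case (nonpos n)
    then show ?thesis using diff_closed_neg[OF A nat[of n]] by simp
  qed
qed

definition zspan :: "'b::ab_group_add set \<Rightarrow> 'b set" where
  "zspan S = \<Inter>{A. diff_closed A \<and> S \<subseteq> A}"

lemma diff_closed_zspan: "diff_closed (zspan S)"
  by (auto simp: zspan_def diff_closed_def)

lemmas zspan_0 = diff_closed_0[OF diff_closed_zspan]
  and zspan_diff = diff_closed_diff[OF diff_closed_zspan]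
  and zspan_add = diff_closed_add[OF diff_closed_zspan]
  and zspan_of_int_mult = diff_closed_of_int_mult[OF diff_closed_zspan]

lemma zspan_base: "x \<in> S \<Longrightarrow> x \<in> zspan S"
  by (auto simp: zspan_def)

lemma zspan_least: "diff_closed A \<Longrightarrow> S \<subseteq> A \<Longrightarrow> zspan S \<subseteq> A"
  by (auto simp: zspan_def)

lemma zspan_mono: "S \<subseteq> T \<Longrightarrow> zspan S \<subseteq> zspan T"
  by (rule zspan_least[OF diff_closed_zspan]) (auto intro: zspan_base)

lemma zspan_subset: "S \<subseteq> zspan T \<Longrightarrow> zspan S \<subseteq> zspan T"
  by (rule zspan_least[OF diff_closed_zspan])

lemma zspan_induct [consumes 1, case_names zero base diff]:
  assumes "x \<in> zspan S" "P 0" "\<And>x. x \<in> S \<Longrightarrow> P x" "\<And>x y. P x \<Longrightarrow> P y \<Longrightarrow> P (x - y)"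
  shows "P x"
  using zspan_least[of "Collect P" S] assms by (auto simp: diff_closed_def)

lemma zspan_insertD:
  fixes S :: "'b::comm_ring_1 set"
  assumes "y \<in> zspan (insert x S)"
  shows "\<exists>n. y - of_int n * x \<in> zspan S"
  using assms
proof (induction rule: zspan_induct)
  case zero
  show ?case by (rule exI[of _ 0]) (simp add: zspan_0)
next
  case (base y)
  then show ?case
  proof
    assume "y = x"
    then show ?thesis by (intro exI[of _ 1]) (simp add: zspan_0)
  next
    assume "y \<in> S"
    then show ?thesis by (intro exI[of _ 0]) (simp add: zspan_base)
  qed
next
  case (diff y z)
  then obtain m n where "y - of_int m * x \<in> zspan S" "z - of_int n * x \<in> zspan S" by blast
  from zspan_diff[OF this] show ?case
    by (intro exI[of _ "m - n"]) (simp add: algebra_simps)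
qed

lemma int_subgroup_principal:
  fixes L :: "int set"
  assumes L: "diff_closed L"
  obtains d where "\<And>n. n \<in> L \<longleftrightarrow> d dvd n"
proof (cases "L \<subseteq> {0}")
  case True
  then have "n \<in> L \<longleftrightarrow> 0 dvd n" for n
    using diff_closed_0[OF L] by auto
  then show thesis by (rule that)
next
  case False
  then obtain a where a: "a \<in> L" "a \<noteq> 0" by blast
  define d where "d = (LEAST n::nat. n > 0 \<and> int n \<in> L)"
  have "nat \<bar>a\<bar> > 0 \<and> int (nat \<bar>a\<bar>) \<in> L"
    using a diff_closed_neg[OF L] by (auto simp: abs_if)
  then have d: "d > 0" "int d \<in> L" and least: "\<And>n. n > 0 \<Longrightarrow> int n \<in> L \<Longrightarrow> d \<le> n"
    unfolding d_def by (metis (mono_tags, lifting) LeastI, metis (mono_tags, lifting) LeastI,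
        simp add: Least_le)
  have mult: "k * int d \<in> L" for k
    using diff_closed_of_int_mult[OF L d(2), of k] by simp
  have "n \<in> L \<longleftrightarrow> int d dvd n" for n
  proof
    assume n: "n \<in> L"
    have "n mod int d \<in> L"
      using diff_closed_diff[OF L n mult[of "n div int d"]] by (simp add: minus_div_mult_eq_mod)
    then have "\<not> 0 < nat (n mod int d)"
      using least[of "nat (n mod int d)"] d(1)
      by (metis int_nat_eq leD nat_less_iff of_nat_0_less_iff pos_mod_bound pos_mod_sign)
    then show "int d dvd n"
      using pos_mod_sign[of "int d" n] d(1) by (simp add: dvd_eq_mod_eq_0 del: pos_mod_sign)
  next
    assume "int d dvd n"
    then show "n \<in> L" using mult by (auto simp: mult.commute)
  qed
  then show thesis by (rule that)
qed

lemma finite_total_top: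
  assumes "finite K" "K \<noteq> {}" "K \<subseteq> I" "total_on I R" "trans R"
  shows "\<exists>i\<in>K. \<forall>j\<in>K. j = i \<or> (j, i) \<in> R"
  using assms(1-3)
proof (induction rule: finite_ne_induct)
  case (singleton x)
  then show ?case by simp
next
  case (insert x F)
  then obtain i where i: "i \<in> F" "\<forall>j\<in>F. j = i \<or> (j, i) \<in> R" by auto
  have "x \<in> I" "i \<in> I" "x \<noteq> i" using i(1) insert by auto
  then consider "(x, i) \<in> R" | "(i, x) \<in> R" using assms(4) by (auto simp: total_on_def)
  then show ?case
  proof cases
    case 1
    then show ?thesis using i by (intro bexI[of _ i]) auto
  next
    case 2
    have "(j, x) \<in> R" if "j \<in> F" for j
    proof (cases "j = i")
      case False
      then have "(j, i) \<in> R" using i(2) that by blast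
      then show ?thesis using 2 by (rule transD[OF assms(5)])
    qed (use 2 in simp)
    then show ?thesis by (intro bexI[of _ x]) auto
  qed
qed

text \<open>
Let a well-ordered family \<open>x\<close> span the values of \<open>\<phi>\<close> modulo \<open>M\<close>, and suppose that the successive quotients of the
filtration by the spans of initial segments are torsion-free; each of them is then zero or infinite cyclic.  For a
group embedded modulo \<open>M\<close>, the coefficients of \<open>x i\<close> that occur in elements with leading index \<open>i\<close> form a subgroup
\<open>d i \<int>\<close>.  Choosing an element \<open>g i\<close> with leading coefficient \<open>d i\<close> whenever this is nonzero gives a basis: distinct
leading indices make the \<open>g i\<close> independent, and subtracting multiples of \<open>g i\<close> lowers the leading index, so
that they generate by well-founded induction.
\<close>

theorem free_abelian_of_leading_terms:
  fixes \<phi> :: "'g \<Rightarrow> 'b::comm_ring_1" and x :: "'i \<Rightarrow> 'b" and G (structure)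
  assumes G: "comm_group G"
    and hom: "\<And>a b. a \<in> carrier G \<Longrightarrow> b \<in> carrier G \<Longrightarrow> \<phi> (a \<otimes> b) - (\<phi> a + \<phi> b) \<in> M"
    and ker: "\<And>a. a \<in> carrier G \<Longrightarrow> \<phi> a \<in> M \<Longrightarrow> a = \<one>"
    and M: "diff_closed M"
    and R: "wf R" "total_on I R" "trans R"
    and span: "\<And>a. a \<in> carrier G \<Longrightarrow> \<phi> a \<in> zspan (M \<union> x ` I)"
    and pure: "\<And>i n. i \<in> I \<Longrightarrow> n \<noteq> 0 \<Longrightarrow>
      of_int n * x i \<in> zspan (M \<union> x ` {j\<in>I. (j, i) \<in> R}) \<Longrightarrow> x i \<in> zspan (M \<union> x ` {j\<in>I. (j, i) \<in> R})"
  shows "free_abelian G"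
proof -
  interpret G: comm_group G by (rule G)
  define B where "B i = zspan (M \<union> x ` {j\<in>I. (j, i) \<in> R})" for i
  note pure = pure[folded B_def]
  have dB: "diff_closed (B i)" for i by (simp add: B_def diff_closed_zspan)
  have MB: "M \<subseteq> B i" for i by (auto simp: B_def intro: zspan_base)
  have B_mono: "B j \<subseteq> B i" if "(j, i) \<in> R" for i j
    unfolding B_def by (rule zspan_mono) (use that transD[OF R(3)] in blast)
  have xB: "x j \<in> B i" if "j \<in> I" "(j, i) \<in> R" for i j
    using that by (auto simp: B_def intro: zspan_base)

  have phi1: "\<phi> \<one> \<in> M"
    using diff_closed_neg[OF M hom[of "\<one>" "\<one>"]] by simp
  have phi_diff: "\<phi> (a \<otimes> inv b) - (\<phi> a - \<phi> b) \<in> M"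
    if "a \<in> carrier G" "b \<in> carrier G" for a b
  proof -
    have "\<phi> \<one> - (\<phi> b + \<phi> (inv b)) \<in> M"
      using hom[of b "inv b"] that by simp
    moreover have "\<phi> (a \<otimes> inv b) - (\<phi> a + \<phi> (inv b)) \<in> M"
      using hom[of a "inv b"] that by simp
    ultimately have "\<phi> (a \<otimes> inv b) - (\<phi> a + \<phi> (inv b))
        - (\<phi> \<one> - (\<phi> b + \<phi> (inv b))) + \<phi> \<one> \<in> M"
      using diff_closed_add[OF M diff_closed_diff[OF M] phi1] by blast
    then show ?thesis by (simp add: algebra_simps)
  qed

  \<comment> \<open>The leading coefficients at \<open>i\<close> form a subgroup of the integers, generated by \<open>d i\<close>;
    the element \<open>g i\<close> realises the generator.\<close>
  define L where "L i = {n. \<exists>a\<in>carrier G. \<phi> a - of_int n * x i \<in> B i}" for i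
  have dL: "diff_closed (L i)" for i
  proof -
    have "0 \<in> L i"
      using phi1 MB by (auto simp: L_def intro!: bexI[of _ "\<one>"])
    moreover have "m - n \<in> L i" if mn: "m \<in> L i" "n \<in> L i" for m n
    proof -
      obtain a b where ab: "a \<in> carrier G" "b \<in> carrier G"
        "\<phi> a - of_int m * x i \<in> B i" "\<phi> b - of_int n * x i \<in> B i"
        using mn by (auto simp: L_def)
      have "(\<phi> (a \<otimes> inv b) - (\<phi> a - \<phi> b)) +
          ((\<phi> a - of_int m * x i) - (\<phi> b - of_int n * x i)) \<in> B i"
        using ab phi_diff[OF ab(1,2)] MB
        by (intro diff_closed_add[OF dB] diff_closed_diff[OF dB, of "\<phi> a - _"]) auto
      then have "\<phi> (a \<otimes> inv b) - of_int (m - n) * x i \<in> B i"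
        by (simp add: algebra_simps)
      then show ?thesis using ab by (auto simp: L_def intro!: bexI[of _ "a \<otimes> inv b"])
    qed
    ultimately show ?thesis by (simp add: diff_closed_def)
  qed
  have "\<exists>d. \<forall>n. n \<in> L i \<longleftrightarrow> d dvd n" for i
    using int_subgroup_principal[OF dL] by metis
  then obtain d where d: "\<And>i n. n \<in> L i \<longleftrightarrow> d i dvd n" by metis
  have "\<exists>a\<in>carrier G. \<phi> a - of_int (d i) * x i \<in> B i" for i
    using d[where n="d i"] by (auto simp: L_def)
  then obtain g where g: "\<And>i. g i \<in> carrier G" "\<And>i. \<phi> (g i) - of_int (d i) * x i \<in> B i" by metis
  define J where "J = {i\<in>I. x i \<notin> B i \<and> d i \<noteq> 0}"

  have g_below: "\<phi> (g j) \<in> B i" if "j \<in> J" "(j, i) \<in> R" for i j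
  proof -
    have "of_int (d j) * x j \<in> B i"
      using that by (intro diff_closed_of_int_mult[OF dB] xB) (auto simp: J_def)
    moreover have "\<phi> (g j) - of_int (d j) * x j \<in> B i"
      using g B_mono[OF that(2)] by blast
    ultimately show ?thesis
      using diff_closed_add[OF dB, of "\<phi> (g j) - of_int (d j) * x j" i "of_int (d j) * x j"] by simp
  qed
  have top_nonzero: "of_int k * (of_int (d i) * x i) \<notin> B i" if "i \<in> J" "k \<noteq> 0" for i k
  proof
    assume "of_int k * (of_int (d i) * x i) \<in> B i"
    then have "of_int (k * d i) * x i \<in> B i" by (simp add: mult.assoc)
    with pure[of i "k * d i"] that show False by (auto simp: J_def)
  qed
  have inj_g: "inj_on g J"
  proof (rule inj_onI, rule ccontr)
    have *: False if "i \<in> J" "j \<in> J" "g i = g j" "(j, i) \<in> R" for i j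
    proof -
      have "\<phi> (g i) \<in> B i" using g_below[OF that(2,4)] that(3) by simp
      from diff_closed_diff[OF dB this g(2)[of i]] have "of_int 1 * (of_int (d i) * x i) \<in> B i"
        by (simp add: algebra_simps)
      with top_nonzero[OF that(1), of 1] show False by simp
    qed
    fix i j assume ij: "i \<in> J" "j \<in> J" "g i = g j" "i \<noteq> j"
    then have "(i, j) \<in> R \<or> (j, i) \<in> R" using R(2) by (auto simp: J_def total_on_def)
    with *[OF ij(1,2)] *[OF ij(2,1)] ij(3) show False by metis
  qed

  define S where "S = g ` J"
  define F where "F = free_Abelian_group S"
  have "(\<lambda>a. a) ` S \<subseteq> carrier G" using g by (auto simp: S_def)
  from G.free_Abelian_group_universal[OF this]
  obtain h where h: "h \<in> hom F G" and h_of: "\<And>a. a \<in> S \<Longrightarrow> h (frag_of a) = a"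
    unfolding F_def by metis
  interpret h: group_hom F G h
    by (rule group_hom.intro) (auto simp: F_def group_hom_axioms_def h[unfolded F_def])

  have h_diff: "h (c - e) = h c \<otimes> inv h e"
    if "Poly_Mapping.keys c \<subseteq> S" "Poly_Mapping.keys e \<subseteq> S" for c e
  proof -
    have ce: "c \<in> carrier F" "e \<in> carrier F" "- e \<in> carrier F" "inv\<^bsub>F\<^esub> e = - e"
      using that by (auto simp: F_def)
    have "h (c - e) = h (c \<otimes>\<^bsub>F\<^esub> (- e))" by (simp add: F_def)
    also have "\<dots> = h c \<otimes> h (- e)" by (rule h.hom_mult[OF ce(1,3)])
    also have "h (- e) = inv h e" using h.hom_inv[OF ce(2)] ce(4) by simp
    finally show ?thesis .
  qed
  have h_carr: "h c \<in> carrier G" if "Poly_Mapping.keys c \<subseteq> S" for c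
    using h.hom_closed[of c] that by (simp add: F_def)

  have top: "\<phi> (h c) - of_int (Poly_Mapping.lookup c (g i)) * (of_int (d i) * x i) \<in> B i"
    if i: "i \<in> J" and c: "Poly_Mapping.keys c \<subseteq> g ` {j\<in>J. j = i \<or> (j, i) \<in> R}" for i c
    using c
  proof (induction c rule: free_Abelian_group_induct[consumes 1])
    case 1
    have "h 0 = \<one>" using h.hom_one by (simp add: F_def)
    then show ?case using phi1 MB by auto
  next
    case (2 c e)
    let ?y = "of_int (d i) * x i"
    have sub: "Poly_Mapping.keys c \<subseteq> S" "Poly_Mapping.keys e \<subseteq> S" using 2 by (auto simp: S_def)
    have "(\<phi> (h c \<otimes> inv h e) - (\<phi> (h c) - \<phi> (h e))) +
       ((\<phi> (h c) - of_int (Poly_Mapping.lookup c (g i)) * ?y)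
         - (\<phi> (h e) - of_int (Poly_Mapping.lookup e (g i)) * ?y)) \<in> B i"
      using phi_diff[OF h_carr[OF sub(1)] h_carr[OF sub(2)]] MB 2(3,4)
      by (intro diff_closed_add[OF dB] diff_closed_diff[OF dB, of "\<phi> (h c) - _"]) auto
    then show ?case
      by (simp add: h_diff[OF sub] Poly_Mapping.lookup_minus algebra_simps)
  next
    case (3 a)
    then obtain j where j: "j \<in> J" "j = i \<or> (j, i) \<in> R" "a = g j" by auto
    then have ha: "h (frag_of a) = g j" using h_of by (auto simp: S_def)
    show ?case
    proof (cases "j = i")
      case True
      then show ?thesis using ha g(2)[of i] j by simp
    next
      case False
      then have "g j \<noteq> g i" using inj_g i j by (auto dest: inj_onD)
      then show ?thesis
        using ha g_below[OF j(1), of i] j False by (simp add: lookup_single)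
    qed
  qed

  have inj: "c = 0" if c: "Poly_Mapping.keys c \<subseteq> S" "h c = \<one>" for c
  proof (rule ccontr)
    assume "c \<noteq> 0"
    define K where "K = {j\<in>J. g j \<in> Poly_Mapping.keys c}"
    have "g ` K = Poly_Mapping.keys c" using c(1) by (auto simp: K_def S_def)
    moreover have "inj_on g K" by (rule inj_on_subset[OF inj_g]) (auto simp: K_def)
    ultimately have fin: "finite K"
      using finite_keys[of c] by (metis finite_imageD)
    have "Poly_Mapping.keys c \<noteq> {}" using \<open>c \<noteq> 0\<close> by simp
    with \<open>g ` K = Poly_Mapping.keys c\<close> have "K \<noteq> {}" by blast
    moreover have "K \<subseteq> I" by (auto simp: K_def J_def)
    ultimately obtain i where i: "i \<in> K" "\<forall>j\<in>K. j = i \<or> (j, i) \<in> R"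
      using finite_total_top[OF fin _ _ R(2,3)] by blast
    have "Poly_Mapping.keys c \<subseteq> g ` {j\<in>J. j = i \<or> (j, i) \<in> R}"
    proof
      fix y assume "y \<in> Poly_Mapping.keys c"
      then obtain j where j: "j \<in> K" "y = g j" using \<open>g ` K = Poly_Mapping.keys c\<close> by blast
      then show "y \<in> g ` {j\<in>J. j = i \<or> (j, i) \<in> R}" using i by (auto simp: K_def)
    qed
    from top[OF _ this] i
    have "\<phi> (h c) - of_int (Poly_Mapping.lookup c (g i)) * (of_int (d i) * x i) \<in> B i"
      by (auto simp: K_def)
    moreover have "\<phi> (h c) \<in> B i" using phi1 MB c by auto
    ultimately have "\<phi> (h c) - (\<phi> (h c) - of_int (Poly_Mapping.lookup c (g i)) * (of_int (d i) * x i)) \<in> B i"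
      using diff_closed_diff[OF dB] by blast
    with top_nonzero[of i "Poly_Mapping.lookup c (g i)"] i show False
      by (auto simp: K_def in_keys_iff)
  qed

  \<comment> \<open>A combination involves only finitely many terms; as the order is total, one of them is the last.\<close>
  have in_M_or_below: "y \<in> M \<or> (\<exists>i\<in>K. y \<in> zspan (insert (x i) (M \<union> x ` {j\<in>I. (j, i) \<in> R})))"
    if "y \<in> zspan (M \<union> x ` K)" "K \<subseteq> I" for y K
    using that(1)
  proof (induction rule: zspan_induct)
    case zero
    then show ?case using diff_closed_0[OF M] by simp
  next
    case (base y)
    then show ?case by (auto intro: zspan_base)
  next
    case (diff y z)
    let ?C = "\<lambda>i. zspan (insert (x i) (M \<union> x ` {j\<in>I. (j, i) \<in> R}))"
    have MC: "M \<subseteq> ?C i" for i by (auto intro: zspan_base)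
    have C_mono: "?C i \<subseteq> ?C j" if "i \<in> K" "j \<in> K" "i = j \<or> (i, j) \<in> R" for i j
    proof (cases "i = j")
      case False
      then show ?thesis
        using that \<open>K \<subseteq> I\<close> transD[OF R(3)] by (intro zspan_mono) blast
    qed simp
    consider "y \<in> M" "z \<in> M" | i where "i \<in> K" "y \<in> ?C i" "z \<in> ?C i"
    proof -
      have comparable: "?C i \<subseteq> ?C j \<or> ?C j \<subseteq> ?C i" if "i \<in> K" "j \<in> K" for i j
        using R(2) \<open>K \<subseteq> I\<close> that C_mono[of i j] C_mono[of j i]
        unfolding total_on_def by blast
      from diff(1) show ?thesis
      proof
        assume y: "y \<in> M"
        from diff(2) show ?thesis
        proof
          assume "z \<in> M" then show ?thesis using y that by blast
        next
          assume "\<exists>i\<in>K. z \<in> ?C i"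
          then show ?thesis using y MC that(2) by blast
        qed
      next
        assume "\<exists>i\<in>K. y \<in> ?C i"
        then obtain i where i: "i \<in> K" "y \<in> ?C i" by blast
        from diff(2) show ?thesis
        proof
          assume "z \<in> M" then show ?thesis using i MC that(2) by blast
        next
          assume "\<exists>i\<in>K. z \<in> ?C i"
          then obtain j where j: "j \<in> K" "z \<in> ?C j" by blast
          show ?thesis using comparable[OF i(1) j(1)] i j that(2) by blast
        qed
      qed
    qed
    then show ?case
    proof cases
      case 1
      then show ?thesis using diff_closed_diff[OF M] by blast
    next
      case 2
      then show ?thesis using zspan_diff by blast
    qed
  qed

  have one_img: "\<one> \<in> h ` carrier F"
    by (metis h.hom_one h.G.one_closed imageI)
  have surj_step: "\<forall>a\<in>carrier G. \<phi> a \<in> zspan (insert (x i) (M \<union> x ` {j\<in>I. (j, i) \<in> R})) \<longrightarrow> a \<in> h ` carrier F"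
    if "i \<in> I" for i
    using R(1) that
  proof (induction i rule: wf_induct_rule)
    case (less i)
    have low: "a \<in> h ` carrier F" if "a \<in> carrier G" "\<phi> a \<in> B i" for a
      using in_M_or_below[of "\<phi> a" "{j\<in>I. (j, i) \<in> R}"] that ker[of a] less one_img
      by (auto simp: B_def)
    show ?case
    proof (intro ballI impI)
      fix a assume a: "a \<in> carrier G" "\<phi> a \<in> zspan (insert (x i) (M \<union> x ` {j\<in>I. (j, i) \<in> R}))"
      obtain n where n: "\<phi> a - of_int n * x i \<in> B i" using zspan_insertD[OF a(2)] by (auto simp: B_def)
      show "a \<in> h ` carrier F"
      proof (cases "x i \<in> B i")
        case True
        have "(\<phi> a - of_int n * x i) + of_int n * x i \<in> B i"
          using n True by (intro diff_closed_add[OF dB] diff_closed_of_int_mult[OF dB])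
        then show ?thesis using low a by simp
      next
        case False
        have "n \<in> L i" using n a by (auto simp: L_def)
        then obtain k where k: "n = d i * k" using d by auto
        show ?thesis
        proof (cases "d i = 0")
          case True
          then show ?thesis using n k low a by simp
        next
          case d0: False
          then have iJ: "i \<in> J" using False less.prems by (auto simp: J_def)
          define c where "c = frag_cmul k (frag_of (g i))"
          have keys: "Poly_Mapping.keys c \<subseteq> g ` {j\<in>J. j = i \<or> (j, i) \<in> R}"
            using iJ by (auto simp: c_def in_keys_iff lookup_single when_def split: if_splits)
          then have keysS: "Poly_Mapping.keys c \<subseteq> S" by (auto simp: S_def)
          have lk: "Poly_Mapping.lookup c (g i) = k" by (simp add: c_def)
          define b where "b = a \<otimes> inv h c"
          have b: "b \<in> carrier G" using a h_carr[OF keysS] by (simp add: b_def)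
          have "(\<phi> b - (\<phi> a - \<phi> (h c))) + ((\<phi> a - of_int n * x i)
              - (\<phi> (h c) - of_int k * (of_int (d i) * x i))) \<in> B i"
            using phi_diff[OF a(1) h_carr[OF keysS]] MB n top[OF iJ keys] lk
            unfolding b_def
            by (intro diff_closed_add[OF dB] diff_closed_diff[OF dB, of "\<phi> a - of_int _ * _"]) auto
          then have "\<phi> b \<in> B i" by (simp add: k algebra_simps)
          then obtain e where e: "e \<in> carrier F" "b = h e" using low b by auto
          have "a = b \<otimes> h c" using a h_carr[OF keysS] by (simp add: b_def G.m_assoc)
          also have "\<dots> = h (e \<otimes>\<^bsub>F\<^esub> c)" using h.hom_mult[of e c] e keysS by (simp add: F_def)
          finally have "a = h (e \<otimes>\<^bsub>F\<^esub> c)" .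
          moreover have "e \<otimes>\<^bsub>F\<^esub> c \<in> carrier F"
            using e(1) keysS by (intro h.G.m_closed) (auto simp: F_def)
          ultimately show ?thesis by blast
        qed
      qed
    qed
  qed
  have "a \<in> h ` carrier F" if a: "a \<in> carrier G" for a
    using in_M_or_below[OF span[OF a]] ker[OF a] surj_step a one_img by blast
  then have "h \<in> iso F G"
    unfolding h.iso_iff using inj by (simp add: F_def subsetI)
  then have "F \<cong> G" by (auto simp: is_iso_def)
  moreover have "group F" by (simp add: F_def)
  ultimately have "G \<cong> F" by (rule group.iso_sym[rotated])
  then show ?thesis using G unfolding free_abelian_def F_def by blast
qed

section \<open>Integer-valued functions modulo an ideal of sets\<close>

lemma of_int_fun_apply [simp]: "(of_int k :: 'p \<Rightarrow> 'b::comm_ring_1) p = of_int k"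
  by (cases k) (simp_all add: of_nat_fun_apply)

definition ind :: "'p set \<Rightarrow> 'p \<Rightarrow> int" where
  "ind S p = of_bool (p \<in> S)"

lemma ind_Int: "ind (S \<inter> T) = ind S * ind T"
  by (auto simp: ind_def fun_eq_iff)

lemma ind_Compl: "ind (- S) = 1 - ind S"
  by (auto simp: ind_def fun_eq_iff)

lemma ind_UNIV [simp]: "ind UNIV = 1"
  by (auto simp: ind_def fun_eq_iff)

lemma diff_closed_sum:
  assumes "diff_closed A" "\<And>i. i \<in> I \<Longrightarrow> f i \<in> A"
  shows "sum f I \<in> A"
  using assms(2)
  by (induction I rule: infinite_finite_induct)
    (auto simp: diff_closed_0[OF assms(1)] intro: diff_closed_add[OF assms(1)])

lemma zspan_UnD:
  assumes "y \<in> zspan (A \<union> B)"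
  obtains a b where "a \<in> zspan A" "b \<in> zspan B" "y = a + b"
proof -
  have "\<exists>a\<in>zspan A. \<exists>b\<in>zspan B. y = a + b"
    using assms
  proof (induction rule: zspan_induct)
    case zero
    then show ?case by (intro bexI[of _ 0]) (auto simp: zspan_0)
  next
    case (base x)
    then show ?case
    proof
      assume "x \<in> A"
      then show ?thesis by (intro bexI[of _ x] bexI[of _ 0]) (auto simp: zspan_0 zspan_base)
    next
      assume "x \<in> B"
      then show ?thesis by (intro bexI[of _ 0] bexI[of _ x]) (auto simp: zspan_0 zspan_base)
    qed
  next
    case (diff x y)
    then obtain a b a' b' where "a \<in> zspan A" "b \<in> zspan B" "x = a + b"
      "a' \<in> zspan A" "b' \<in> zspan B" "y = a' + b'" by blast
    then show ?case
      by (intro bexI[of _ "a - a'"] bexI[of _ "b - b'"]) (auto intro: zspan_diff)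
  qed
  then show thesis using that by blast
qed

lemma zspan_of_diff_closed: "diff_closed A \<Longrightarrow> zspan A = A"
  using zspan_least[of A A] zspan_base by blast

lemma zspan_mult_into:
  fixes S :: "'b::comm_ring_1 set"
  assumes "a \<in> zspan S" "diff_closed A" "\<And>s. s \<in> S \<Longrightarrow> s * b \<in> A"
  shows "a * b \<in> A"
  using assms(1)
  by (induction rule: zspan_induct)
    (auto simp: left_diff_distrib diff_closed_0[OF assms(2)] assms(3) intro: diff_closed_diff[OF assms(2)])

text \<open>
The subring of \<open>'p \<Rightarrow> int\<close> generated by the indicator functions of members of \<open>U\<close>.  Its elements are the functions
of finite range all of whose level sets lie in the Boolean algebra generated by \<open>U\<close>.
\<close>

definition set_ring :: "'p set set \<Rightarrow> ('p \<Rightarrow> int) set" where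
  "set_ring U = zspan {ind (\<Inter>F) |F. finite F \<and> F \<subseteq> U}"

lemma diff_closed_set_ring: "diff_closed (set_ring U)"
  by (simp add: set_ring_def diff_closed_zspan)

lemma set_ring_Inter: "finite F \<Longrightarrow> F \<subseteq> U \<Longrightarrow> ind (\<Inter>F) \<in> set_ring U"
  by (auto simp: set_ring_def intro: zspan_base)

lemma set_ring_ind: "S \<in> U \<Longrightarrow> ind S \<in> set_ring U"
  using set_ring_Inter[of "{S}" U] by simp

lemma set_ring_1: "1 \<in> set_ring U"
  using set_ring_Inter[of "{}" U] by simp

lemma set_ring_mono: "U \<subseteq> V \<Longrightarrow> set_ring U \<subseteq> set_ring V"
  unfolding set_ring_def by (rule zspan_mono) blast

lemma set_ring_mult:
  assumes "a \<in> set_ring U" "b \<in> set_ring U"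
  shows "a * b \<in> set_ring U"
  using assms(1)[unfolded set_ring_def] diff_closed_set_ring
proof (rule zspan_mult_into)
  fix s assume "s \<in> {ind (\<Inter>F) |F. finite F \<and> F \<subseteq> U}"
  then obtain F where F: "finite F" "F \<subseteq> U" "s = ind (\<Inter>F)" by blast
  have "b * s \<in> set_ring U"
    using assms(2)[unfolded set_ring_def] diff_closed_set_ring
  proof (rule zspan_mult_into)
    fix t assume "t \<in> {ind (\<Inter>F) |F. finite F \<and> F \<subseteq> U}"
    then obtain E where E: "finite E" "E \<subseteq> U" "t = ind (\<Inter>E)" by blast
    have "t * s = ind (\<Inter>(E \<union> F))" by (simp add: E F Inter_Un_distrib ind_Int)
    then show "t * s \<in> set_ring U" using E F set_ring_Inter[of "E \<union> F" U] by simp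
  qed
  then show "s * b \<in> set_ring U" by (simp add: mult.commute)
qed

lemma set_ring_Union:
  assumes "finite I" "\<And>i. i \<in> I \<Longrightarrow> ind (S i) \<in> set_ring U"
  shows "ind (\<Union>i\<in>I. S i) \<in> set_ring U"
proof -
  have "ind (- (\<Union>i\<in>I. S i)) \<in> set_ring U"
    using assms
  proof (induction I rule: finite_induct)
    case empty
    have "- (\<Union>i\<in>{}. S i) = UNIV" by simp
    then show ?case by (simp only: ind_UNIV set_ring_1)
  next
    case (insert i I)
    have "ind (- S i) \<in> set_ring U"
      using insert.prems[of i] by (simp add: ind_Compl diff_closed_diff[OF diff_closed_set_ring set_ring_1])
    moreover have "ind (- (\<Union>i\<in>I. S i)) \<in> set_ring U" using insert by simp
    moreover have "- (\<Union>i\<in>insert i I. S i) = - S i \<inter> - (\<Union>i\<in>I. S i)" by simp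
    ultimately show ?case by (simp only: ind_Int set_ring_mult)
  qed
  then have "1 - ind (- (\<Union>i\<in>I. S i)) \<in> set_ring U"
    by (rule diff_closed_diff[OF diff_closed_set_ring set_ring_1])
  moreover have "1 - ind (- (\<Union>i\<in>I. S i)) = ind (\<Union>i\<in>I. S i)"
    by (simp only: ind_Compl) simp
  ultimately show ?thesis by simp
qed

lemma set_ring_levels:
  assumes "f \<in> set_ring U"
  shows "finite (range f) \<and> (\<forall>k. ind (f -` {k}) \<in> set_ring U)"
  using assms[unfolded set_ring_def]
proof (induction rule: zspan_induct)
  case zero
  have "ind ((0::'a \<Rightarrow> int) -` {k}) \<in> set_ring U" for k
  proof (cases "k = 0")
    case True
    then have "(0::'a \<Rightarrow> int) -` {k} = UNIV" by auto
    then show ?thesis by (simp add: set_ring_1)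
  next
    case False
    then have "(0::'a \<Rightarrow> int) -` {k} = {}" by auto
    moreover have "ind {} = (0 :: 'a \<Rightarrow> int)" by (auto simp: ind_def fun_eq_iff)
    ultimately show ?thesis by (simp add: diff_closed_0[OF diff_closed_set_ring])
  qed
  moreover have "range (0::'a \<Rightarrow> int) \<subseteq> {0}" by auto
  ultimately show ?case using finite_subset by blast
next
  case (base f)
  then obtain F where F: "finite F" "F \<subseteq> U" "f = ind (\<Inter>F)" by blast
  have f: "f \<in> set_ring U" using F by (simp add: set_ring_Inter)
  have "ind (f -` {k}) \<in> set_ring U" for k
  proof -
    consider "k = 1" | "k = 0" | "k \<noteq> 0" "k \<noteq> 1" by blast
    then show ?thesis
    proof cases
      case 1
      then have "f -` {k} = \<Inter>F" by (auto simp: F ind_def split: if_splits)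
      then show ?thesis using F f by simp
    next
      case 2
      then have "f -` {k} = - \<Inter>F" by (auto simp: F ind_def split: if_splits)
      then show ?thesis using F f
        by (simp only: ind_Compl diff_closed_diff[OF diff_closed_set_ring set_ring_1])
    next
      case 3
      then have "ind (f -` {k}) = 0" by (auto simp: F ind_def fun_eq_iff)
      then show ?thesis by (simp add: diff_closed_0[OF diff_closed_set_ring])
    qed
  qed
  moreover have "range f \<subseteq> {0, 1}" by (auto simp: F ind_def)
  ultimately show ?case by (auto intro: finite_subset)
next
  case (diff f g)
  have "range (f - g) \<subseteq> (\<lambda>(a, b). a - b) ` (range f \<times> range g)" by auto
  then have "finite (range (f - g))"
    using diff by (meson finite_SigmaI finite_imageI finite_subset)
  moreover have "ind ((f - g) -` {k}) \<in> set_ring U" for k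
  proof -
    let ?I = "{ab \<in> range f \<times> range g. fst ab - snd ab = k}"
    have "(f - g) -` {k} = (\<Union>ab\<in>?I. f -` {fst ab} \<inter> g -` {snd ab})" by force
    moreover have "finite ?I" using diff by simp
    moreover have "ind (f -` {fst ab} \<inter> g -` {snd ab}) \<in> set_ring U" for ab
      using diff by (simp add: ind_Int set_ring_mult)
    ultimately show ?thesis by (simp only: set_ring_Union)
  qed
  ultimately show ?case by blast
qed

text \<open>
Applied to a pair \<open>h\<close> of functions, this writes both components as combinations of the same disjoint
indicator functions.
\<close>

lemma sum_of_levels:
  assumes "finite I" "\<And>p. h p \<in> I"
  shows "(\<Sum>i\<in>I. of_int (c i) * ind (h -` {i})) = (\<lambda>p. c (h p))"
proof
  fix p
  have "(\<Sum>i\<in>I. of_int (c i) * ind (h -` {i})) p = (\<Sum>i\<in>I. if h p = i then c i else 0)"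
    by (induction I rule: infinite_finite_induct) (auto simp: ind_def)
  also have "\<dots> = c (h p)" using assms by simp
  finally show "(\<Sum>i\<in>I. of_int (c i) * ind (h -` {i})) p = c (h p)" .
qed

text \<open>
Adjoining one indicator function \<open>e\<close> to the ring of \<open>V\<close> keeps the quotients torsion-free.  If \<open>n r e = b + j\<close> with
\<open>b\<close> in the ring and \<open>j \<in> J\<close>, decompose \<open>r\<close> and \<open>b\<close> along common disjoint idempotents \<open>f\<close>, on which they have
constant values \<open>u\<close> and \<open>w\<close>.  Multiplying by \<open>f e\<close> and by \<open>f (1 - e)\<close> puts \<open>(n u - w) f e\<close> and \<open>w f (1 - e)\<close> into
\<open>J\<close>.  Either \<open>u = 0\<close>, or one of the integers \<open>n u - w\<close>, \<open>w\<close> is nonzero, and purity of \<open>J\<close> puts \<open>f e\<close> or \<open>f - f e\<close> into \<open>J\<close>.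
\<close>

lemma idempotent_multiple_pure:
  assumes J: "diff_closed J"
    and ideal: "\<And>a j. a \<in> set_ring U \<Longrightarrow> j \<in> J \<Longrightarrow> a * j \<in> J"
    and pure: "\<And>a n. a \<in> set_ring U \<Longrightarrow> n \<noteq> 0 \<Longrightarrow> of_int n * a \<in> J \<Longrightarrow> a \<in> J"
    and V: "V \<subseteq> U" "e \<in> U"
    and r: "r \<in> set_ring V" and n: "n \<noteq> 0"
    and nr: "of_int n * (r * ind e) \<in> zspan (set_ring V \<union> J)"
  shows "r * ind e \<in> zspan (set_ring V \<union> J)"
proof -
  note [simp] = zspan_of_diff_closed[OF J] zspan_of_diff_closed[OF diff_closed_set_ring]
  have VU: "set_ring V \<subseteq> set_ring U" using V by (intro set_ring_mono)
  have e: "ind e \<in> set_ring U" using V by (intro set_ring_ind)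
  obtain b j where b: "b \<in> set_ring V" and j: "j \<in> J" and eq: "of_int n * (r * ind e) = b + j"
    using zspan_UnD[OF nr] by auto
  define h where "h p = (r p, b p)" for p
  define I where "I = range r \<times> range b"
  have finI: "finite I"
    using set_ring_levels[OF r] set_ring_levels[OF b] by (simp add: I_def)
  have hI: "h p \<in> I" for p by (simp add: h_def I_def)
  have piece: "of_int (fst i) * ind (h -` {i}) * ind e \<in> zspan (set_ring V \<union> J)" for i
  proof -
    obtain u w where i: "i = (u, w)" by force
    define f where "f = ind (h -` {i})"
    have "h -` {i} = r -` {u} \<inter> b -` {w}" by (auto simp: h_def i)
    then have fV: "f \<in> set_ring V"
      using set_ring_levels[OF r] set_ring_levels[OF b]
      by (simp add: f_def ind_Int set_ring_mult)
    with VU have fU: "f \<in> set_ring U" by blast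
    have fe: "f * ind e \<in> set_ring U" by (rule set_ring_mult[OF fU e])
    have fe': "f * (1 - ind e) \<in> set_ring U"
      by (rule set_ring_mult[OF fU diff_closed_diff[OF diff_closed_set_ring set_ring_1 e]])
    have jp: "j p = n * (r p * ind e p) - b p" for p
      using fun_cong[OF eq, of p] by simp
    have "f * ind e * j = of_int (n * u - w) * (f * ind e)"
      by (auto simp: fun_eq_iff jp f_def ind_def h_def i)
    with ideal[OF fe j] have nuw: "of_int (n * u - w) * (f * ind e) \<in> J" by simp
    have "f * (1 - ind e) * j = of_int (- w) * (f * (1 - ind e))"
      by (auto simp: fun_eq_iff jp f_def ind_def h_def i)
    with ideal[OF fe' j] have 2: "of_int (- w) * (f * (1 - ind e)) \<in> J" by simp
    consider "n * u - w \<noteq> 0" | "u = 0" | "w \<noteq> 0" using n by (cases "w = 0") auto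
    then have "f * ind e \<in> zspan (set_ring V \<union> J) \<or> u = 0"
    proof cases
      case 1
      with pure[OF fe _ nuw] show ?thesis by (auto intro: zspan_base)
    next
      case 3
      with pure[OF fe' _ 2] have "f * (1 - ind e) \<in> J" by simp
      then have "f - f * (1 - ind e) \<in> zspan (set_ring V \<union> J)"
        using fV by (intro zspan_diff) (auto intro: zspan_base)
      then show ?thesis by (simp add: algebra_simps)
    qed simp
    then show ?thesis
      using zspan_of_int_mult[of "f * ind e" _ u] by (auto simp: i f_def mult.assoc zspan_0)
  qed
  have "r = (\<Sum>i\<in>I. of_int (fst i) * ind (h -` {i}))"
    using sum_of_levels[of I h fst, OF finI hI] by (simp add: h_def)
  then have "r * ind e = (\<Sum>i\<in>I. of_int (fst i) * ind (h -` {i}) * ind e)"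
    by (simp add: sum_distrib_right)
  also have "\<dots> \<in> zspan (set_ring V \<union> J)"
    by (rule diff_closed_sum[OF diff_closed_zspan piece])
  finally show ?thesis .
qed

text \<open>
Finite sets are represented by strictly decreasing lists, on which \<open>lexord\<close> compares greatest elements first.
\<close>

abbreviation decr :: "('a \<times> 'a) set \<Rightarrow> 'a list \<Rightarrow> bool" where
  "decr r \<equiv> sorted_wrt (\<lambda>x y. (y, x) \<in> r)"

lemma decr_list_of_finite:
  assumes "finite F" "total r" "trans r"
  shows "\<exists>m. decr r m \<and> set m = F"
  using assms(1)
proof (induction F rule: finite_psubset_induct)
  case (psubset F)
  show ?case
  proof (cases "F = {}")
    case True
    then show ?thesis by (intro exI[of _ "[]"]) simp
  next
    case False
    obtain i where i: "i \<in> F" "\<forall>j\<in>F. j = i \<or> (j, i) \<in> r"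
      using finite_total_top[OF psubset.hyps(1) False subset_UNIV assms(2,3)] by blast
    have "F - {i} \<subset> F" using i by blast
    from psubset.IH[OF this] obtain m where "decr r m" "set m = F - {i}" by blast
    then show ?thesis using i by (intro exI[of _ "i # m"]) auto
  qed
qed

lemma lexord_decr_below:
  assumes "(m, l) \<in> lexord r" "decr r m" "trans r" "set l \<subseteq> U" "\<And>x y. x \<in> U \<Longrightarrow> (y, x) \<in> r \<Longrightarrow> y \<in> U"
  shows "set m \<subseteq> U"
proof (cases m)
  case (Cons a t)
  with assms(1) obtain b s where l: "l = b # s" by (cases l) auto
  have "a = b \<or> (a, b) \<in> r" using assms(1) Cons l by auto
  then have a: "a \<in> U" using l assms(4,5) by auto
  then have "x \<in> U" if "x \<in> set t" for x using assms(2,5) Cons that by auto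
  with a show ?thesis using Cons by auto
qed simp

text \<open>
The lexicographic order on all lists over a well-order is not well-founded; on strictly decreasing lists it is,
by induction on the head and, for a fixed head, on the accessible tail.
\<close>

lemma wf_lexord_decr:
  assumes "wf r"
  shows "wf {(l, m). (l, m) \<in> lexord r \<and> decr r l \<and> decr r m}" (is "wf ?R")
proof -
  have nil: "[] \<in> Wellfounded.acc ?R" by (rule accI) auto
  have "\<forall>t. decr r (a # t) \<longrightarrow> a # t \<in> Wellfounded.acc ?R" for a
    using assms
  proof (induction a rule: wf_induct_rule)
    case (less a)
    have sub: "l \<in> Wellfounded.acc ?R" if "decr r l" "\<And>b. b \<in> set l \<Longrightarrow> (b, a) \<in> r" for l
      using that less nil by (cases l) auto
    show ?case
    proof (intro allI impI)
      fix t assume t: "decr r (a # t)"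
      then have "t \<in> Wellfounded.acc ?R" by (intro sub) auto
      then have "decr r (a # t) \<longrightarrow> a # t \<in> Wellfounded.acc ?R"
      proof (rule acc_induct, intro impI)
        fix t assume IH: "\<forall>s. (s, t) \<in> ?R \<longrightarrow> decr r (a # s) \<longrightarrow> a # s \<in> Wellfounded.acc ?R"
          and t: "decr r (a # t)"
        show "a # t \<in> Wellfounded.acc ?R"
        proof (rule accI)
          fix l assume "(l, a # t) \<in> ?R"
          then have l: "(l, a # t) \<in> lexord r" "decr r l" by auto
          show "l \<in> Wellfounded.acc ?R"
          proof (cases l)
            case Nil
            then show ?thesis using nil by simp
          next
            case (Cons b s)
            then consider "(b, a) \<in> r" | "b = a" "(s, t) \<in> lexord r" using l by auto
            then show ?thesis
            proof cases
              case 1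
              then show ?thesis using less[of b] l(2) Cons by blast
            next
              case 2
              then have "(s, t) \<in> ?R" using l(2) Cons t by auto
              then show ?thesis using IH l(2) Cons 2 by auto
            qed
          qed
        qed
      qed
      then show "a # t \<in> Wellfounded.acc ?R" using t by blast
    qed
  qed
  then have all: "l \<in> Wellfounded.acc ?R" if "decr r l" for l
    using that nil by (cases l) auto
  have "l \<in> Wellfounded.acc ?R" for l
    by (rule accI) (use all in auto)
  then show ?thesis by (simp add: acc_wfI)
qed

definition monomial :: "'p set list \<Rightarrow> 'p \<Rightarrow> int" where
  "monomial l = ind (\<Inter>(set l))"

lemma monomial_Nil [simp]: "monomial [] = 1"
  by (simp add: monomial_def)

lemma monomial_Cons: "monomial (e # l) = monomial l * ind e"
  by (simp add: monomial_def ind_Int mult.commute)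

lemma monomial_in_set_ring: "set l \<subseteq> U \<Longrightarrow> monomial l \<in> set_ring U"
  by (simp add: monomial_def set_ring_Inter)

text \<open>
Purity of the filtration by monomials, by induction on the list.  A monomial smaller than \<open>e l\<close> either involves only
sets below \<open>e\<close>, and these span the ring of \<open>V = {y. y < e}\<close>, or is \<open>e\<close> times a monomial smaller than \<open>l\<close>.  So a relation
for \<open>n e l\<close> says that \<open>n l - s\<close>, with \<open>s\<close> in the span of the monomials below \<open>l\<close>, belongs to
\<open>I = {a. a e \<in> set_ring V + J}\<close>.  By \<open>idempotent_multiple_pure\<close> this \<open>I\<close> is again a pure ideal, now of the ring of \<open>V\<close>,
and the induction hypothesis for \<open>l\<close> and \<open>I\<close> applies.  This is why \<open>U\<close> and \<open>J\<close> vary in the induction.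
\<close>

lemma smaller_monomials_pure:
  assumes r: "total r" "trans r"
    and down: "\<And>x y. x \<in> U \<Longrightarrow> (y, x) \<in> r \<Longrightarrow> y \<in> U"
    and J: "diff_closed J"
    and ideal: "\<And>a j. a \<in> set_ring U \<Longrightarrow> j \<in> J \<Longrightarrow> a * j \<in> J"
    and pure: "\<And>a n. a \<in> set_ring U \<Longrightarrow> n \<noteq> 0 \<Longrightarrow> of_int n * a \<in> J \<Longrightarrow> a \<in> J"
    and l: "decr r l" "set l \<subseteq> U" and n: "n \<noteq> 0"
    and nl: "of_int n * monomial l \<in> zspan (J \<union> monomial ` {m. decr r m \<and> (m, l) \<in> lexord r})"
  shows "monomial l \<in> zspan (J \<union> monomial ` {m. decr r m \<and> (m, l) \<in> lexord r})"
proof -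
  \<comment> \<open>Packing the statement into a predicate lets plain list induction vary the ring and the ideal.\<close>
  define P where "P l \<longleftrightarrow> (\<forall>U J. (\<forall>x\<in>U. \<forall>y. (y, x) \<in> r \<longrightarrow> y \<in> U) \<longrightarrow> diff_closed J \<longrightarrow>
      (\<forall>a\<in>set_ring U. \<forall>j\<in>J. a * j \<in> J) \<longrightarrow> (\<forall>a\<in>set_ring U. \<forall>n. n \<noteq> 0 \<longrightarrow> of_int n * a \<in> J \<longrightarrow> a \<in> J) \<longrightarrow>
      decr r l \<longrightarrow> set l \<subseteq> U \<longrightarrow>
      of_int n * monomial l \<in> zspan (J \<union> monomial ` {m. decr r m \<and> (m, l) \<in> lexord r}) \<longrightarrow>
      monomial l \<in> zspan (J \<union> monomial ` {m. decr r m \<and> (m, l) \<in> lexord r}))" for l :: "'a set list"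
  have "P []"
    unfolding P_def
  proof (intro allI impI)
    fix U :: "'a set set" and J :: "('a \<Rightarrow> int) set"
    assume J: "diff_closed J"
      and pure: "\<forall>a\<in>set_ring U. \<forall>n. n \<noteq> 0 \<longrightarrow> of_int n * a \<in> J \<longrightarrow> a \<in> J"
      and nl: "of_int n * monomial [] \<in> zspan (J \<union> monomial ` {m. decr r m \<and> (m, []) \<in> lexord r})"
    have "monomial [] \<in> J"
      using nl pure n monomial_in_set_ring[of "[]" U] by (simp add: zspan_of_diff_closed[OF J])
    then show "monomial [] \<in> zspan (J \<union> monomial ` {m. decr r m \<and> (m, []) \<in> lexord r})"
      by (rule zspan_base[OF UnI1])
  qed
  moreover have "P (e # l)" if IH: "P l" for e l
    unfolding P_def
  proof (intro allI impI)
    fix U :: "'a set set" and J :: "('a \<Rightarrow> int) set"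
    assume down': "\<forall>x\<in>U. \<forall>y. (y, x) \<in> r \<longrightarrow> y \<in> U" and J: "diff_closed J"
      and ideal': "\<forall>a\<in>set_ring U. \<forall>j\<in>J. a * j \<in> J"
      and pure': "\<forall>a\<in>set_ring U. \<forall>n. n \<noteq> 0 \<longrightarrow> of_int n * a \<in> J \<longrightarrow> a \<in> J"
      and l: "decr r (e # l)" "set (e # l) \<subseteq> U"
      and nl: "of_int n * monomial (e # l) \<in> zspan (J \<union> monomial ` {m. decr r m \<and> (m, e # l) \<in> lexord r})"
    note down = down'[rule_format] and ideal = ideal'[rule_format] and pure = pure'[rule_format]
    define V where "V = {y. (y, e) \<in> r}"
    have eU: "e \<in> U" and decl: "decr r l" and lV: "set l \<subseteq> V" using l by (auto simp: V_def)
    have VU: "V \<subseteq> U" using down[OF eU] by (auto simp: V_def)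
    have downV: "y \<in> V" if "x \<in> V" "(y, x) \<in> r" for x y
      using that transD[OF r(2)] unfolding V_def by blast
    define Lo where "Lo l = monomial ` {m. decr r m \<and> (m, l) \<in> lexord r}" for l
    define S where "S = zspan (J \<union> Lo (e # l))"
    define I where "I = {a \<in> set_ring V. a * ind e \<in> zspan (set_ring V \<union> J)}"
    have VJ_mult: "b * y \<in> zspan (set_ring V \<union> J)" if "b \<in> set_ring V" "y \<in> zspan (set_ring V \<union> J)" for b y
    proof -
      have "y * b \<in> zspan (set_ring V \<union> J)"
        using that(2) diff_closed_zspan
      proof (rule zspan_mult_into)
        fix s assume "s \<in> set_ring V \<union> J"
        then have "b * s \<in> set_ring V \<union> J" using that(1) set_ring_mult ideal set_ring_mono[OF VU] by blast
        then show "s * b \<in> zspan (set_ring V \<union> J)" by (simp add: zspan_base mult.commute)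
      qed
      then show ?thesis by (simp add: mult.commute)
    qed
    have I: "diff_closed I"
      unfolding diff_closed_def I_def
      by (auto simp: zspan_0 left_diff_distrib diff_closed_0[OF diff_closed_set_ring]
          intro: diff_closed_diff[OF diff_closed_set_ring] zspan_diff)
    have I_ideal: "a * j \<in> I" if "a \<in> set_ring V" "j \<in> I" for a j
      using that VJ_mult[of a "j * ind e"] by (auto simp: I_def set_ring_mult mult.assoc)
    have I_pure: "a \<in> I" if "a \<in> set_ring V" "k \<noteq> 0" "of_int k * a \<in> I" for a k
      using idempotent_multiple_pure[OF J ideal pure VU eU that(1,2)] that by (auto simp: I_def mult.assoc)

    have lowV: "set m \<subseteq> V" if "decr r m" "(m, l) \<in> lexord r" for m
      by (rule lexord_decr_below[OF that(2,1) r(2) lV downV])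
    have Lo_V: "Lo l \<subseteq> set_ring V"
      using lowV by (auto simp: Lo_def intro!: monomial_in_set_ring)

    define T where "T = {y. \<exists>s\<in>zspan (Lo l). y - s * ind e \<in> zspan (set_ring V \<union> J)}"
    have TI: "y \<in> T" if "s \<in> zspan (Lo l)" "y - s * ind e \<in> zspan (set_ring V \<union> J)" for y s
      using that unfolding T_def by blast
    have TI0: "y \<in> T" if "y \<in> set_ring V \<union> J" for y
      by (rule TI[OF zspan_0]) (use zspan_base[OF that] in simp)
    have "S \<subseteq> T"
      unfolding S_def
    proof (rule zspan_least)
      have "0 \<in> T" by (rule TI0) (simp add: diff_closed_0[OF J])
      moreover have "x - y \<in> T" if xy: "x \<in> T" "y \<in> T" for x y
      proof -
        obtain s t where st: "s \<in> zspan (Lo l)" "t \<in> zspan (Lo l)"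
          "x - s * ind e \<in> zspan (set_ring V \<union> J)" "y - t * ind e \<in> zspan (set_ring V \<union> J)"
          using xy unfolding T_def by blast
        have "(x - s * ind e) - (y - t * ind e) \<in> zspan (set_ring V \<union> J)"
          using st(3,4) by (rule zspan_diff)
        also have "(x - s * ind e) - (y - t * ind e) = (x - y) - (s - t) * ind e"
          by (simp add: algebra_simps)
        finally show ?thesis by (rule TI[OF zspan_diff[OF st(1,2)]])
      qed
      ultimately show "diff_closed T" unfolding diff_closed_def by blast
      have "monomial m \<in> T" if m: "decr r m" "(m, e # l) \<in> lexord r" for m
      proof (cases "set m \<subseteq> V")
        case True
        then show ?thesis by (intro TI0 UnI1 monomial_in_set_ring)
      next
        case False
        then obtain b t where mbt: "m = b # t" by (cases m) auto
        have "(b, e) \<notin> r"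
        proof
          assume be: "(b, e) \<in> r"
          have "(x, e) \<in> r" if "x \<in> set t" for x
            using m(1) mbt that transD[OF r(2) _ be] by auto
          with be mbt False show False by (auto simp: V_def)
        qed
        then have bt: "b = e" "(t, l) \<in> lexord r" "decr r t" using m mbt by auto
        then have "monomial t \<in> zspan (Lo l)" by (auto simp: Lo_def intro: zspan_base)
        moreover have "monomial m - monomial t * ind e = 0" by (simp add: mbt bt monomial_Cons)
        ultimately show ?thesis using TI[of "monomial t" "monomial m"] zspan_0[of "set_ring V \<union> J"] by simp
      qed
      then show "J \<union> Lo (e # l) \<subseteq> T" using TI0 by (auto simp: Lo_def)
    qed

    have nS: "of_int n * monomial (e # l) \<in> S"
      using nl by (simp add: S_def Lo_def)
    with \<open>S \<subseteq> T\<close> obtain s where s: "s \<in> zspan (Lo l)"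
      and "of_int n * monomial (e # l) - s * ind e \<in> zspan (set_ring V \<union> J)" unfolding T_def by blast
    then have "(of_int n * monomial l - s) * ind e \<in> zspan (set_ring V \<union> J)"
      by (simp add: monomial_Cons algebra_simps)
    moreover have "s \<in> set_ring V" using s zspan_least[OF diff_closed_set_ring Lo_V] by blast
    then have "of_int n * monomial l - s \<in> set_ring V"
      using lV by (intro diff_closed_diff[OF diff_closed_set_ring] diff_closed_of_int_mult[OF diff_closed_set_ring] monomial_in_set_ring)
    ultimately have "of_int n * monomial l - s \<in> I" by (simp add: I_def)
    then have "(of_int n * monomial l - s) + s \<in> zspan (I \<union> Lo l)"
      using s zspan_mono[of "Lo l" "I \<union> Lo l"] by (intro zspan_add) (auto intro: zspan_base)
    then have n_in: "of_int n * monomial l \<in> zspan (I \<union> Lo l)" by simp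
    have l_in: "monomial l \<in> zspan (I \<union> Lo l)"
      unfolding Lo_def
    proof (rule IH[unfolded P_def, THEN spec[of _ V], THEN spec[of _ I], rule_format])
      show "y \<in> V" if "x \<in> V" "(y, x) \<in> r" for x y using that by (rule downV)
      show "diff_closed I" by (rule I)
      show "a * j \<in> I" if "a \<in> set_ring V" "j \<in> I" for a j using that by (rule I_ideal)
      show "a \<in> I" if "a \<in> set_ring V" "k \<noteq> 0" "of_int k * a \<in> I" for a k using that by (rule I_pure)
      show "decr r l" by (rule decl)
      show "set l \<subseteq> V" by (rule lV)
      show "of_int n * monomial l \<in> zspan (I \<union> monomial ` {m. decr r m \<and> (m, l) \<in> lexord r})"
        using n_in unfolding Lo_def .
    qed

    have algV_S: "set_ring V \<subseteq> S"
      unfolding set_ring_def S_def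
    proof (rule zspan_subset, clarify)
      fix F assume F: "finite F" "F \<subseteq> V"
      then obtain m where m: "decr r m" "set m = F" using decr_list_of_finite[OF _ r] by blast
      have "(m, e # l) \<in> lexord r" using F m by (cases m) (auto simp: V_def)
      then have "monomial m \<in> Lo (e # l)" using m by (auto simp: Lo_def)
      then show "ind (\<Inter>F) \<in> zspan (J \<union> Lo (e # l))" using m by (auto simp: monomial_def intro: zspan_base)
    qed
    have VJS: "zspan (set_ring V \<union> J) \<subseteq> S"
      using algV_S unfolding S_def by (intro zspan_subset) (auto intro: zspan_base)
    have "monomial l * ind e \<in> S"
      using l_in
    proof (rule zspan_mult_into)
      show "diff_closed S" by (simp add: S_def diff_closed_zspan)
      fix y assume "y \<in> I \<union> Lo l"
      then show "y * ind e \<in> S"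
      proof
        assume "y \<in> I"
        then show ?thesis using VJS by (auto simp: I_def)
      next
        assume "y \<in> Lo l"
        then obtain m where m: "y = monomial m" "decr r m" "(m, l) \<in> lexord r" by (auto simp: Lo_def)
        then have "decr r (e # m)" using lowV[of m] by (auto simp: V_def)
        then have "monomial (e # m) \<in> Lo (e # l)" using m by (auto simp: Lo_def)
        then show ?thesis using m by (auto simp: S_def monomial_Cons intro: zspan_base)
      qed
    qed
    then show "monomial (e # l) \<in> zspan (J \<union> monomial ` {m. decr r m \<and> (m, e # l) \<in> lexord r})"
      by (simp add: monomial_Cons S_def Lo_def)
  qed
  ultimately have "P l" by (rule list.induct)
  show ?thesis
  proof (rule \<open>P l\<close>[unfolded P_def, THEN spec[of _ U], THEN spec[of _ J], rule_format])
    show "y \<in> U" if "x \<in> U" "(y, x) \<in> r" for x y using that by (rule down)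
    show "diff_closed J" by (rule J)
    show "a * j \<in> J" if "a \<in> set_ring U" "j \<in> J" for a j using that by (rule ideal)
    show "a \<in> J" if "a \<in> set_ring U" "k \<noteq> 0" "of_int k * a \<in> J" for a k using that by (rule pure)
    show "decr r l" "set l \<subseteq> U" by (rule l)+
    show "of_int n * monomial l \<in> zspan (J \<union> monomial ` {m. decr r m \<and> (m, l) \<in> lexord r})" by (rule nl)
  qed
qed

text \<open>
The set \<open>\<N>\<close> is an ideal of negligible sets, and \<open>M\<close> is spanned by the indicator functions of \<open>\<C>\<close> together with the functions that vanish
off a negligible set.  The point \<open>p0\<close> lies in no member of \<open>\<N> \<union> \<C>\<close>, so that \<open>f p0 = 0\<close> for all \<open>f \<in> M\<close>; this
makes the empty monomial \<open>1\<close> torsion-free modulo \<open>M\<close>.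
\<close>

theorem free_abelian_modulo_sets:
  fixes \<phi> :: "'g \<Rightarrow> 'p \<Rightarrow> int" and \<N> \<C> :: "'p set set"
  defines "M \<equiv> zspan (ind ` \<C> \<union> {f. {p. f p \<noteq> 0} \<in> \<N>})"
  assumes G: "comm_group G"
    and N: "{} \<in> \<N>" "\<And>S T. S \<in> \<N> \<Longrightarrow> T \<subseteq> S \<Longrightarrow> T \<in> \<N>" "\<And>S T. S \<in> \<N> \<Longrightarrow> T \<in> \<N> \<Longrightarrow> S \<union> T \<in> \<N>"
    and C: "\<And>S T. S \<in> \<C> \<Longrightarrow> T \<in> \<C> \<Longrightarrow> S \<inter> T \<in> \<C>"
    and p0: "\<And>S. S \<in> \<N> \<union> \<C> \<Longrightarrow> p0 \<notin> S"
    and fin: "\<And>a. a \<in> carrier G \<Longrightarrow> finite (range (\<phi> a))"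
    and hom: "\<And>a b. a \<in> carrier G \<Longrightarrow> b \<in> carrier G \<Longrightarrow> \<phi> (a \<otimes>\<^bsub>G\<^esub> b) - (\<phi> a + \<phi> b) \<in> M"
    and ker: "\<And>a. a \<in> carrier G \<Longrightarrow> \<phi> a \<in> M \<Longrightarrow> a = \<one>\<^bsub>G\<^esub>"
  shows "free_abelian G"
proof -
  define J where "J = {f :: 'p \<Rightarrow> int. {p. f p \<noteq> 0} \<in> \<N>}"
  have J: "diff_closed J"
  proof -
    have "f - g \<in> J" if "f \<in> J" "g \<in> J" for f g
    proof -
      have "{p. (f - g) p \<noteq> 0} \<subseteq> {p. f p \<noteq> 0} \<union> {p. g p \<noteq> 0}" by auto
      then show ?thesis using that N(2,3) unfolding J_def by blast
    qed
    then show ?thesis using N(1) by (simp add: diff_closed_def J_def)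
  qed
  have J_ideal: "a * j \<in> J" if "j \<in> J" for a j
    using that N(2)[of "{p. j p \<noteq> 0}" "{p. (a * j) p \<noteq> 0}"] by (auto simp: J_def)
  have J_pure: "a \<in> J" if "n \<noteq> 0" "of_int n * a \<in> J" for n a
    using that by (simp add: J_def)
  have MJ: "M = zspan (ind ` \<C> \<union> J)" by (simp add: M_def J_def)

  \<comment> \<open>Members of \<open>\<C>\<close> come first, so that every monomial which involves a set outside \<open>\<C>\<close> is larger than
    all indicator functions of members of \<open>\<C>\<close>.\<close>
  obtain r0 :: "'p set rel" where r0: "well_order_on UNIV r0" using well_order_on by blast
  define s where "s = r0 - Id"
  have s: "wf s" "total s" "trans s" "irrefl s"
  proof -
    show "wf s" "total s" "irrefl s" using r0
      by (auto simp: s_def well_order_on_def linear_order_on_def irrefl_def total_on_def)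
    show "trans s" using r0 unfolding s_def well_order_on_def linear_order_on_def partial_order_on_def
        preorder_on_def by (metis trans_diff_Id)
  qed
  define r where "r = {(x, y). (x \<in> \<C> \<and> y \<notin> \<C>) \<or> ((x \<in> \<C> \<longleftrightarrow> y \<in> \<C>) \<and> (x, y) \<in> s)}"
  have "r \<subseteq> inv_image (less_than <*lex*> s) (\<lambda>x. (of_bool (x \<notin> \<C>), x))"
    by (auto simp: r_def inv_image_def)
  then have wf_r: "wf r"
    by (rule wf_subset[OF wf_inv_image[OF wf_lex_prod[OF wf_less_than s(1)]]])
  have total_r: "total r" using s(2) by (auto simp: r_def total_on_def)
  have trans_r: "trans r"
    unfolding trans_def r_def using transD[OF s(3)] by blast
  define I where "I = {l. decr r l}"
  define R where "R = {(l, m). (l, m) \<in> lexord r \<and> decr r l \<and> decr r m}"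
  have wf_R: "wf R" unfolding R_def by (rule wf_lexord_decr[OF wf_r])
  have total_R: "total_on I R"
    using total_lexord[OF total_r] by (auto simp: total_on_def I_def R_def)
  have trans_R: "trans R"
    unfolding trans_def R_def using lexord_trans[OF _ _ trans_r] by blast
  have low: "{m\<in>I. (m, l) \<in> R} = {m. decr r m \<and> (m, l) \<in> lexord r}" if "l \<in> I" for l
    using that by (auto simp: I_def R_def)

  have M: "diff_closed M" by (simp add: M_def diff_closed_zspan)
  show ?thesis
    using G hom ker M wf_R total_R trans_R
  proof (rule free_abelian_of_leading_terms)
    fix a assume a: "a \<in> carrier G"
    have "\<phi> a = (\<Sum>k\<in>range (\<phi> a). of_int k * ind (\<phi> a -` {k}))"
      using sum_of_levels[OF fin[OF a], where h = "\<phi> a" and c = "\<lambda>k. k"] by simp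
    also have "\<dots> \<in> zspan (M \<union> monomial ` I)"
    proof (rule diff_closed_sum[OF diff_closed_zspan])
      fix k
      have "ind (\<phi> a -` {k}) = monomial [\<phi> a -` {k}]" by (simp add: monomial_def)
      then show "of_int k * ind (\<phi> a -` {k}) \<in> zspan (M \<union> monomial ` I)"
        by (intro zspan_of_int_mult zspan_base) (auto simp: I_def)
    qed
    finally show "\<phi> a \<in> zspan (M \<union> monomial ` I)" .
  next
    fix l n assume l: "l \<in> I" and n: "n \<noteq> (0::int)"
      and nl: "of_int n * monomial l \<in> zspan (M \<union> monomial ` {m \<in> I. (m, l) \<in> R})"
    note nl = nl[unfolded low[OF l]]
    have "monomial l \<in> zspan (M \<union> monomial ` {m. decr r m \<and> (m, l) \<in> lexord r})"
    proof (cases l)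
      case Nil
      have "f p0 = 0" if "f \<in> M" for f
        using that unfolding M_def
      proof (induction rule: zspan_induct)
        case (base f)
        then show ?case using p0 by (auto simp: ind_def)
      qed auto
      moreover have "of_int n * monomial l \<in> M"
        using nl Nil by (simp add: zspan_of_diff_closed[OF M])
      ultimately have "(of_int n * monomial l) p0 = 0" by blast
      then show ?thesis using n Nil by simp
    next
      case (Cons e t)
      show ?thesis
      proof (cases "e \<in> \<C>")
        case True
        have sub: "set l \<subseteq> \<C>" using True l Cons by (auto simp: I_def r_def)
        have "\<Inter>F \<in> \<C>" if "finite F" "F \<noteq> {}" "F \<subseteq> \<C>" for F
          using that by (induction F rule: finite_ne_induct) (auto intro: C)
        from this[OF finite_set _ sub] Cons have "\<Inter>(set l) \<in> \<C>" by simp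
        then have "monomial l \<in> M" by (auto simp: monomial_def MJ intro: zspan_base)
        then show ?thesis by (auto intro: zspan_base)
      next
        case False
        let ?L = "monomial ` {m. decr r m \<and> (m, l) \<in> lexord r}"
        have "ind S \<in> ?L" if "S \<in> \<C>" for S
        proof -
          have "([S], l) \<in> lexord r" using that False Cons by (auto simp: r_def)
          then show ?thesis by (intro image_eqI[of _ _ "[S]"]) (auto simp: monomial_def)
        qed
        then have "M \<subseteq> zspan (J \<union> ?L)" unfolding MJ by (intro zspan_mono) auto
        then have "zspan (M \<union> ?L) \<subseteq> zspan (J \<union> ?L)"
          by (intro zspan_subset) (auto intro: zspan_base)
        with nl have nJ: "of_int n * monomial l \<in> zspan (J \<union> ?L)" by blast
        have "monomial l \<in> zspan (J \<union> ?L)"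
        proof (rule smaller_monomials_pure[OF total_r trans_r _ J J_ideal _ _ _ n nJ, of UNIV])
          show "a \<in> J" if "m \<noteq> 0" "of_int m * a \<in> J" for a m
            using that by (rule J_pure)
          show "decr r l" using l by (simp add: I_def)
          show "set l \<subseteq> UNIV" by (rule subset_UNIV)
        qed simp_all
        moreover have "J \<subseteq> M" by (auto simp: MJ intro: zspan_base)
        ultimately show ?thesis using zspan_mono[of "J \<union> ?L" "M \<union> ?L"] by blast
      qed
    qed
    then show "monomial l \<in> zspan (M \<union> monomial ` {m \<in> I. (m, l) \<in> R})" by (simp add: low[OF l])
  qed
qed

section \<open>Modules over a Pruefer domain and their localizations\<close>

lemma fld_simps [simp]:
  "carrier (fld :: 'a::field ring) = UNIV" "x \<otimes>\<^bsub>fld\<^esub> y = x * (y :: 'a)" "\<one>\<^bsub>fld\<^esub> = (1 :: 'a)"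
  "\<zero>\<^bsub>fld\<^esub> = (0 :: 'a)" "x \<oplus>\<^bsub>fld\<^esub> y = x + (y :: 'a)"
  by (simp_all add: ring_of_type_algebra_def)

lemma mprod_prod: "x \<in> I \<Longrightarrow> y \<in> J \<Longrightarrow> x * y \<in> mprod I J"
  using ideal_prod.prod[of x I y J fld] by simp

lemma mprod_add: "x \<in> mprod I J \<Longrightarrow> y \<in> mprod I J \<Longrightarrow> x + y \<in> mprod I J"
  using ideal_prod.sum[of x fld I J y] by simp

lemma mprod_induct [consumes 1, case_names prod add]:
  assumes "z \<in> mprod I J" "\<And>x y. x \<in> I \<Longrightarrow> y \<in> J \<Longrightarrow> Q (x * y)" "\<And>x y. Q x \<Longrightarrow> Q y \<Longrightarrow> Q (x + y)"
  shows "Q z"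
  using assms(1) by (induction rule: ideal_prod.induct) (simp_all add: assms(2,3))

lemma mprod_least:
  assumes "\<And>x y. x \<in> I \<Longrightarrow> y \<in> J \<Longrightarrow> x * y \<in> L" "\<And>x y. x \<in> L \<Longrightarrow> y \<in> L \<Longrightarrow> x + y \<in> L"
  shows "mprod I J \<subseteq> L"
proof
  fix z assume "z \<in> mprod I J"
  then show "z \<in> L" by (induction rule: mprod_induct) (simp_all add: assms)
qed

lemma mprod_mono: "I \<subseteq> I' \<Longrightarrow> J \<subseteq> J' \<Longrightarrow> mprod I J \<subseteq> mprod I' J'"
  by (rule mprod_least) (blast intro: mprod_prod, rule mprod_add)

lemma mprod_commute: "mprod I J = mprod J I"
proof -
  have "mprod I J \<subseteq> mprod J I" for I J :: "'a set"
    by (rule mprod_least) (metis mprod_prod mult.commute, rule mprod_add)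
  then show ?thesis by blast
qed

lemma mprod_assoc: "mprod (mprod I J) K = mprod I (mprod J K)"
proof -
  have *: "mprod (mprod I J) K \<subseteq> mprod I (mprod J K)" for I J K :: "'a set"
  proof (rule mprod_least)
    fix x y assume "x \<in> mprod I J" and y: "y \<in> K"
    then show "x * y \<in> mprod I (mprod J K)"
    proof (induction rule: mprod_induct)
      case (prod a b)
      have "a * (b * y) \<in> mprod I (mprod J K)" using prod y by (intro mprod_prod)
      then show ?case by (simp add: mult.assoc)
    next
      case (add a b)
      then show ?case by (simp add: distrib_right mprod_add)
    qed
  qed (rule mprod_add)
  have "mprod I (mprod J K) = mprod (mprod K J) I" by (simp only: mprod_commute)
  also have "\<dots> \<subseteq> mprod K (mprod J I)" by (rule *)
  also have "\<dots> = mprod (mprod I J) K" by (simp only: mprod_commute)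
  finally show ?thesis using * by blast
qed

lemma colon_dmult: "x \<in> I \<Longrightarrow> y \<in> colon D I \<Longrightarrow> x * y \<in> D"
  by (auto simp: colon_def mult.commute)

lemma colon_antimono: "I \<subseteq> J \<Longrightarrow> colon D J \<subseteq> colon D I"
  by (auto simp: colon_def)

lemma subset_v_closure: "I \<subseteq> v_closure D I"
  by (auto simp: v_closure_def colon_def mult.commute)

lemma colon_v_closure: "colon D (v_closure D I) = colon D I"
  using subset_v_closure[of I D] subset_v_closure[of "colon D I" D] colon_antimono
  unfolding v_closure_def by blast

lemma v_closure_mono: "I \<subseteq> J \<Longrightarrow> v_closure D I \<subseteq> v_closure D J"
  unfolding v_closure_def by (intro colon_antimono)

locale prufer =
  fixes D :: "'a::field set"
  assumes prufer: "prufer_domain D"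
begin

lemma D_subdomain: "subdomain D fld"
  using prufer by (simp add: prufer_domain_def)

lemma D_closed [simp]:
  "0 \<in> D" "1 \<in> D" "x \<in> D \<Longrightarrow> y \<in> D \<Longrightarrow> x + y \<in> D" "x \<in> D \<Longrightarrow> y \<in> D \<Longrightarrow> x * y \<in> D"
  "x \<in> D \<Longrightarrow> - x \<in> D" "x \<in> D \<Longrightarrow> y \<in> D \<Longrightarrow> x - y \<in> D"
proof -
  interpret F: field "fld :: 'a ring" by (rule field_from_type_algebra)
  have neg: "\<ominus>\<^bsub>fld\<^esub> x = - (x :: 'a)" for x
    by (rule F.minus_equality) auto
  note E = subdomainE[OF D_subdomain]
  show "0 \<in> D" "1 \<in> D" using E(2,3) by simp_all
  show add: "x \<in> D \<Longrightarrow> y \<in> D \<Longrightarrow> x + y \<in> D" for x y using E(7)[of x y] by simp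
  show "x \<in> D \<Longrightarrow> y \<in> D \<Longrightarrow> x * y \<in> D" for x y using E(6)[of x y] by simp
  show min: "x \<in> D \<Longrightarrow> - x \<in> D" for x using E(5)[of x] neg by simp
  show "x \<in> D \<Longrightarrow> y \<in> D \<Longrightarrow> x - y \<in> D" for x y
    using add[of x "- y"] min[of y] by simp
qed

lemma D_power [simp]: "x \<in> D \<Longrightarrow> x ^ n \<in> D"
  by (induction n) simp_all

lemma ring_D: "cring (ring_on D)"
proof -
  interpret F: field "fld :: 'a ring" by (rule field_from_type_algebra)
  show ?thesis using F.subdomain_is_domain[OF D_subdomain] by (simp add: domain_def)
qed

definition dmod :: "'a set \<Rightarrow> bool" where
  "dmod I \<longleftrightarrow> 0 \<in> I \<and> (\<forall>x\<in>I. \<forall>y\<in>I. x + y \<in> I) \<and> (\<forall>d\<in>D. \<forall>x\<in>I. d * x \<in> I)"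

lemma dmodI:
  assumes "0 \<in> I" "\<And>x y. x \<in> I \<Longrightarrow> y \<in> I \<Longrightarrow> x + y \<in> I" "\<And>d x. d \<in> D \<Longrightarrow> x \<in> I \<Longrightarrow> d * x \<in> I"
  shows "dmod I"
  using assms unfolding dmod_def by blast

lemma dmodD:
  assumes "dmod I"
  shows dmod_0: "0 \<in> I"
    and dmod_add: "x \<in> I \<Longrightarrow> y \<in> I \<Longrightarrow> x + y \<in> I"
    and dmod_mult: "d \<in> D \<Longrightarrow> x \<in> I \<Longrightarrow> d * x \<in> I"
    and dmod_neg: "x \<in> I \<Longrightarrow> - x \<in> I"
proof -
  show 1: "0 \<in> I" "x \<in> I \<Longrightarrow> y \<in> I \<Longrightarrow> x + y \<in> I" "d \<in> D \<Longrightarrow> x \<in> I \<Longrightarrow> d * x \<in> I" for x y d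
    using assms unfolding dmod_def by blast+
  show "x \<in> I \<Longrightarrow> - x \<in> I" for x using 1(3)[of "- 1" x] by simp
qed

lemma dmod_D: "dmod D"
  by (rule dmodI) simp_all

lemma dmod_Int: "dmod I \<Longrightarrow> dmod J \<Longrightarrow> dmod (I \<inter> J)"
  unfolding dmod_def by blast

lemma dmod_mprod:
  assumes "dmod I" "dmod J"
  shows "dmod (mprod I J)"
proof (rule dmodI)
  show "0 \<in> mprod I J" using mprod_prod[OF dmod_0 dmod_0, OF assms] by simp
  fix d z assume d: "d \<in> D" and "z \<in> mprod I J"
  from this(2) show "d * z \<in> mprod I J"
  proof (induction rule: mprod_induct)
    case (prod x y)
    then show ?case using mprod_prod[of "d * x" I y J] d dmod_mult[OF assms(1)] by (simp add: mult.assoc)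
  next
    case (add x y)
    then show ?case by (simp add: distrib_left mprod_add)
  qed
qed (rule mprod_add)

lemma dmod_colon: "dmod (colon D I)"
  by (rule dmodI) (auto simp: colon_def distrib_right mult.assoc)

lemma dmod_v_closure: "dmod (v_closure D I)"
  by (simp add: v_closure_def dmod_colon)

lemma mprod_D: "dmod I \<Longrightarrow> mprod I D = I"
proof
  assume I: "dmod I"
  show "mprod I D \<subseteq> I"
    by (rule mprod_least) (metis mult.commute dmod_mult[OF I], rule dmod_add[OF I])
  show "I \<subseteq> mprod I D" using mprod_prod[of _ I 1 D] by auto
qed

lemma colon_D: "colon D D = D"
  by (auto simp: colon_def dest: bspec[of _ _ 1])

lemma mprod_subset_D:
  assumes "\<And>x y. x \<in> I \<Longrightarrow> y \<in> J \<Longrightarrow> x * y \<in> D"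
  shows "mprod I J \<subseteq> D"
  by (rule mprod_least) (simp_all add: assms)

lemma dmod_one_subset: "dmod L \<Longrightarrow> 1 \<in> L \<Longrightarrow> D \<subseteq> L"
  using dmod_mult[of L _ 1] by auto

lemma submodule_iff: "submodule I (ring_on D) field_module \<longleftrightarrow> dmod I"
proof -
  have inv: "m_inv (add_monoid (field_module :: ('a, 'a) module)) x = - x" for x
    unfolding m_inv_def by (rule the_equality) (auto simp: field_module_def eq_neg_iff_add_eq_0 add.commute)
  have "subgroup I (add_monoid (field_module :: ('a, 'a) module)) \<longleftrightarrow>
      0 \<in> I \<and> (\<forall>x\<in>I. \<forall>y\<in>I. x + y \<in> I) \<and> (\<forall>x\<in>I. - x \<in> I)"
    unfolding subgroup_def inv by (auto simp: field_module_def)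
  then have "submodule I (ring_on D) field_module \<longleftrightarrow>
      (0 \<in> I \<and> (\<forall>x\<in>I. \<forall>y\<in>I. x + y \<in> I) \<and> (\<forall>x\<in>I. - x \<in> I)) \<and> (\<forall>d\<in>D. \<forall>x\<in>I. d * x \<in> I)"
    unfolding submodule_def submodule_axioms_def by (auto simp: field_module_def)
  then show ?thesis using dmod_neg unfolding dmod_def by blast
qed

lemma ideal_iff: "ideal I (ring_on D) \<longleftrightarrow> dmod I \<and> I \<subseteq> D"
proof
  assume "ideal I (ring_on D)"
  then interpret ideal I "ring_on D" .
  have "I \<subseteq> D" using a_subset by simp
  moreover have "dmod I"
    using additive_subgroup.zero_closed[OF is_additive_subgroup]
      additive_subgroup.a_closed[OF is_additive_subgroup] I_l_closed
    by (intro dmodI) simp_all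
  ultimately show "dmod I \<and> I \<subseteq> D" by blast
next
  assume I: "dmod I \<and> I \<subseteq> D"
  interpret R: cring "ring_on D" by (rule ring_D)
  have inv: "\<ominus>\<^bsub>ring_on D\<^esub> x = - x" if "x \<in> D" for x
    by (rule R.minus_equality) (use that in auto)
  have "subgroup I (add_monoid (ring_on D))"
    by (rule R.add.subgroupI)
      (use I dmod_neg[of I] dmod_add[of I] dmod_0[of I] inv in \<open>auto simp: a_inv_def[symmetric]\<close>)
  moreover have "x * a \<in> I" "a * x \<in> I" if "a \<in> I" "x \<in> D" for a x
    using I that dmod_mult[of I x a] by (simp_all add: mult.commute)
  ultimately show "ideal I (ring_on D)"
    by (intro idealI[OF R.ring_axioms]) simp_all
qed

lemma SpecD:
  assumes "P \<in> Spec D"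
  shows Spec_dmod: "dmod P" and Spec_subset: "P \<subseteq> D" and Spec_1: "1 \<notin> P"
    and Spec_prime: "a \<in> D \<Longrightarrow> b \<in> D \<Longrightarrow> a * b \<in> P \<Longrightarrow> a \<in> P \<or> b \<in> P"
proof -
  interpret primeideal P "ring_on D" using assms by (simp add: Spec_def)
  show P: "dmod P" "P \<subseteq> D" using ideal_axioms ideal_iff by blast+
  show "1 \<notin> P"
  proof
    assume "1 \<in> P"
    then have "D \<subseteq> P" by (rule dmod_one_subset[OF P(1)])
    then show False using P(2) I_notcarr by simp
  qed
  show "a \<in> D \<Longrightarrow> b \<in> D \<Longrightarrow> a * b \<in> P \<Longrightarrow> a \<in> P \<or> b \<in> P" using I_prime[of a b] by simp
qed

lemma SpecI:
  assumes "dmod P" "P \<subseteq> D" "1 \<notin> P" "\<And>a b. a \<in> D \<Longrightarrow> b \<in> D \<Longrightarrow> a * b \<in> P \<Longrightarrow> a \<in> P \<or> b \<in> P"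
  shows "P \<in> Spec D"
  unfolding Spec_def mem_Collect_eq
  by (rule primeidealI[OF _ ring_D]) (use assms ideal_iff in auto)

lemma Spec_diff_mult:
  assumes "P \<in> Spec D" "s \<in> D - P" "t \<in> D - P"
  shows "s * t \<in> D - P"
  using assms Spec_prime[OF assms(1), of s t] by auto

lemma Spec_power:
  assumes "P \<in> Spec D" "s \<in> D" "s ^ n \<in> P"
  shows "s \<in> P"
  using assms(3)
proof (induction n)
  case 0
  then show ?case using Spec_1[OF assms(1)] by simp
next
  case (Suc n)
  then show ?case using Spec_prime[OF assms(1,2) D_power[OF assms(2)], of n] by auto
qed

lemma MaxSpec_Spec: "M \<in> MaxSpec D \<Longrightarrow> M \<in> Spec D"
  using cring.maximalideal_prime[OF ring_D] by (simp add: MaxSpec_def Spec_def)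

lemma dmod_adjoin:
  assumes "dmod P"
  shows "dmod {p + d * a |p d. p \<in> P \<and> d \<in> D}" (is "dmod ?Q")
proof (rule dmodI)
  show "0 \<in> ?Q" using dmod_0[OF assms] by (auto intro!: exI[of _ 0])
next
  fix x y assume "x \<in> ?Q" "y \<in> ?Q"
  then obtain p d q e where "x = p + d * a" "y = q + e * a" "p \<in> P" "d \<in> D" "q \<in> P" "e \<in> D" by blast
  then show "x + y \<in> ?Q"
    using dmod_add[OF assms] by (intro CollectI exI[of _ "p + q"] exI[of _ "d + e"]) (auto simp: algebra_simps)
next
  fix c x assume "c \<in> D" "x \<in> ?Q"
  then obtain p d where "x = p + d * a" "p \<in> P" "d \<in> D" by blast
  then show "c * x \<in> ?Q"
    using dmod_mult[OF assms] \<open>c \<in> D\<close>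
    by (intro CollectI exI[of _ "c * p"] exI[of _ "c * d"]) (auto simp: algebra_simps)
qed

lemma subset_adjoin: "P \<subseteq> {p + d * a |p d. p \<in> P \<and> d \<in> D}"
proof
  fix p assume "p \<in> P"
  then show "p \<in> {p + d * a |p d. p \<in> P \<and> d \<in> D}"
    by (intro CollectI exI[of _ p] exI[of _ 0]) simp
qed

lemma mem_adjoin:
  assumes "dmod P"
  shows "a \<in> {p + d * a |p d. p \<in> P \<and> d \<in> D}"
  using dmod_0[OF assms] by (intro CollectI exI[of _ 0] exI[of _ 1]) simp

lemma MaxSpec_comax:
  assumes M: "M \<in> MaxSpec D" and a: "a \<in> D" "a \<notin> M"
  obtains p t where "p \<in> M" "t \<in> D" "p + t * a = 1"
proof -
  interpret maximalideal M "ring_on D" using M by (simp add: MaxSpec_def)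
  have M': "dmod M" "M \<subseteq> D" using ideal_axioms ideal_iff by blast+
  let ?Q = "{p + d * a |p d. p \<in> M \<and> d \<in> D}"
  have "?Q \<subseteq> D"
  proof
    fix x assume "x \<in> ?Q"
    then obtain p d where "x = p + d * a" "p \<in> M" "d \<in> D" by blast
    then show "x \<in> D" using M'(2) a(1) by auto
  qed
  moreover have "ideal ?Q (ring_on D)"
    unfolding ideal_iff using dmod_adjoin[OF M'(1)] \<open>?Q \<subseteq> D\<close> by (rule conjI)
  ultimately have "?Q = M \<or> ?Q = D" using I_maximal[of ?Q] subset_adjoin[of M a] by simp
  then have "?Q = D" using mem_adjoin[OF M'(1), of a] a(2) by blast
  then have "1 \<in> ?Q" using D_closed(2) by blast
  then obtain p t where "p \<in> M" "t \<in> D" "1 = p + t * a" by blast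
  then show thesis using that[of p t] by simp
qed

text \<open>
This is \<open>I D\<^sub>P\<close> for a \<open>D\<close>-module \<open>I\<close> (\<open>mprod_loc\<close>).  Avoiding sums of products makes it evident that localization
commutes with intersections and products.
\<close>

definition loc :: "'a set \<Rightarrow> 'a set \<Rightarrow> 'a set" where
  "loc I P = {y. \<exists>s\<in>D - P. s * y \<in> I}"

lemma locI: "s \<in> D \<Longrightarrow> s \<notin> P \<Longrightarrow> s * y \<in> I \<Longrightarrow> y \<in> loc I P"
  by (auto simp: loc_def)

lemma locE:
  assumes "y \<in> loc I P"
  obtains s where "s \<in> D" "s \<notin> P" "s * y \<in> I"
  using assms by (auto simp: loc_def)

lemma loc_mono: "I \<subseteq> J \<Longrightarrow> loc I P \<subseteq> loc J P"
  by (auto simp: loc_def)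

context
  fixes P assumes P: "P \<in> Spec D"
begin

lemma subset_loc: "I \<subseteq> loc I P"
  using Spec_1[OF P] by (auto intro: locI[of 1])

lemma loc_nonzero: "s \<in> D \<Longrightarrow> s \<notin> P \<Longrightarrow> s \<noteq> 0"
  using dmod_0[OF Spec_dmod[OF P]] by blast

lemma loc_add:
  assumes "dmod I" "x \<in> loc I P" "y \<in> loc I P"
  shows "x + y \<in> loc I P"
proof -
  obtain s t where st: "s \<in> D" "s \<notin> P" "s * x \<in> I" "t \<in> D" "t \<notin> P" "t * y \<in> I"
    using assms by (meson locE)
  have "s * t * (x + y) = t * (s * x) + s * (t * y)" by (simp add: algebra_simps)
  also have "\<dots> \<in> I"
    using st dmod_mult[OF assms(1), of t "s * x"] dmod_mult[OF assms(1), of s "t * y"]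
    by (intro dmod_add[OF assms(1)])
  finally show ?thesis using Spec_diff_mult[OF P, of s t] st by (auto intro: locI[of "s * t"])
qed

lemma loc_mult:
  assumes "x \<in> loc I P" "y \<in> loc J P"
  shows "x * y \<in> loc (mprod I J) P"
proof -
  obtain s t where st: "s \<in> D" "s \<notin> P" "s * x \<in> I" "t \<in> D" "t \<notin> P" "t * y \<in> J"
    using assms by (meson locE)
  have "s * t * (x * y) = s * x * (t * y)" by (simp add: algebra_simps)
  also have "\<dots> \<in> mprod I J" using st by (intro mprod_prod)
  finally show ?thesis using Spec_diff_mult[OF P, of s t] st by (auto intro: locI[of "s * t"])
qed

lemma loc_smult: "dmod I \<Longrightarrow> v \<in> loc D P \<Longrightarrow> x \<in> loc I P \<Longrightarrow> v * x \<in> loc I P"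
  using loc_mult[of x I v D] mprod_D by (simp add: mult.commute)

lemma dmod_loc: "dmod I \<Longrightarrow> dmod (loc I P)"
proof (rule dmodI)
  assume I: "dmod I"
  show "0 \<in> loc I P" using subset_loc[of I] dmod_0[OF I] by blast
  show "x + y \<in> loc I P" if "x \<in> loc I P" "y \<in> loc I P" for x y
    using loc_add[OF I that] .
  show "d * x \<in> loc I P" if "d \<in> D" "x \<in> loc I P" for d x
    using loc_smult[OF I _ that(2)] subset_loc[of D] that(1) by blast
qed

lemma loc_Int:
  assumes "dmod I" "dmod J"
  shows "loc (I \<inter> J) P = loc I P \<inter> loc J P"
proof
  show "loc I P \<inter> loc J P \<subseteq> loc (I \<inter> J) P"
  proof
    fix y assume y: "y \<in> loc I P \<inter> loc J P"
    obtain s where s: "s \<in> D" "s \<notin> P" "s * y \<in> I" using locE[OF IntD1[OF y]] .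
    obtain t where t: "t \<in> D" "t \<notin> P" "t * y \<in> J" using locE[OF IntD2[OF y]] .
    note st = s t
    have "s * t * y \<in> I \<inter> J"
      using dmod_mult[OF assms(1) t(1) s(3)] dmod_mult[OF assms(2) s(1) t(3)]
      by (simp add: mult.assoc mult.left_commute)
    then show "y \<in> loc (I \<inter> J) P"
      using Spec_diff_mult[OF P, of s t] st by (auto intro: locI[of "s * t"])
  qed
next
  show "loc (I \<inter> J) P \<subseteq> loc I P \<inter> loc J P" by (intro Int_greatest loc_mono Int_lower1 Int_lower2)
qed

lemma loc_D_closed:
  "x \<in> loc D P \<Longrightarrow> y \<in> loc D P \<Longrightarrow> x * y \<in> loc D P"
  "x \<in> loc D P \<Longrightarrow> y \<in> loc D P \<Longrightarrow> x + y \<in> loc D P"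
  "1 \<in> loc D P" "0 \<in> loc D P" "D \<subseteq> loc D P"
  using loc_smult[OF dmod_D] loc_add[OF dmod_D] subset_loc[of D] by auto

lemma inverse_loc_D: "s \<in> D \<Longrightarrow> s \<notin> P \<Longrightarrow> inverse s \<in> loc D P"
  using loc_nonzero by (auto intro: locI[of s])

lemma loc_D_eq: "localization D P = loc D P"
proof
  show "localization D P \<subseteq> loc D P"
  proof
    fix y assume "y \<in> localization D P"
    then obtain a s where as: "y = a / s" "a \<in> D" "s \<in> D" "s \<notin> P" by (auto simp: localization_def)
    then have "s * y = a" using loc_nonzero by simp
    then show "y \<in> loc D P" using as by (intro locI[of s]) simp_all
  qed
  show "loc D P \<subseteq> localization D P"
  proof
    fix y assume "y \<in> loc D P"
    then obtain s where s: "s \<in> D" "s \<notin> P" "s * y \<in> D" by (rule locE)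
    then have "y = (s * y) / s" using loc_nonzero by simp
    then show "y \<in> localization D P" unfolding localization_def using s by blast
  qed
qed

lemma mprod_loc:
  assumes "dmod I"
  shows "mprod I (localization D P) = loc I P"
proof
  show "mprod I (localization D P) \<subseteq> loc I P"
    unfolding loc_D_eq
  proof (rule mprod_least)
    fix x y assume "x \<in> I" "y \<in> loc D P"
    then show "x * y \<in> loc I P"
      using loc_smult[OF assms, of y x] subset_loc[of I] by (auto simp: mult.commute)
  qed (rule loc_add[OF assms])
  show "loc I P \<subseteq> mprod I (localization D P)"
  proof
    fix y assume "y \<in> loc I P"
    then obtain s where s: "s \<in> D" "s \<notin> P" "s * y \<in> I" by (rule locE)
    have "s * y * inverse s \<in> mprod I (localization D P)"
      unfolding loc_D_eq by (rule mprod_prod[OF s(3) inverse_loc_D[OF s(1,2)]])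
    moreover have "s * y * inverse s = y" using loc_nonzero[OF s(1,2)] by simp
    ultimately show "y \<in> mprod I (localization D P)" by metis
  qed
qed

lemma loc_valuation: "x \<noteq> 0 \<Longrightarrow> x \<in> loc D P \<or> inverse x \<in> loc D P"
  using prufer P unfolding prufer_domain_def valuation_domain_def by (metis loc_D_eq)

lemma loc_quotient:
  assumes "dmod I" "x \<in> loc I P" "y \<notin> loc I P"
  shows "x / y \<in> loc D P"
proof (cases "x = 0")
  case False
  have "y \<noteq> 0" using assms dmod_0[OF dmod_loc[OF assms(1)]] by auto
  have "y / x \<notin> loc D P"
    using loc_smult[OF assms(1) _ assms(2), of "y / x"] assms(3) False by auto
  then show ?thesis using loc_valuation[of "x / y"] False \<open>y \<noteq> 0\<close> by simp
qed (simp add: loc_D_closed)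

lemma loc_chain:
  assumes "dmod I" "dmod J"
  shows "loc I P \<subseteq> loc J P \<or> loc J P \<subseteq> loc I P"
proof (rule ccontr)
  assume "\<not> ?thesis"
  then obtain x y where x: "x \<in> loc I P" "x \<notin> loc J P" and y: "y \<in> loc J P" "y \<notin> loc I P" by blast
  have "x / y \<in> loc D P" by (rule loc_quotient[OF assms(1) x(1) y(2)])
  from loc_smult[OF assms(2) this y(1)] x(2) show False
    using y(2) dmod_0[OF dmod_loc[OF assms(1)]] by (cases "y = 0") auto
qed

lemma loc_prime_iff: "x \<in> D \<Longrightarrow> x \<in> loc P P \<longleftrightarrow> x \<in> P"
proof
  assume x: "x \<in> D" "x \<in> loc P P"
  then obtain s where "s \<in> D" "s \<notin> P" "s * x \<in> P" by (auto elim: locE)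
  then show "x \<in> P" using Spec_prime[OF P] x by blast
qed (use subset_loc in blast)

lemma loc_one_iff:
  assumes "dmod I" "I \<subseteq> D"
  shows "1 \<in> loc I P \<longleftrightarrow> \<not> I \<subseteq> P"
proof
  assume "1 \<in> loc I P"
  then show "\<not> I \<subseteq> P" by (auto elim!: locE)
next
  assume "\<not> I \<subseteq> P"
  then show "1 \<in> loc I P" using assms by (auto intro: locI)
qed

lemma loc_eq_D_iff:
  assumes "dmod I" "I \<subseteq> D"
  shows "loc I P = loc D P \<longleftrightarrow> \<not> I \<subseteq> P"
proof -
  have "loc I P = loc D P \<longleftrightarrow> 1 \<in> loc I P"
    using loc_mono[OF assms(2), of P] loc_smult[OF assms(1), of _ 1] loc_D_closed by auto
  then show ?thesis using loc_one_iff[OF assms] by simp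
qed

end

text \<open>
An ideal that is maximal among those containing no member of \<open>\<J>\<close> is prime, because \<open>\<J>\<close> is closed under products up to
shrinking.  It exists by Zorn's lemma, because a finitely generated ideal in the union of a chain lies in a member of the
chain.
\<close>

lemma exists_prime_avoiding:
  assumes fin: "\<And>J. J \<in> \<J> \<Longrightarrow> \<exists>F. finite F \<and> F \<subseteq> J \<and> (\<forall>L. dmod L \<longrightarrow> F \<subseteq> L \<longrightarrow> J \<subseteq> L)"
    and directed: "\<And>J K. J \<in> \<J> \<Longrightarrow> K \<in> \<J> \<Longrightarrow> \<exists>L\<in>\<J>. L \<subseteq> mprod J K"
    and ne: "J0 \<in> \<J>" "J0 \<subseteq> D"
    and I: "dmod I" "I \<subseteq> D" "\<And>J. J \<in> \<J> \<Longrightarrow> \<not> J \<subseteq> I"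
  obtains P where "P \<in> Spec D" "I \<subseteq> P" "\<And>J. J \<in> \<J> \<Longrightarrow> \<not> J \<subseteq> P"
proof -
  define S where "S = {L. dmod L \<and> I \<subseteq> L \<and> L \<subseteq> D \<and> (\<forall>J\<in>\<J>. \<not> J \<subseteq> L)}"
  have "\<exists>P\<in>S. \<forall>L\<in>S. P \<subseteq> L \<longrightarrow> L = P"
  proof (rule subset_Zorn_nonempty)
    show "S \<noteq> {}" using I by (auto simp: S_def)
    fix C assume C: "C \<noteq> {}" "subset.chain S C"
    have CS: "C \<subseteq> S" and chain: "\<And>A B. A \<in> C \<Longrightarrow> B \<in> C \<Longrightarrow> A \<subseteq> B \<or> B \<subseteq> A"
      using C(2) unfolding subset.chain_def by blast+
    have "dmod (\<Union>C)"
    proof (rule dmodI)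
      show "0 \<in> \<Union>C" using C(1) CS dmod_0 by (force simp: S_def)
      fix x y assume "x \<in> \<Union>C" "y \<in> \<Union>C"
      then obtain A B where AB: "A \<in> C" "x \<in> A" "B \<in> C" "y \<in> B" by blast
      then obtain L where "L \<in> C" "x \<in> L" "y \<in> L" using chain[of A B] by blast
      then show "x + y \<in> \<Union>C" using CS dmod_add[of L x y] by (auto simp: S_def)
    next
      fix d x assume "d \<in> D" "x \<in> \<Union>C"
      then show "d * x \<in> \<Union>C" using CS dmod_mult by (force simp: S_def)
    qed
    moreover have "\<not> J \<subseteq> \<Union>C" if J: "J \<in> \<J>" for J
    proof
      assume JC: "J \<subseteq> \<Union>C"
      obtain F where F: "finite F" "F \<subseteq> J" "\<And>L. dmod L \<Longrightarrow> F \<subseteq> L \<Longrightarrow> J \<subseteq> L" using fin[OF J] by blast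
      obtain L where L: "L \<in> C" "F \<subseteq> L"
        using finite_subset_Union_chain[OF F(1) _ C(1,2)] F(2) JC by blast
      then have "dmod L" "\<not> J \<subseteq> L" using CS J by (auto simp: S_def)
      then show False using F(3) L(2) by blast
    qed
    moreover have "I \<subseteq> \<Union>C" "\<Union>C \<subseteq> D" using C(1) CS unfolding S_def by blast+
    ultimately show "\<Union>C \<in> S" by (simp add: S_def)
  qed
  then obtain P where PS: "P \<in> S" and max: "\<And>L. L \<in> S \<Longrightarrow> P \<subseteq> L \<Longrightarrow> L = P" by blast
  have P: "dmod P" "I \<subseteq> P" "P \<subseteq> D" "\<And>J. J \<in> \<J> \<Longrightarrow> \<not> J \<subseteq> P" using PS by (auto simp: S_def)
  have "1 \<notin> P"
  proof
    assume "1 \<in> P"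
    then have "D \<subseteq> P" by (rule dmod_one_subset[OF P(1)])
    then show False using P(4)[OF ne(1)] ne(2) by blast
  qed
  moreover have "a \<in> P \<or> b \<in> P" if ab: "a \<in> D" "b \<in> D" "a * b \<in> P" for a b
  proof (rule ccontr)
    assume no: "\<not> (a \<in> P \<or> b \<in> P)"
    have big: "\<exists>J\<in>\<J>. J \<subseteq> {p + d * c |p d. p \<in> P \<and> d \<in> D}" (is "\<exists>J\<in>\<J>. J \<subseteq> ?Q")
      if c: "c \<in> D" "c \<notin> P" for c
    proof (rule ccontr)
      assume none: "\<not> (\<exists>J\<in>\<J>. J \<subseteq> ?Q)"
      have PQ: "P \<subseteq> ?Q" by (rule subset_adjoin)
      have "?Q \<subseteq> D" using P(3) c by auto
      then have "?Q \<in> S" using dmod_adjoin[OF P(1)] PQ P(2) none unfolding S_def by blast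
      then have "?Q = P" using max PQ by blast
      moreover have "c \<in> ?Q" by (rule mem_adjoin[OF P(1)])
      ultimately show False using c by blast
    qed
    obtain J K where J: "J \<in> \<J>" "J \<subseteq> {p + d * a |p d. p \<in> P \<and> d \<in> D}"
      and K: "K \<in> \<J>" "K \<subseteq> {p + d * b |p d. p \<in> P \<and> d \<in> D}"
      using big[of a] big[of b] ab no by blast
    obtain L where L: "L \<in> \<J>" "L \<subseteq> mprod J K" using directed[OF J(1) K(1)] by blast
    have "mprod J K \<subseteq> P"
    proof (rule mprod_least)
      fix x y assume "x \<in> J" "y \<in> K"
      then obtain p d q e where pd: "x = p + d * a" "y = q + e * b" "p \<in> P" "d \<in> D" "q \<in> P" "e \<in> D"
        using J(2) K(2) by blast
      have "x * y = (q + e * b) * p + (d * a) * q + (d * e) * (a * b)" using pd by (simp add: algebra_simps)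
      also have "\<dots> \<in> P"
      proof (intro dmod_add[OF P(1)])
        show "(q + e * b) * p \<in> P" using pd ab P(3) by (intro dmod_mult[OF P(1)]) auto
        show "d * a * q \<in> P" using pd ab P(3) by (intro dmod_mult[OF P(1)]) auto
        show "d * e * (a * b) \<in> P" using pd ab by (intro dmod_mult[OF P(1), of "d * e" "a * b"]) auto
      qed
      finally show "x * y \<in> P" .
    qed (rule dmod_add[OF P(1)])
    then show False using L P(4) by blast
  qed
  ultimately have "P \<in> Spec D" using P by (intro SpecI)
  then show thesis using P that by blast
qed

text \<open>
Otherwise the ideal of all \<open>d\<close> with \<open>d x \<in> I\<close> is proper and lies in a prime \<open>P\<close>, and then \<open>x\<close> is not in \<open>I D\<^sub>P\<close>.
\<close>

lemma local_global:
  assumes I: "dmod I" and loc: "\<And>P. P \<in> Spec D \<Longrightarrow> x \<in> loc I P"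
  shows "x \<in> I"
proof (rule ccontr)
  assume x: "x \<notin> I"
  define A where "A = {d\<in>D. d * x \<in> I}"
  have A: "dmod A"
  proof (rule dmodI)
    show "0 \<in> A" by (simp add: A_def dmod_0[OF I])
    show "a + b \<in> A" if "a \<in> A" "b \<in> A" for a b
      using that dmod_add[OF I, of "a * x" "b * x"] by (simp add: A_def distrib_right)
    show "d * a \<in> A" if "d \<in> D" "a \<in> A" for d a
      using that dmod_mult[OF I, of d "a * x"] by (simp add: A_def mult.assoc)
  qed
  have fin: "\<exists>F. finite F \<and> F \<subseteq> J \<and> (\<forall>L. dmod L \<longrightarrow> F \<subseteq> L \<longrightarrow> J \<subseteq> L)" if "J \<in> {D}" for J
    using that by (intro exI[of _ "{1}"]) (simp add: dmod_one_subset)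
  have directed: "\<exists>L\<in>{D}. L \<subseteq> mprod J K" if "J \<in> {D}" "K \<in> {D}" for J K
    using that mprod_D[OF dmod_D] by simp
  have proper: "\<not> J \<subseteq> A" if "J \<in> {D}" for J
  proof
    assume "J \<subseteq> A"
    then have "1 \<in> A" using that D_closed(2) by blast
    then show False using x by (simp add: A_def)
  qed
  have AD: "A \<subseteq> D" by (auto simp: A_def)
  obtain P where P: "P \<in> Spec D" "A \<subseteq> P"
    by (rule exists_prime_avoiding[OF fin directed singletonI subset_refl A AD proper])
  then show False using loc[OF P(1)] by (auto simp: A_def elim!: locE)
qed

lemma local_subset:
  assumes "dmod J" "\<And>P. P \<in> Spec D \<Longrightarrow> loc I P \<subseteq> loc J P"
  shows "I \<subseteq> J"
  using local_global[OF assms(1)] assms(2) subset_loc by blast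

end

section \<open>Invertible modules and the group of divisorial ideals\<close>

context prufer
begin

definition inv_mod :: "'a set \<Rightarrow> bool" where
  "inv_mod I \<longleftrightarrow> dmod I \<and> 1 \<in> mprod I (colon D I)"

lemma inv_mod_dmod: "inv_mod I \<Longrightarrow> dmod I"
  by (simp add: inv_mod_def)

lemma mprod_colon_subset: "mprod I (colon D I) \<subseteq> D"
  by (rule mprod_subset_D) (rule colon_dmult)

lemma mprod_colon_eq: "inv_mod I \<Longrightarrow> mprod I (colon D I) = D"
proof
  assume I: "inv_mod I"
  show "D \<subseteq> mprod I (colon D I)"
    using I dmod_mprod[OF inv_mod_dmod[OF I] dmod_colon] by (intro dmod_one_subset) (simp_all add: inv_mod_def)
qed (rule mprod_colon_subset)

text \<open>
The elements of \<open>I\<close> that occur in a representation of \<open>1\<close> as a sum of products generate \<open>I\<close>.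
\<close>

lemma inv_mod_finitely_generated:
  assumes "inv_mod I"
  shows "\<exists>F. finite F \<and> F \<subseteq> I \<and> (\<forall>L. dmod L \<longrightarrow> F \<subseteq> L \<longrightarrow> I \<subseteq> L)"
proof -
  have "\<exists>F. finite F \<and> F \<subseteq> I \<and> (\<forall>L. dmod L \<longrightarrow> F \<subseteq> L \<longrightarrow> (\<forall>x\<in>I. z * x \<in> L))"
    if "z \<in> mprod I (colon D I)" for z
    using that
  proof (induction rule: mprod_induct)
    case (prod a b)
    have "a * b * x \<in> L" if "dmod L" "a \<in> L" "x \<in> I" for L x
      using dmod_mult[OF that(1) colon_dmult[OF that(3) prod(2)] that(2)] by (simp add: mult_ac)
    then show ?case using prod by (intro exI[of _ "{a}"]) simp
  next
    case (add z w)
    then obtain F E where FE: "finite F" "F \<subseteq> I" "finite E" "E \<subseteq> I"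
      "\<And>L x. dmod L \<Longrightarrow> F \<subseteq> L \<Longrightarrow> x \<in> I \<Longrightarrow> z * x \<in> L"
      "\<And>L x. dmod L \<Longrightarrow> E \<subseteq> L \<Longrightarrow> x \<in> I \<Longrightarrow> w * x \<in> L" by metis
    then show ?case
      by (intro exI[of _ "F \<union> E"]) (simp add: distrib_right dmod_add)
  qed
  from this[of 1] assms obtain F where "finite F" "F \<subseteq> I"
    "\<And>L x. dmod L \<Longrightarrow> F \<subseteq> L \<Longrightarrow> x \<in> I \<Longrightarrow> x \<in> L" unfolding inv_mod_def by (metis mult_1)
  then show ?thesis by (intro exI[of _ F]) blast
qed

lemma inv_mod_divisorial:
  assumes "inv_mod I"
  shows "v_closure D I = I"
proof
  show "v_closure D I \<subseteq> I"
  proof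
    fix x assume x: "x \<in> v_closure D I"
    have "z * x \<in> I" if "z \<in> mprod I (colon D I)" for z
      using that
    proof (induction rule: mprod_induct)
      case (prod a b)
      have "b * x \<in> D" using x prod(2) by (simp add: v_closure_def colon_dmult)
      from dmod_mult[OF inv_mod_dmod[OF assms] this prod(1)] show ?case by (simp add: mult_ac)
    next
      case (add z w)
      then show ?case by (simp add: distrib_right dmod_add[OF inv_mod_dmod[OF assms]])
    qed
    from this[of 1] show "x \<in> I" using assms by (simp add: inv_mod_def)
  qed
qed (rule subset_v_closure)

lemma inv_mod_inverse_unique:
  assumes I: "dmod I" and K: "dmod K" and sub: "mprod I K \<subseteq> D" and one: "1 \<in> mprod I K"
  shows "inv_mod I" "colon D I = K"
proof -
  have KI: "K \<subseteq> colon D I"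
  proof
    fix y assume "y \<in> K"
    then have "x * y \<in> D" if "x \<in> I" for x using mprod_prod[OF that] sub by blast
    then show "y \<in> colon D I" by (simp add: colon_def mult.commute)
  qed
  show "inv_mod I" using I one mprod_mono[OF subset_refl KI] by (auto simp: inv_mod_def)
  show "colon D I = K"
  proof
    show "colon D I \<subseteq> K"
    proof
      fix c assume c: "c \<in> colon D I"
      have "z * c \<in> K" if "z \<in> mprod I K" for z
        using that
      proof (induction rule: mprod_induct)
        case (prod a b)
        from dmod_mult[OF K colon_dmult[OF prod(1) c] prod(2)] show ?case by (simp add: mult_ac)
      next
        case (add z w)
        then show ?case by (simp add: distrib_right dmod_add[OF K])
      qed
      from this[OF one] show "c \<in> K" by simp
    qed
  qed (rule KI)
qed

lemma inv_mod_colon: "inv_mod I \<Longrightarrow> inv_mod (colon D I)"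
  using inv_mod_inverse_unique(1)[OF dmod_colon inv_mod_dmod, of I I] mprod_colon_subset[of I]
  by (simp add: mprod_commute[of "colon D I" I] inv_mod_def)

lemma inv_mod_D: "inv_mod D"
  using mprod_D[OF dmod_D] by (simp add: inv_mod_def dmod_D colon_D)

lemma mprod_swap: "mprod (mprod A B) (mprod C E) = mprod (mprod A C) (mprod B E)"
  by (metis mprod_assoc mprod_commute)

lemma inv_mod_mprod:
  assumes "inv_mod I" "inv_mod J"
  shows "inv_mod (mprod I J)" "colon D (mprod I J) = mprod (colon D I) (colon D J)"
proof -
  have "mprod (mprod I J) (mprod (colon D I) (colon D J)) = D"
    using mprod_colon_eq[OF assms(1)] mprod_colon_eq[OF assms(2)] mprod_D[OF dmod_D]
    by (simp add: mprod_swap[of I J])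
  then have *: "mprod (mprod I J) (mprod (colon D I) (colon D J)) \<subseteq> D"
    "1 \<in> mprod (mprod I J) (mprod (colon D I) (colon D J))" by simp_all
  note unique = inv_mod_inverse_unique[OF dmod_mprod[OF inv_mod_dmod inv_mod_dmod, OF assms] dmod_mprod[OF dmod_colon dmod_colon] *]
  show "inv_mod (mprod I J)" "colon D (mprod I J) = mprod (colon D I) (colon D J)" by (fact unique)+
qed

lemma inv_mod_scale:
  assumes "inv_mod I" "z \<noteq> 0"
  shows "inv_mod ((*) z ` I)"
proof -
  have scale: "dmod ((*) w ` K)" if "dmod K" for w K
  proof (rule dmodI)
    show "0 \<in> (*) w ` K" using dmod_0[OF that] by force
    show "x + y \<in> (*) w ` K" if xy: "x \<in> (*) w ` K" "y \<in> (*) w ` K" for x y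
    proof -
      obtain a b where "x = w * a" "y = w * b" "a \<in> K" "b \<in> K" using xy by blast
      then have "x + y = w * (a + b)" "a + b \<in> K" using dmod_add[OF \<open>dmod K\<close>] by (simp_all add: distrib_left)
      then show ?thesis by blast
    qed
    show "d * x \<in> (*) w ` K" if dx: "d \<in> D" "x \<in> (*) w ` K" for d x
    proof -
      obtain a where "x = w * a" "a \<in> K" using dx by blast
      then have "d * x = w * (d * a)" "d * a \<in> K" using dmod_mult[OF \<open>dmod K\<close> dx(1)] by simp_all
      then show ?thesis by blast
    qed
  qed
  let ?I = "(*) z ` I" and ?K = "(*) (inverse z) ` colon D I"
  have "mprod ?I ?K \<subseteq> D"
  proof (rule mprod_subset_D)
    fix x y assume "x \<in> ?I" "y \<in> ?K"
    then obtain a b where "x = z * a" "y = inverse z * b" "a \<in> I" "b \<in> colon D I" by blast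
    then have "x * y = a * b" "a * b \<in> D" using assms(2) colon_dmult[of a I b D] by (simp_all add: field_simps)
    then show "x * y \<in> D" by metis
  qed
  moreover have "mprod I (colon D I) \<subseteq> mprod ?I ?K"
  proof (rule mprod_least)
    fix a b assume "a \<in> I" "b \<in> colon D I"
    then have "(z * a) * (inverse z * b) \<in> mprod ?I ?K" by (intro mprod_prod) blast+
    moreover have "z * a * (inverse z * b) = a * b" using assms(2) by (simp add: field_simps)
    ultimately show "a * b \<in> mprod ?I ?K" by metis
  qed (rule mprod_add)
  ultimately show ?thesis
    using inv_mod_inverse_unique(1)[OF scale scale, of I "colon D I" z "inverse z"] assms(1) dmod_colon
    unfolding inv_mod_def by blast
qed

definition isum :: "'a set \<Rightarrow> 'a set \<Rightarrow> 'a set" where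
  "isum I J = {x + y |x y. x \<in> I \<and> y \<in> J}"

lemma dmod_isum:
  assumes "dmod I" "dmod J"
  shows "dmod (isum I J)"
proof (rule dmodI)
  have "0 + 0 \<in> isum I J" using dmod_0[OF assms(1)] dmod_0[OF assms(2)] unfolding isum_def by blast
  then show "0 \<in> isum I J" by simp
next
  fix u w assume "u \<in> isum I J" "w \<in> isum I J"
  then obtain x y x' y' where "u = x + y" "w = x' + y'" "x \<in> I" "y \<in> J" "x' \<in> I" "y' \<in> J"
    unfolding isum_def by blast
  then have "u + w = (x + x') + (y + y')" "x + x' \<in> I" "y + y' \<in> J"
    using dmod_add[OF assms(1)] dmod_add[OF assms(2)] by simp_all
  then show "u + w \<in> isum I J" unfolding isum_def by blast
next
  fix d u assume d: "d \<in> D" and "u \<in> isum I J"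
  then obtain x y where "u = x + y" "x \<in> I" "y \<in> J" unfolding isum_def by blast
  then have "d * u = d * x + d * y" "d * x \<in> I" "d * y \<in> J"
    using dmod_mult[OF assms(1) d] dmod_mult[OF assms(2) d] by (simp_all add: distrib_left)
  then show "d * u \<in> isum I J" unfolding isum_def by blast
qed

lemma isum_upper:
  assumes "dmod I" "dmod J"
  shows "I \<subseteq> isum I J" "J \<subseteq> isum I J"
proof -
  have "x + 0 \<in> isum I J" if "x \<in> I" for x using that dmod_0[OF assms(2)] unfolding isum_def by blast
  then show "I \<subseteq> isum I J" by auto
  have "0 + x \<in> isum I J" if "x \<in> J" for x using that dmod_0[OF assms(1)] unfolding isum_def by blast
  then show "J \<subseteq> isum I J" by auto
qed

lemma isum_least: "dmod L \<Longrightarrow> I \<subseteq> L \<Longrightarrow> J \<subseteq> L \<Longrightarrow> isum I J \<subseteq> L"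
  unfolding isum_def using dmod_add by blast

text \<open>
In a valuation domain two modules are comparable, so their sum and their intersection are the two modules in some order
and \<open>(I + J)(I \<inter> J) = I J\<close>.  The identity globalizes, and it exhibits inverses of \<open>I + J\<close> and \<open>I \<inter> J\<close> whenever \<open>I\<close> and
\<open>J\<close> are invertible.
\<close>

lemma isum_mprod_Int_eq:
  assumes I: "inv_mod I" and J: "inv_mod J"
  shows "mprod (mprod (isum I J) (I \<inter> J)) (mprod (colon D I) (colon D J)) = D"
proof
  note dI = inv_mod_dmod[OF I] and dJ = inv_mod_dmod[OF J]
  note dS = dmod_isum[OF dI dJ] and dM = dmod_Int[OF dI dJ]
  let ?S = "isum I J" and ?M = "I \<inter> J" and ?K = "mprod (colon D I) (colon D J)"
  have IJK: "mprod (mprod I J) ?K = D"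
    using mprod_colon_eq[OF inv_mod_mprod(1)[OF I J]] inv_mod_mprod(2)[OF I J] by simp
  have "mprod ?S ?M \<subseteq> mprod I J"
  proof (rule mprod_least)
    fix s m assume "s \<in> ?S" "m \<in> ?M"
    then obtain x y where s: "s = x + y" "x \<in> I" "y \<in> J" unfolding isum_def by blast
    have "x * m \<in> mprod I J" "m * y \<in> mprod I J" using s \<open>m \<in> ?M\<close> by (auto intro: mprod_prod)
    from mprod_add[OF this] show "s * m \<in> mprod I J" by (simp add: s algebra_simps)
  qed (rule mprod_add)
  then show "mprod (mprod ?S ?M) ?K \<subseteq> D" using mprod_mono[OF _ subset_refl] IJK by blast
  have "1 \<in> mprod (mprod ?S ?M) ?K"
  proof (rule local_global)
    show dSM: "dmod (mprod (mprod ?S ?M) ?K)" by (intro dmod_mprod dS dM dmod_colon)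
    fix P assume P: "P \<in> Spec D"
    have *: "mprod I J \<subseteq> loc (mprod ?S ?M) P"
    proof (rule mprod_least)
      fix x y assume x: "x \<in> I" and y: "y \<in> J"
      consider "loc I P \<subseteq> loc J P" | "loc J P \<subseteq> loc I P" using loc_chain[OF P dI dJ] by blast
      then show "x * y \<in> loc (mprod ?S ?M) P"
      proof cases
        case 1
        then have "x \<in> loc ?M P" using loc_Int[OF P dI dJ] subset_loc[OF P, of I] x by blast
        moreover have "y \<in> loc ?S P" using isum_upper(2)[OF dI dJ] subset_loc[OF P, of ?S] y by blast
        ultimately show ?thesis using loc_mult[OF P, of y ?S x ?M] by (simp add: mult.commute)
      next
        case 2
        then have "y \<in> loc ?M P" using loc_Int[OF P dI dJ] subset_loc[OF P, of J] y by blast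
        moreover have "x \<in> loc ?S P" using isum_upper(1)[OF dI dJ] subset_loc[OF P, of ?S] x by blast
        ultimately show ?thesis using loc_mult[OF P, of x ?S y ?M] by simp
      qed
    qed (rule loc_add[OF P dmod_mprod[OF dS dM]])
    have "mprod (mprod I J) ?K \<subseteq> loc (mprod (mprod ?S ?M) ?K) P"
    proof (rule mprod_least)
      fix x y assume "x \<in> mprod I J" "y \<in> ?K"
      then show "x * y \<in> loc (mprod (mprod ?S ?M) ?K) P"
        using * loc_mult[OF P, of x "mprod ?S ?M" y ?K] subset_loc[OF P, of ?K] by blast
    qed (rule loc_add[OF P dSM])
    then show "1 \<in> loc (mprod (mprod ?S ?M) ?K) P" using IJK D_closed(2) by blast
  qed
  then show "D \<subseteq> mprod (mprod ?S ?M) ?K"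
    by (rule dmod_one_subset[rotated]) (intro dmod_mprod dS dM dmod_colon)
qed

lemma inv_mod_isum_Int:
  assumes I: "inv_mod I" and J: "inv_mod J"
  shows "inv_mod (isum I J)" "inv_mod (I \<inter> J)"
proof -
  note dI = inv_mod_dmod[OF I] and dJ = inv_mod_dmod[OF J]
  let ?S = "isum I J" and ?M = "I \<inter> J" and ?K = "mprod (colon D I) (colon D J)"
  have K: "dmod ?K" by (intro dmod_mprod dmod_colon)
  have "mprod ?S (mprod ?M ?K) = D" "mprod ?M (mprod ?S ?K) = D"
    using isum_mprod_Int_eq[OF I J] by (metis mprod_assoc mprod_commute)+
  then show "inv_mod ?S" "inv_mod ?M"
    using inv_mod_inverse_unique(1)[OF dmod_isum[OF dI dJ] dmod_mprod[OF dmod_Int[OF dI dJ] K]]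
      inv_mod_inverse_unique(1)[OF dmod_Int[OF dI dJ] dmod_mprod[OF dmod_isum[OF dI dJ] K]] by simp_all
qed

text \<open>
This and the next lemma allow the support conditions to be stated as \<open>1 \<in> I D\<^sub>P\<close> and \<open>1 \<in> (D:I) D\<^sub>P\<close>, which are
easier to propagate than equalities of modules.
\<close>

lemma loc_subset_of_colon_unit:
  assumes P: "P \<in> Spec D" and I: "dmod I" and one: "1 \<in> loc (colon D I) P"
  shows "loc I P \<subseteq> loc D P"
proof
  fix x assume "x \<in> loc I P"
  from loc_mult[OF P this one] show "x \<in> loc D P"
    using loc_mono[OF mprod_colon_subset, of I P] by auto
qed

lemma colon_unit_of_loc_subset:
  assumes P: "P \<in> Spec D" and I: "inv_mod I" and sub: "loc I P \<subseteq> loc D P"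
  shows "1 \<in> loc (colon D I) P"
proof -
  have "mprod I (colon D I) \<subseteq> loc (colon D I) P"
  proof (rule mprod_least)
    fix x y assume "x \<in> I" "y \<in> colon D I"
    then show "x * y \<in> loc (colon D I) P"
      using sub subset_loc[OF P] loc_smult[OF P dmod_colon, of x y I] by blast
  qed (rule loc_add[OF P dmod_colon])
  then show ?thesis using I by (auto simp: inv_mod_def)
qed

lemma colon_mprod_iff: "c \<in> colon D (mprod A B) \<longleftrightarrow> (\<forall>a\<in>A. c * a \<in> colon D B)"
proof
  assume c: "c \<in> colon D (mprod A B)"
  show "\<forall>a\<in>A. c * a \<in> colon D B"
  proof
    fix a assume "a \<in> A"
    then have "c * (a * b) \<in> D" if "b \<in> B" for b
      using c mprod_prod[OF _ that, of a A] by (simp add: colon_def)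
    then show "c * a \<in> colon D B" by (simp add: colon_def mult.assoc)
  qed
next
  assume c: "\<forall>a\<in>A. c * a \<in> colon D B"
  have "c * z \<in> D" if "z \<in> mprod A B" for z
    using that
  proof (induction rule: mprod_induct)
    case (prod a b)
    then have "c * a * b \<in> D" using c by (simp add: colon_def)
    then show ?case by (simp add: mult.assoc)
  next
    case (add z w)
    then show ?case by (simp add: distrib_left)
  qed
  then show "c \<in> colon D (mprod A B)" by (simp add: colon_def)
qed

lemma colon_mprod_v_closure:
  "colon D (mprod A (v_closure D B)) = colon D (mprod A B)"
  "colon D (mprod (v_closure D A) B) = colon D (mprod A B)"
proof -
  show *: "colon D (mprod A (v_closure D B)) = colon D (mprod A B)" for A B
    by (simp add: set_eq_iff colon_mprod_iff colon_v_closure)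
  show "colon D (mprod (v_closure D A) B) = colon D (mprod A B)"
    using *[of B A] by (simp add: mprod_commute)
qed

lemma v_closure_mprod_v_closure:
  "v_closure D (mprod A (v_closure D B)) = v_closure D (mprod A B)"
  "v_closure D (mprod (v_closure D A) B) = v_closure D (mprod A B)"
  by (simp_all add: v_closure_def[of D "mprod _ _"] colon_mprod_v_closure)

lemma v_closure_D: "v_closure D D = D"
  by (simp add: v_closure_def colon_D)

lemma v_closure_idem: "v_closure D (v_closure D I) = v_closure D I"
  by (simp add: v_closure_def[of D "v_closure D I"] colon_v_closure) (simp add: v_closure_def)

end

locale prufer_max = prufer +
  fixes Y :: "'a set set"
  assumes Y_max: "Y \<subseteq> MaxSpec D"
begin

text \<open>
Membership in \<open>Div_on D Y\<close> (\<open>carrier_Div_on\<close>), with the support conditions of the form \<open>1 \<in> I D\<^sub>P\<close>.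
\<close>

definition divY :: "'a set \<Rightarrow> bool" where
  "divY I \<longleftrightarrow> dmod I \<and> I \<noteq> {0} \<and> colon D I \<noteq> {0} \<and> v_closure D I = I \<and>
    v_closure D (mprod I (colon D I)) = D \<and>
    (\<forall>P\<in>Spec D - Y. 1 \<in> loc I P \<and> 1 \<in> loc (colon D I) P)"

lemma Y_Spec: "P \<in> Y \<Longrightarrow> P \<in> Spec D"
  using Y_max MaxSpec_Spec by blast

lemma nonzero_dmod: "dmod I \<Longrightarrow> I \<noteq> {0} \<longleftrightarrow> (\<exists>x\<in>I. x \<noteq> 0)"
  using dmod_0 by blast

lemma loc_eq_D_pair:
  assumes "P \<in> Spec D" "dmod I" "v_closure D I = I"
  shows "loc I P = loc D P \<and> loc (colon D I) P = loc D P \<longleftrightarrow> 1 \<in> loc I P \<and> 1 \<in> loc (colon D I) P"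
proof
  assume "loc I P = loc D P \<and> loc (colon D I) P = loc D P"
  then show "1 \<in> loc I P \<and> 1 \<in> loc (colon D I) P" using loc_D_closed(3)[OF assms(1)] by simp
next
  assume one: "1 \<in> loc I P \<and> 1 \<in> loc (colon D I) P"
  have D_sub: "loc D P \<subseteq> loc K P" if "dmod K" "1 \<in> loc K P" for K
    using loc_smult[OF assms(1) that(1) _ that(2)] by auto
  have cc: "colon D (colon D I) = I" using assms(3) by (simp add: v_closure_def)
  then have one': "1 \<in> loc (colon D (colon D I)) P" using one by metis
  have "loc I P = loc D P"
    using loc_subset_of_colon_unit[OF assms(1,2) conjunct2[OF one]] D_sub[OF assms(2) conjunct1[OF one]]
    by (rule subset_antisym)
  moreover have "loc (colon D I) P = loc D P"
    using loc_subset_of_colon_unit[OF assms(1) dmod_colon one']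
      D_sub[OF dmod_colon conjunct2[OF one]]
    by (rule subset_antisym)
  ultimately show "loc I P = loc D P \<and> loc (colon D I) P = loc D P" ..
qed

lemma carrier_Div_on: "I \<in> carrier (Div_on D Y) \<longleftrightarrow> divY I"
proof -
  have frac: "fractional_ideal D I \<longleftrightarrow> dmod I \<and> I \<noteq> {0} \<and> colon D I \<noteq> {0}"
  proof -
    have "(\<exists>d. d \<noteq> 0 \<and> (\<forall>x\<in>I. d * x \<in> D)) \<longleftrightarrow> colon D I \<noteq> {0}"
      using nonzero_dmod[OF dmod_colon, of I] by (auto simp: colon_def)
    then show ?thesis by (simp add: fractional_ideal_def submodule_iff)
  qed
  have supp: "supp D J \<subseteq> Y \<longleftrightarrow> (\<forall>P\<in>Spec D - Y. loc J P = loc D P)" if "dmod J" for J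
    using mprod_loc[OF _ that] loc_D_eq by (auto simp: supp_def)
  show ?thesis
  proof (cases "dmod I \<and> v_closure D I = I")
    case True
    then have "(\<forall>P\<in>Spec D - Y. loc I P = loc D P \<and> loc (colon D I) P = loc D P) \<longleftrightarrow>
        (\<forall>P\<in>Spec D - Y. 1 \<in> loc I P \<and> 1 \<in> loc (colon D I) P)"
      using loc_eq_D_pair[of _ I] by simp
    then have "supp D I \<subseteq> Y \<and> supp D (colon D I) \<subseteq> Y \<longleftrightarrow>
        (\<forall>P\<in>Spec D - Y. 1 \<in> loc I P \<and> 1 \<in> loc (colon D I) P)"
      using supp[of I] supp[OF dmod_colon, of I] True by (simp add: ball_conj_distrib)
    moreover have "I \<in> carrier (Div_on D Y) \<longleftrightarrow> fractional_ideal D I \<and> divisorial D I \<and>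
        v_invertible D I \<and> supp D I \<subseteq> Y \<and> supp D (colon D I) \<subseteq> Y"
      by (simp add: Div_on_def Div_def)
    ultimately show ?thesis
      using True by (simp add: frac divY_def divisorial_def v_invertible_def)
  next
    case False
    then have "\<not> (fractional_ideal D I \<and> divisorial D I)"
      unfolding frac divisorial_def by metis
    moreover have "\<not> divY I" using False unfolding divY_def by blast
    moreover have "I \<in> carrier (Div_on D Y) \<Longrightarrow> fractional_ideal D I \<and> divisorial D I"
      by (simp add: Div_on_def Div_def)
    ultimately show ?thesis by blast
  qed
qed

lemma mult_Div_on: "I \<otimes>\<^bsub>Div_on D Y\<^esub> J = v_closure D (mprod I J)"
  by (simp add: Div_on_def Div_def)

lemma one_Div_on: "\<one>\<^bsub>Div_on D Y\<^esub> = D"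
  by (simp add: Div_on_def Div_def)

lemma divYD:
  assumes "divY I"
  shows "dmod I" "v_closure D I = I" "v_closure D (mprod I (colon D I)) = D"
    "\<And>P. P \<in> Spec D - Y \<Longrightarrow> 1 \<in> loc I P" "\<And>P. P \<in> Spec D - Y \<Longrightarrow> 1 \<in> loc (colon D I) P"
    "colon D (colon D I) = I" "colon D (mprod I (colon D I)) = D"
proof -
  show I: "dmod I" "v_closure D I = I" "v_closure D (mprod I (colon D I)) = D"
    "\<And>P. P \<in> Spec D - Y \<Longrightarrow> 1 \<in> loc I P" "\<And>P. P \<in> Spec D - Y \<Longrightarrow> 1 \<in> loc (colon D I) P"
    using assms unfolding divY_def by blast+
  show "colon D (colon D I) = I" using I(2) by (simp add: v_closure_def)
  show "colon D (mprod I (colon D I)) = D"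
    using colon_v_closure[of D "mprod I (colon D I)"] I(3) colon_D by simp
qed

lemma divY_D: "divY D"
proof -
  have "D \<noteq> {0}" using D_closed(2) by (metis singletonD zero_neq_one)
  then show ?thesis
    using dmod_D v_closure_D mprod_D[OF dmod_D] loc_D_closed(3) by (simp add: divY_def colon_D)
qed

lemma divY_colon:
  assumes "divY I"
  shows "divY (colon D I)"
proof -
  note I = divYD[OF assms]
  have "v_closure D (colon D I) = colon D I" using I(6) by (simp add: v_closure_def)
  moreover have "v_closure D (mprod (colon D I) I) = D" using I(3) mprod_commute[of I] by metis
  ultimately show ?thesis
    using assms dmod_colon[of I] I(4,5) unfolding divY_def I(6) by blast
qed

lemma mprod_colon_subset_colon_mprod:
  assumes "dmod I" "dmod J"
  shows "mprod (colon D I) (colon D J) \<subseteq> colon D (mprod I J)"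
proof (rule mprod_least)
  fix a b assume ab: "a \<in> colon D I" "b \<in> colon D J"
  have "a * b * x \<in> colon D J" if "x \<in> I" for x
    using dmod_mult[OF dmod_colon colon_dmult[OF that ab(1)] ab(2)] by (simp add: mult_ac)
  then show "a * b \<in> colon D (mprod I J)" by (simp add: colon_mprod_iff)
qed (rule dmod_add[OF dmod_colon])

lemma divY_mult:
  assumes I: "divY I" and J: "divY J"
  shows "divY (v_closure D (mprod I J))"
proof -
  let ?L = "v_closure D (mprod I J)" and ?C = "colon D (mprod I J)"
  note dI = divYD(1)[OF I] and dJ = divYD(1)[OF J]
  have CL: "colon D ?L = ?C" by (rule colon_v_closure)
  have sub: "mprod (colon D I) (colon D J) \<subseteq> ?C" by (rule mprod_colon_subset_colon_mprod[OF dI dJ])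
  have nz: "\<exists>z\<in>mprod A B. z \<noteq> 0" if "\<exists>x\<in>A. x \<noteq> 0" "\<exists>x\<in>B. x \<noteq> 0" for A B :: "'a set"
  proof -
    from that obtain x y where "x \<in> A" "x \<noteq> 0" "y \<in> B" "y \<noteq> 0" by blast
    then show ?thesis by (intro bexI[of _ "x * y"] mprod_prod) simp_all
  qed
  have "\<exists>x\<in>I. x \<noteq> 0" "\<exists>x\<in>J. x \<noteq> 0" "\<exists>x\<in>colon D I. x \<noteq> 0" "\<exists>x\<in>colon D J. x \<noteq> 0"
    using I J nonzero_dmod dI dJ dmod_colon unfolding divY_def by blast+
  with nz[of I J] nz[of "colon D I" "colon D J"] have "?L \<noteq> {0}" "?C \<noteq> {0}"
    using subset_v_closure[of "mprod I J" D] sub by blast+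
  moreover have "v_closure D (mprod ?L ?C) = D"
  proof
    have "mprod ?L ?C \<subseteq> D" using mprod_colon_subset[of ?L] CL by simp
    then show "v_closure D (mprod ?L ?C) \<subseteq> D" using v_closure_mono v_closure_D by metis
    let ?A = "mprod I (colon D I)" and ?B = "mprod J (colon D J)"
    have "mprod ?A ?B = mprod (mprod I J) (mprod (colon D I) (colon D J))" by (rule mprod_swap)
    also have "\<dots> \<subseteq> mprod ?L ?C" by (intro mprod_mono subset_v_closure sub)
    finally have "v_closure D (mprod ?A ?B) \<subseteq> v_closure D (mprod ?L ?C)" by (rule v_closure_mono)
    moreover have "colon D (mprod ?A ?B) = D"
    proof
      show "colon D (mprod ?A ?B) \<subseteq> D"
      proof
        fix c assume "c \<in> colon D (mprod ?A ?B)"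
        then have "c \<in> colon D ?A" using divYD(7)[OF J] by (auto simp: colon_mprod_iff colon_def[of D ?A])
        then show "c \<in> D" using divYD(7)[OF I] by simp
      qed
      have "mprod ?A ?B \<subseteq> D"
        using mprod_colon_subset[of I] mprod_colon_subset[of J] by (intro mprod_subset_D D_closed(4)) blast+
      then show "D \<subseteq> colon D (mprod ?A ?B)" using colon_antimono colon_D by metis
    qed
    then have "v_closure D (mprod ?A ?B) = D" by (simp add: v_closure_def colon_D)
    ultimately show "D \<subseteq> v_closure D (mprod ?L ?C)" by simp
  qed
  moreover have "1 \<in> loc ?L P" "1 \<in> loc ?C P" if P: "P \<in> Spec D - Y" for P
  proof -
    have PS: "P \<in> Spec D" using P by blast
    have "1 * 1 \<in> loc (mprod I J) P" using divYD(4)[OF I P] divYD(4)[OF J P] by (rule loc_mult[OF PS])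
    then show "1 \<in> loc ?L P" using loc_mono[OF subset_v_closure] by auto
    have "1 * 1 \<in> loc (mprod (colon D I) (colon D J)) P"
      using divYD(5)[OF I P] divYD(5)[OF J P] by (rule loc_mult[OF PS])
    then show "1 \<in> loc ?C P" using loc_mono[OF sub] by auto
  qed
  ultimately show ?thesis
    using dmod_v_closure v_closure_idem by (auto simp: divY_def CL)
qed

theorem comm_group_Div_on: "comm_group (Div_on D Y)"
proof (rule comm_groupI, unfold carrier_Div_on mult_Div_on one_Div_on)
  fix I J K assume I: "divY I" and J: "divY J"
  show "divY (v_closure D (mprod I J))" by (rule divY_mult[OF I J])
  show "v_closure D (mprod I J) = v_closure D (mprod J I)" by (simp add: mprod_commute)
  show "v_closure D (mprod (v_closure D (mprod I J)) K) = v_closure D (mprod I (v_closure D (mprod J K)))"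
    by (simp add: v_closure_mprod_v_closure mprod_assoc)
next
  fix I assume I: "divY I"
  show "v_closure D (mprod D I) = I" using mprod_D divYD[OF I] by (simp add: mprod_commute[of D])
  have "v_closure D (mprod (colon D I) I) = D" using divYD(3)[OF I] by (simp add: mprod_commute)
  then show "\<exists>J\<in>carrier (Div_on D Y). v_closure D (mprod J I) = D"
    using divY_colon[OF I] by (intro bexI[of _ "colon D I"]) (simp_all add: carrier_Div_on)
qed (rule divY_D)

text \<open>
Membership in \<open>Inv_on D Y\<close> (\<open>Inv_on_iff\<close>).
\<close>

definition invY :: "'a set \<Rightarrow> bool" where
  "invY I \<longleftrightarrow> inv_mod I \<and> (\<forall>P\<in>Spec D - Y. 1 \<in> loc I P \<and> 1 \<in> loc (colon D I) P)"

lemma invY_divY: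
  assumes "invY I"
  shows "divY I"
proof -
  have I: "inv_mod I" using assms by (simp add: invY_def)
  have "I \<noteq> {0} \<and> colon D I \<noteq> {0}"
  proof (rule ccontr)
    assume "\<not> ?thesis"
    then have "mprod I (colon D I) \<subseteq> {0}" by (intro mprod_least) auto
    then show False using I by (auto simp: inv_mod_def)
  qed
  then show ?thesis
    using assms inv_mod_dmod[OF I] inv_mod_divisorial[OF I] mprod_colon_eq[OF I] v_closure_D
    by (simp add: divY_def invY_def)
qed

lemma Inv_on_iff: "I \<in> Inv_on D Y \<longleftrightarrow> invY I"
proof
  assume "I \<in> Inv_on D Y"
  then have "invertible D I" "divY I" by (simp_all add: Inv_on_def Inv_def carrier_Div_on)
  then have "dmod I" "1 \<in> mprod I (colon D I)" by (simp_all add: divYD(1) invertible_def)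
  then show "invY I" using \<open>divY I\<close> unfolding divY_def invY_def inv_mod_def by blast
next
  assume I: "invY I"
  then have "invertible D I" by (simp add: invY_def invertible_def mprod_colon_eq)
  moreover have "I \<in> carrier (Div_on D Y)" using invY_divY[OF I] by (simp add: carrier_Div_on)
  moreover have "fractional_ideal D I"
    using calculation(2) by (simp add: Div_on_def Div_def)
  ultimately show "I \<in> Inv_on D Y" by (simp add: Inv_on_def Inv_def)
qed

lemma invY_mprod:
  assumes "invY I" "invY J"
  shows "invY (mprod I J)"
proof -
  have inv_mod: "inv_mod I" "inv_mod J" using assms by (simp_all add: invY_def)
  have "v_closure D (mprod I J) = mprod I J" using inv_mod_divisorial[OF inv_mod_mprod(1)[OF inv_mod]] .
  then have "divY (mprod I J)" using divY_mult[OF invY_divY invY_divY, OF assms] by simp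
  then show ?thesis using inv_mod_mprod(1)[OF inv_mod] unfolding invY_def divY_def by blast
qed

lemma invY_colon:
  assumes "invY I"
  shows "invY (colon D I)"
  using inv_mod_colon[of I] assms divY_colon[OF invY_divY[OF assms]] unfolding invY_def divY_def by blast

lemma invY_integralI:
  assumes I: "inv_mod I" "I \<subseteq> D" and sub: "\<And>P. P \<in> Spec D - Y \<Longrightarrow> \<not> I \<subseteq> P"
  shows "invY I"
proof -
  have "1 \<in> loc I P \<and> 1 \<in> loc (colon D I) P" if P: "P \<in> Spec D - Y" for P
  proof -
    have PS: "P \<in> Spec D" using P by blast
    have "1 \<in> loc I P" using loc_one_iff[OF PS inv_mod_dmod[OF I(1)] I(2)] sub[OF P] by simp
    moreover have "1 \<in> loc (colon D I) P"
      by (rule colon_unit_of_loc_subset[OF PS I(1) loc_mono[OF I(2)]])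
    ultimately show ?thesis ..
  qed
  then show ?thesis using I by (simp add: invY_def)
qed

lemma invY_not_subset:
  assumes "invY I" "I \<subseteq> D" "P \<in> Spec D - Y"
  shows "\<not> I \<subseteq> P"
  using assms loc_one_iff[of P I] inv_mod_dmod[of I] by (auto simp: invY_def)

end

section \<open>Values at maximal ideals\<close>

locale prufer_disc = prufer_max +
  assumes strong: "strongly_discrete D"
    and Y_nonzero: "P \<in> Y \<Longrightarrow> P \<noteq> {0}"
begin

lemma nonunit_loc:
  assumes P: "P \<in> Spec D" and v: "v \<in> loc D P" "inverse v \<notin> loc D P"
  shows "v \<in> loc P P"
proof -
  obtain s where s: "s \<in> D" "s \<notin> P" "s * v \<in> D" using locE[OF v(1)] .
  have "s * v \<in> P"
  proof (rule ccontr)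
    assume "s * v \<notin> P"
    moreover have "s * v * inverse v \<in> D" using s by (cases "v = 0") (simp_all add: mult.assoc)
    ultimately show False using v(2) locI[of "s * v" P "inverse v" D] s by blast
  qed
  then show ?thesis using s by (intro locI[of s])
qed

text \<open>
As \<open>P\<close> is maximal, \<open>P \<noteq> P\<^sup>2\<close> persists in \<open>D\<^sub>P\<close>.  An element of \<open>P\<close> outside \<open>P\<^sup>2 D\<^sub>P\<close> divides every element of
the maximal ideal of the valuation domain \<open>D\<^sub>P\<close>: otherwise it would be a product of two nonunits.
\<close>

lemma exists_uniformizer:
  assumes PY: "P \<in> Y"
  shows "\<exists>\<pi>. \<pi> \<in> P \<and> \<pi> \<noteq> 0 \<and> (\<forall>x\<in>loc P P. x / \<pi> \<in> loc D P)"
proof -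
  have P: "P \<in> Spec D" using PY by (rule Y_Spec)
  note dP = Spec_dmod[OF P]
  have "P \<noteq> mprod P P" using strong P Y_nonzero[OF PY] by (simp add: strongly_discrete_def)
  moreover have "mprod P P \<subseteq> P"
    by (rule mprod_least) (use dmod_mult[OF dP] Spec_subset[OF P] dmod_add[OF dP] in blast)+
  ultimately obtain \<pi> where \<pi>: "\<pi> \<in> P" "\<pi> \<notin> mprod P P" by blast
  note dPP = dmod_mprod[OF dP dP]
  have not_loc: "\<pi> \<notin> loc (mprod P P) P"
  proof
    assume "\<pi> \<in> loc (mprod P P) P"
    then obtain s where s: "s \<in> D" "s \<notin> P" "s * \<pi> \<in> mprod P P" by (rule locE)
    obtain p t where pt: "p \<in> P" "t \<in> D" "p + t * s = 1"
      using MaxSpec_comax[OF _ s(1,2)] PY Y_max by blast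
    have "\<pi> = (p + t * s) * \<pi>" by (simp add: pt)
    also have "\<dots> = p * \<pi> + t * (s * \<pi>)" by (simp add: algebra_simps)
    also have "\<dots> \<in> mprod P P"
      by (rule dmod_add[OF dPP mprod_prod[OF pt(1) \<pi>(1)] dmod_mult[OF dPP pt(2) s(3)]])
    finally show False using \<pi>(2) by simp
  qed
  have nz: "\<pi> \<noteq> 0" using \<pi>(2) dmod_0[OF dPP] by blast
  have "x / \<pi> \<in> loc D P" if x: "x \<in> loc P P" for x
  proof (rule ccontr)
    assume no: "x / \<pi> \<notin> loc D P"
    then have "x \<noteq> 0" using loc_D_closed(4)[OF P] by auto
    have "\<pi> / x \<in> loc D P" using loc_valuation[OF P, of "x / \<pi>"] no \<open>x \<noteq> 0\<close> nz by simp
    then have "\<pi> / x \<in> loc P P" by (rule nonunit_loc[OF P]) (use no in simp)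
    from loc_mult[OF P this x] not_loc \<open>x \<noteq> 0\<close> show False by simp
  qed
  then show ?thesis using \<pi>(1) nz by blast
qed

definition unif :: "'a set \<Rightarrow> 'a" where
  "unif P = (SOME \<pi>. \<pi> \<in> P \<and> \<pi> \<noteq> 0 \<and> (\<forall>x\<in>loc P P. x / \<pi> \<in> loc D P))"

lemma unif:
  assumes "P \<in> Y"
  shows "unif P \<in> P" "unif P \<noteq> 0" "x \<in> loc P P \<Longrightarrow> x / unif P \<in> loc D P"
  using someI_ex[OF exists_uniformizer[OF assms]] unfolding unif_def by blast+

text \<open>
The module \<open>\<pi>\<^sup>n D\<^sub>P\<close>, where \<open>\<pi>\<close> is the chosen uniformizer at \<open>P\<close>.
\<close>

definition pw :: "'a set \<Rightarrow> int \<Rightarrow> 'a set" where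
  "pw P n = {x. x * unif P powi (- n) \<in> loc D P}"

context
  fixes P assumes PY: "P \<in> Y"
begin

lemma PS: "P \<in> Spec D"
  using PY by (rule Y_Spec)

lemma unif_D: "unif P \<in> D"
  using unif(1)[OF PY] Spec_subset[OF PS] by blast

lemma unif_add: "unif P powi (m + n) = unif P powi m * unif P powi n"
  by (rule power_int_add) (use unif(2)[OF PY] in simp)

lemma unif_powi_nz: "unif P powi n \<noteq> 0"
  using unif(2)[OF PY] by simp

lemma inverse_unif: "inverse (unif P) \<notin> loc D P"
proof
  assume "inverse (unif P) \<in> loc D P"
  then obtain s where s: "s \<in> D" "s \<notin> P" "s * inverse (unif P) \<in> D" by (rule locE)
  have "s = s * inverse (unif P) * unif P" using unif(2)[OF PY] by simp
  also have "\<dots> \<in> P" by (rule dmod_mult[OF Spec_dmod[OF PS] s(3) unif(1)[OF PY]])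
  finally show False using s(2) by simp
qed

lemma unif_powi_loc_iff: "unif P powi k \<in> loc D P \<longleftrightarrow> 0 \<le> k"
proof
  assume "0 \<le> k"
  then have "unif P powi k = unif P ^ nat k" by (simp add: power_int_def)
  then show "unif P powi k \<in> loc D P" using subset_loc[OF PS, of D] D_power[OF unif_D] by auto
next
  assume k: "unif P powi k \<in> loc D P"
  show "0 \<le> k"
  proof (rule ccontr)
    assume "\<not> 0 \<le> k"
    then have "unif P powi (- k - 1) = unif P ^ nat (- k - 1)" by (simp add: power_int_def)
    then have "unif P powi (- k - 1) \<in> loc D P"
      using subset_loc[OF PS, of D] D_power[OF unif_D] by auto
    from loc_D_closed(1)[OF PS k this] have "unif P powi (- 1) \<in> loc D P"
      by (simp flip: unif_add)
    then show False using inverse_unif by (simp add: power_int_minus)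
  qed
qed

lemma unif_powi_pw_iff: "unif P powi m \<in> pw P n \<longleftrightarrow> n \<le> m"
proof -
  have "unif P powi m * unif P powi (- n) = unif P powi (m - n)" by (simp flip: unif_add)
  then show ?thesis unfolding pw_def using unif_powi_loc_iff[of "m - n"] by simp
qed

lemma pw_smult: "v \<in> loc D P \<Longrightarrow> x \<in> pw P n \<Longrightarrow> v * x \<in> pw P n"
  unfolding pw_def using loc_D_closed(1)[OF PS] by (simp add: mult.assoc)

lemma pw_add: "x \<in> pw P n \<Longrightarrow> y \<in> pw P n \<Longrightarrow> x + y \<in> pw P n"
  unfolding pw_def using loc_D_closed(2)[OF PS] by (simp add: distrib_right)

lemma pw_0: "pw P 0 = loc D P"
  by (simp add: pw_def)

lemma pw_generated:
  assumes "x \<in> pw P n"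
  obtains v where "v \<in> loc D P" "x = v * unif P powi n"
proof
  show "x * unif P powi (- n) \<in> loc D P" using assms by (simp add: pw_def)
  have "unif P powi (- n) * unif P powi n = 1" by (simp flip: unif_add)
  then show "x = x * unif P powi (- n) * unif P powi n" by (simp add: mult.assoc)
qed

lemma pw_subset_iff: "pw P m \<subseteq> pw P n \<longleftrightarrow> n \<le> m"
proof
  assume "pw P m \<subseteq> pw P n"
  then show "n \<le> m" using unif_powi_pw_iff[of m m] unif_powi_pw_iff[of m n] by blast
next
  assume nm: "n \<le> m"
  show "pw P m \<subseteq> pw P n"
  proof
    fix x assume "x \<in> pw P m"
    then obtain v where v: "v \<in> loc D P" "x = v * unif P powi m" by (rule pw_generated)
    then show "x \<in> pw P n" using pw_smult[OF v(1)] unif_powi_pw_iff nm by blast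
  qed
qed

lemma pw_inject: "pw P m = pw P n \<Longrightarrow> m = n"
  using pw_subset_iff[of m n] pw_subset_iff[of n m] by auto

lemma pw_mult: "x \<in> pw P m \<Longrightarrow> y \<in> pw P n \<Longrightarrow> x * y \<in> pw P (m + n)"
proof -
  assume "x \<in> pw P m" "y \<in> pw P n"
  then have "(x * unif P powi (- m)) * (y * unif P powi (- n)) \<in> loc D P"
    unfolding pw_def by (intro loc_D_closed(1)[OF PS, of "x * _" "y * _"]) simp_all
  moreover have "unif P powi (- (m + n)) = unif P powi (- m) * unif P powi (- n)"
    by (simp flip: unif_add)
  ultimately show ?thesis by (simp add: pw_def mult_ac)
qed

lemma loc_mprod_pw:
  assumes "dmod I" "dmod J" "loc I P = pw P m" "loc J P = pw P n"
  shows "loc (mprod I J) P = pw P (m + n)"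
proof
  have sub: "mprod I J \<subseteq> pw P (m + n)"
  proof (rule mprod_least)
    fix x y assume "x \<in> I" "y \<in> J"
    then show "x * y \<in> pw P (m + n)"
      using subset_loc[OF PS, of I] subset_loc[OF PS, of J] assms(3,4) pw_mult by blast
  qed (rule pw_add)
  show "loc (mprod I J) P \<subseteq> pw P (m + n)"
  proof
    fix y assume "y \<in> loc (mprod I J) P"
    then obtain s where s: "s \<in> D" "s \<notin> P" "s * y \<in> mprod I J" by (rule locE)
    then have "s * y \<in> pw P (m + n)" using sub by blast
    then have "inverse s * (s * y) \<in> pw P (m + n)"
      by (rule pw_smult[OF inverse_loc_D[OF PS s(1,2)]])
    moreover have "inverse s * (s * y) = y" using loc_nonzero[OF PS s(1,2)] by simp
    ultimately show "y \<in> pw P (m + n)" by metis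
  qed
  show "pw P (m + n) \<subseteq> loc (mprod I J) P"
  proof
    fix x assume "x \<in> pw P (m + n)"
    then obtain v where v: "v \<in> loc D P" "x = v * unif P powi (m + n)" by (rule pw_generated)
    have "unif P powi m * unif P powi n \<in> loc (mprod I J) P"
      by (rule loc_mult[OF PS]) (simp_all add: assms(3,4) unif_powi_pw_iff)
    then show "x \<in> loc (mprod I J) P"
      using loc_smult[OF PS dmod_mprod[OF assms(1,2)] v(1)] v(2) unif_add by metis
  qed
qed

text \<open>
The intersection \<open>p\<close> of all \<open>\<pi>\<^sup>n D\<^sub>P\<close> is a prime strictly below \<open>P\<close>.  As the members of \<open>Y\<close> are maximal, \<open>p \<notin> Y\<close>, so
members of \<open>Div_on D Y\<close> are trivial at \<open>p\<close>.
\<close>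

lemma prime_below_Spec:
  "{x\<in>D. \<forall>n::nat. x \<in> pw P (int n)} \<in> Spec D" (is "?p \<in> _")
  "{x\<in>D. \<forall>n::nat. x \<in> pw P (int n)} \<notin> Y"
proof -
  have sub_pw: "x \<in> pw P (int k)" if "x \<in> pw P (int n)" "k \<le> n" for x k n
    using that pw_subset_iff[of "int n" "int k"] by auto
  show "?p \<in> Spec D"
  proof (rule SpecI)
    show "dmod ?p"
    proof (rule dmodI)
      show "0 \<in> ?p" using loc_D_closed(4)[OF PS] by (simp add: pw_def)
      show "x + y \<in> ?p" if "x \<in> ?p" "y \<in> ?p" for x y
        using that pw_add[of x _ y] by simp
      show "d * x \<in> ?p" if "d \<in> D" "x \<in> ?p" for d x
        using that pw_smult[of d x] subset_loc[OF PS, of D] by auto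
    qed
    have "1 \<notin> pw P (int 1)" using unif_powi_pw_iff[of 0 1] by simp
    then show "1 \<notin> ?p" by blast
    fix a b assume ab: "a \<in> D" "b \<in> D" "a * b \<in> ?p"
    show "a \<in> ?p \<or> b \<in> ?p"
    proof (rule ccontr)
      assume "\<not> (a \<in> ?p \<or> b \<in> ?p)"
      then obtain m n where mn: "a \<notin> pw P (int m)" "b \<notin> pw P (int n)" using ab by blast
      have rev: "unif P powi int k * inverse x \<in> loc D P" and nz: "x \<noteq> 0"
        if "x \<notin> pw P (int k)" for x k
      proof -
        show "x \<noteq> 0" using that loc_D_closed(4)[OF PS] by (auto simp: pw_def)
        have "x * unif P powi (- int k) \<notin> loc D P" using that by (simp add: pw_def)
        then have "inverse (x * unif P powi (- int k)) \<in> loc D P"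
          using loc_valuation[OF PS, of "x * unif P powi (- int k)"] unif(2)[OF PY] \<open>x \<noteq> 0\<close> by simp
        then show "unif P powi int k * inverse x \<in> loc D P"
          by (simp add: power_int_minus mult.commute)
      qed
      have "unif P powi int m * inverse a * (unif P powi int n * inverse b) \<in> loc D P"
        by (rule loc_D_closed(1)[OF PS rev[OF mn(1)] rev[OF mn(2)]])
      moreover have "a * b \<in> pw P (int (m + n + 1))" using ab by blast
      ultimately have "unif P powi int m * inverse a * (unif P powi int n * inverse b) * (a * b)
          \<in> pw P (int (m + n + 1))" by (rule pw_smult)
      also have "unif P powi int m * inverse a * (unif P powi int n * inverse b) * (a * b)
          = unif P powi (int m + int n)"
        using nz[OF mn(1)] nz[OF mn(2)] by (simp add: unif_add field_simps)
      finally show False using unif_powi_pw_iff[of "int m + int n" "int (m + n + 1)"] by simp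
    qed
  qed auto
  show "?p \<notin> Y"
  proof
    assume pY: "?p \<in> Y"
    have "unif P \<notin> pw P (int 2)" using unif_powi_pw_iff[of 1 2] by simp
    then have "unif P \<notin> ?p" by blast
    then obtain q t where qt: "q \<in> ?p" "t \<in> D" "q + t * unif P = 1"
      using MaxSpec_comax[OF _ unif_D] pY Y_max by blast
    have "q \<in> P"
    proof -
      have "q \<in> pw P (int 1)" using qt(1) by blast
      then obtain v where "v \<in> loc D P" "q = v * unif P" by (auto elim: pw_generated)
      then have "q \<in> loc P P"
        using loc_smult[OF PS Spec_dmod[OF PS]] subset_loc[OF PS, of P] unif(1)[OF PY] by blast
      then show ?thesis using loc_prime_iff[OF PS] qt(1) by blast
    qed
    then have "1 \<in> P"
      using dmod_add[OF Spec_dmod[OF PS] _ dmod_mult[OF Spec_dmod[OF PS] qt(2) unif(1)[OF PY]]] qt(3) by metis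
    then show False using Spec_1[OF PS] by blast
  qed
qed

text \<open>
Triviality of \<open>W\<close> at the prime \<open>p\<close> below \<open>P\<close> provides an element of \<open>W\<close> outside \<open>p\<close>; such an element is not divisible
by some power of the uniformizer, so it divides that power.
\<close>

lemma unif_power_mem:
  assumes W: "dmod W" and one: "\<And>p. p \<in> Spec D - Y \<Longrightarrow> 1 \<in> loc W p"
  shows "\<exists>a::nat. unif P powi int a \<in> loc W P"
proof -
  let ?p = "{x\<in>D. \<forall>n::nat. x \<in> pw P (int n)}"
  have "1 \<in> loc W ?p" using one prime_below_Spec by blast
  then obtain s where s: "s \<in> D" "s \<notin> ?p" "s * 1 \<in> W" by (rule locE)
  then obtain n where n: "s \<notin> pw P (int n)" by blast
  then have nz: "s \<noteq> 0" using loc_D_closed(4)[OF PS] by (auto simp: pw_def)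
  have "s * unif P powi (- int n) \<notin> loc D P" using n by (simp add: pw_def)
  then have "inverse (s * unif P powi (- int n)) \<in> loc D P"
    using loc_valuation[OF PS, of "s * unif P powi (- int n)"] unif(2)[OF PY] nz by simp
  then have "unif P powi int n * inverse s \<in> loc D P"
    by (simp add: power_int_minus mult.commute)
  moreover have "s \<in> loc W P" using s(3) subset_loc[OF PS, of W] by auto
  ultimately have "unif P powi int n * inverse s * s \<in> loc W P" by (rule loc_smult[OF PS W])
  then show ?thesis using nz by (intro exI[of _ n]) (simp add: mult.assoc)
qed

text \<open>
By \<open>unif_power_mem\<close> for \<open>I\<close> and for \<open>D:I\<close>, the exponents of the powers of the uniformizer in \<open>I D\<^sub>P\<close> are bounded below and
do occur.  The least one generates \<open>I D\<^sub>P\<close>, as there is nothing between consecutive powers.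
\<close>

lemma loc_eq_pw:
  assumes I: "divY I"
  shows "\<exists>n. loc I P = pw P n"
proof -
  note dI = divYD(1)[OF I]
  obtain a :: nat where a: "unif P powi int a \<in> loc I P"
    using unif_power_mem[OF dI divYD(4)[OF I]] by blast
  obtain b :: nat where b: "unif P powi int b \<in> loc (colon D I) P"
    using unif_power_mem[OF dmod_colon divYD(5)[OF I]] by blast
  have lower: "- int b \<le> n" if "unif P powi n \<in> loc I P" for n
  proof -
    have "unif P powi n * unif P powi int b \<in> loc D P"
      using loc_mult[OF PS that b] loc_mono[OF mprod_colon_subset] by blast
    then show ?thesis using unif_powi_loc_iff[of "n + int b"] by (simp add: unif_add)
  qed
  \<comment> \<open>Exponents are at least \<open>- b\<close>, so shifting them by \<open>b\<close> turns them into natural numbers.\<close>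
  define Q where "Q j \<longleftrightarrow> unif P powi (int j - int b) \<in> loc I P" for j :: nat
  have "Q (a + b)" using a by (simp add: Q_def)
  define k where "k = (LEAST j. Q j)"
  have Qk: "Q k" unfolding k_def using \<open>Q (a + b)\<close> by (rule LeastI)
  have k_le: "k \<le> j" if "Q j" for j unfolding k_def using that by (rule Least_le)
  have k: "unif P powi (int k - int b) \<in> loc I P" using Qk by (simp only: Q_def)
  have least: "unif P powi (int k - int b - 1) \<notin> loc I P"
  proof
    assume no: "unif P powi (int k - int b - 1) \<in> loc I P"
    from lower[OF no] have "k > 0" by linarith
    then have eq: "int k - int b - 1 = int (k - 1) - int b" by linarith
    have "Q (k - 1)" using no unfolding Q_def eq .
    from k_le[OF this] \<open>k > 0\<close> show False by linarith
  qed
  define n where "n = int k - int b"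
  note k = k[folded n_def] and least = least[folded n_def]
  have "loc I P = pw P n"
  proof
    show "pw P n \<subseteq> loc I P"
    proof
      fix x assume "x \<in> pw P n"
      then obtain v where v: "v \<in> loc D P" "x = v * unif P powi n" by (rule pw_generated)
      then show "x \<in> loc I P" using loc_smult[OF PS dI v(1) k] by simp
    qed
    show "loc I P \<subseteq> pw P n"
    proof
      fix y assume y: "y \<in> loc I P"
      show "y \<in> pw P n"
      proof (rule ccontr)
        assume no: "y \<notin> pw P n"
        then have nz: "y \<noteq> 0" using loc_D_closed(4)[OF PS] by (auto simp: pw_def)
        define w where "w = y * unif P powi (- n)"
        have wn: "w \<notin> loc D P" "w \<noteq> 0" using no nz unif_powi_nz by (simp_all add: w_def pw_def)
        then have "inverse w \<in> loc D P" using loc_valuation[OF PS, of w] by blast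
        then have "inverse w \<in> loc P P" by (rule nonunit_loc[OF PS]) (use wn in simp)
        from unif(3)[OF PY this] have "inverse w / unif P * y \<in> loc I P"
          by (rule loc_smult[OF PS dI _ y])
        moreover have "inverse w / unif P * y = unif P powi (n - 1)"
        proof -
          have "inverse w * y = unif P powi n" using nz by (simp add: w_def power_int_minus)
          then have "inverse w / unif P * y = unif P powi n / unif P" by (simp add: mult_ac)
          also have "unif P powi n = unif P powi (n - 1) * unif P" using unif_add[of "n - 1" 1] by simp
          finally show ?thesis using unif(2)[OF PY] by simp
        qed
        ultimately show False using least by simp
      qed
    qed
  qed
  then show ?thesis ..
qed

end

definition nu :: "'a set \<Rightarrow> 'a set \<Rightarrow> int" where
  "nu I P = (if P \<in> Y then THE n. loc I P = pw P n else 0)"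

lemma nu_eqI: "P \<in> Y \<Longrightarrow> loc I P = pw P n \<Longrightarrow> nu I P = n"
  unfolding nu_def using pw_inject by (auto intro!: the_equality)

lemma loc_nu: "P \<in> Y \<Longrightarrow> divY I \<Longrightarrow> loc I P = pw P (nu I P)"
  using loc_eq_pw[of P I] nu_eqI[of P I] by metis

lemma nu_outside: "P \<notin> Y \<Longrightarrow> nu I P = 0"
  by (simp add: nu_def)

lemma nu_antimono:
  assumes "P \<in> Y" "divY I" "divY J" "I \<subseteq> J"
  shows "nu J P \<le> nu I P"
  using loc_mono[OF assms(4), of P] pw_subset_iff[OF assms(1)] loc_nu[OF assms(1)] assms(2,3) by simp

lemma nu_le_iff: "P \<in> Y \<Longrightarrow> divY I \<Longrightarrow> nu I P \<le> n \<longleftrightarrow> unif P powi n \<in> loc I P"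
  using unif_powi_pw_iff[of P n] loc_nu[of P I] by simp

lemma nu_D: "nu D P = 0"
  using nu_eqI[of P D 0] pw_0[of P] nu_outside by (cases "P \<in> Y") simp_all

text \<open>
Equality may fail: \<open>I (D:I)\<close> is contained in \<open>D\<close>, but it may be a proper ideal whose \<open>v\<close>-closure is \<open>D\<close>.
\<close>

lemma nu_colon_nonneg:
  assumes "divY I"
  shows "0 \<le> nu I P + nu (colon D I) P"
proof (cases "P \<in> Y")
  case True
  have "loc (mprod I (colon D I)) P = pw P (nu I P + nu (colon D I) P)"
    by (rule loc_mprod_pw[OF True divYD(1)[OF assms] dmod_colon loc_nu[OF True assms]
          loc_nu[OF True divY_colon[OF assms]]])
  then have "pw P (nu I P + nu (colon D I) P) \<subseteq> pw P 0"
    using loc_mono[OF mprod_colon_subset, of I P] pw_0[OF True] by simp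
  then show ?thesis using pw_subset_iff[OF True] by simp
qed (simp add: nu_outside)

lemma nu_colon_zero:
  assumes I: "divY I" and P: "P \<in> Y" and no: "\<not> mprod I (colon D I) \<subseteq> P"
  shows "nu (colon D I) P = - nu I P"
proof -
  have "loc (mprod I (colon D I)) P = pw P (nu I P + nu (colon D I) P)"
    by (rule loc_mprod_pw[OF P divYD(1)[OF I] dmod_colon loc_nu[OF P I] loc_nu[OF P divY_colon[OF I]]])
  moreover have "1 \<in> loc (mprod I (colon D I)) P"
    using loc_one_iff[OF Y_Spec[OF P] dmod_mprod[OF divYD(1)[OF I] dmod_colon] mprod_colon_subset] no by blast
  ultimately have "unif P powi 0 \<in> pw P (nu I P + nu (colon D I) P)" by simp
  then have "nu I P + nu (colon D I) P \<le> 0" using unif_powi_pw_iff[OF P] by blast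
  then show ?thesis using nu_colon_nonneg[OF I, of P] by simp
qed

section \<open>Small sets of maximal ideals\<close>

definition proper :: "'a set \<Rightarrow> bool" where
  "proper L \<longleftrightarrow> invY L \<and> L \<subseteq> D \<and> L \<noteq> D"

text \<open>
The set \<open>A\<close> is nowhere dense in the topology on \<open>Y\<close> with basis the zero sets of invertible integral ideals
supported in \<open>Y\<close>: every nonempty basic set contains a nonempty basic set that misses \<open>A\<close>.  By \<open>proper_point\<close>, a basic
set is nonempty exactly when its ideal is not \<open>D\<close>.
\<close>

definition small :: "'a set set \<Rightarrow> bool" where
  "small A \<longleftrightarrow> (\<forall>L. proper L \<longrightarrow> (\<exists>L'. proper L' \<and> (\<forall>P\<in>Y. L' \<subseteq> P \<longrightarrow> L \<subseteq> P \<and> P \<notin> A)))"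

lemma small_empty: "small {}"
  unfolding small_def by blast

lemma small_subset: "small A \<Longrightarrow> B \<subseteq> A \<Longrightarrow> small B"
  unfolding small_def by (meson subsetD)

lemma small_Un:
  assumes "small A" "small B"
  shows "small (A \<union> B)"
  unfolding small_def
proof (intro allI impI)
  fix L assume "proper L"
  then obtain L1 where L1: "proper L1" "\<forall>P\<in>Y. L1 \<subseteq> P \<longrightarrow> L \<subseteq> P \<and> P \<notin> A"
    using assms(1) unfolding small_def by blast
  obtain L2 where L2: "proper L2" "\<forall>P\<in>Y. L2 \<subseteq> P \<longrightarrow> L1 \<subseteq> P \<and> P \<notin> B"
    using assms(2) L1(1) unfolding small_def by blast
  show "\<exists>L'. proper L' \<and> (\<forall>P\<in>Y. L' \<subseteq> P \<longrightarrow> L \<subseteq> P \<and> P \<notin> A \<union> B)"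
    by (rule exI[of _ L2]) (use L1(2) L2 in simp)
qed

lemma proper_point:
  assumes "proper L"
  shows "\<exists>P\<in>Y. L \<subseteq> P"
proof (rule ccontr)
  assume no: "\<not> (\<exists>P\<in>Y. L \<subseteq> P)"
  have L: "invY L" "L \<subseteq> D" "L \<noteq> D" using assms by (simp_all add: proper_def)
  have dL: "dmod L" using L(1) inv_mod_dmod by (simp add: invY_def)
  have "1 \<in> L"
  proof (rule local_global[OF dL])
    fix P assume P: "P \<in> Spec D"
    have "\<not> L \<subseteq> P" using no invY_not_subset[OF L(1,2), of P] P by blast
    then show "1 \<in> loc L P" using loc_one_iff[OF P dL L(2)] by simp
  qed
  then show False using dmod_one_subset[OF dL] L(2,3) by blast
qed

lemma divY_integral_nonneg:
  assumes "divY I" "I \<subseteq> D" "P \<in> Y"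
  shows "0 \<le> nu I P"
  using nu_antimono[OF assms(3,1) divY_D assms(2)] nu_D by simp

text \<open>
A prime that contains \<open>I\<close> and no member of \<open>\<J>\<close> would lie in \<open>Y\<close>, contrary to \<open>cover\<close>.
\<close>

lemma exists_in_family_below:
  assumes J: "\<And>J. J \<in> \<J> \<Longrightarrow> invY J \<and> J \<subseteq> D"
    and directed: "\<And>J K. J \<in> \<J> \<Longrightarrow> K \<in> \<J> \<Longrightarrow> \<exists>L\<in>\<J>. L \<subseteq> mprod J K"
    and D: "D \<in> \<J>"
    and cover: "\<And>P. P \<in> Y \<Longrightarrow> \<exists>J\<in>\<J>. J \<subseteq> P"
    and I: "dmod I" "I \<subseteq> D" "\<And>P. P \<in> Spec D - Y \<Longrightarrow> \<not> I \<subseteq> P"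
  shows "\<exists>J\<in>\<J>. J \<subseteq> I"
proof (rule ccontr)
  assume no: "\<not> (\<exists>J\<in>\<J>. J \<subseteq> I)"
  have fin: "\<exists>F. finite F \<and> F \<subseteq> K \<and> (\<forall>L. dmod L \<longrightarrow> F \<subseteq> L \<longrightarrow> K \<subseteq> L)" if "K \<in> \<J>" for K
    by (rule inv_mod_finitely_generated) (use J[OF that] in \<open>simp add: invY_def\<close>)
  have no': "\<not> K \<subseteq> I" if "K \<in> \<J>" for K using no that by blast
  obtain P where P: "P \<in> Spec D" "I \<subseteq> P" "\<forall>K\<in>\<J>. \<not> K \<subseteq> P"
    by (rule exists_prime_avoiding[OF fin directed D subset_refl I(1,2) no']) blast+
  have "P \<in> Y" using I(3)[of P] P(1,2) by blast
  then show False using cover P(3) by blast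
qed

lemma divY_Int_D:
  assumes I: "divY I"
  shows "dmod (I \<inter> D)" "I \<inter> D \<subseteq> D" "\<And>P. P \<in> Spec D - Y \<Longrightarrow> \<not> I \<inter> D \<subseteq> P"
proof -
  note dI = divYD(1)[OF I]
  show dID: "dmod (I \<inter> D)" by (rule dmod_Int[OF dI dmod_D])
  show ID: "I \<inter> D \<subseteq> D" by (rule Int_lower2)
  fix P assume P: "P \<in> Spec D - Y"
  then have PS: "P \<in> Spec D" by blast
  have "1 \<in> loc I P \<inter> loc D P" using divYD(4)[OF I P] loc_D_closed(3)[OF PS] by (rule IntI)
  then show "\<not> I \<inter> D \<subseteq> P" using loc_Int[OF PS dI dmod_D] loc_one_iff[OF PS dID ID] by simp
qed

end

locale prufer_bdd = prufer_disc +
  assumes bounded_cover: "P \<in> Y \<Longrightarrow>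
    \<exists>J n. invY J \<and> J \<subseteq> D \<and> J \<subseteq> P \<and> (\<forall>M\<in>Y. unif M ^ n \<in> loc J M)"
begin

text \<open>
The invertible ideals with bounded values form a multiplicative family, so one of them lies inside \<open>I\<close>.
\<close>

lemma contains_unif_power:
  assumes I: "dmod I" "I \<subseteq> D" "\<And>P. P \<in> Spec D - Y \<Longrightarrow> \<not> I \<subseteq> P"
  shows "\<exists>n. \<forall>M\<in>Y. unif M ^ n \<in> loc I M"
proof -
  define \<J> where "\<J> = {J. invY J \<and> J \<subseteq> D \<and> (\<exists>n. \<forall>M\<in>Y. unif M ^ n \<in> loc J M)}"
  have "\<exists>J\<in>\<J>. J \<subseteq> I"
  proof (rule exists_in_family_below[OF _ _ _ _ I])
    show "invY J \<and> J \<subseteq> D" if "J \<in> \<J>" for J using that by (simp add: \<J>_def)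
    show "\<exists>J\<in>\<J>. J \<subseteq> P" if "P \<in> Y" for P using bounded_cover[OF that] unfolding \<J>_def by blast
    have "unif M ^ 0 \<in> loc D M" if "M \<in> Y" for M using loc_D_closed(3)[OF Y_Spec[OF that]] by simp
    moreover have "invY D" using inv_mod_D loc_D_closed(3) by (simp add: invY_def colon_D)
    ultimately show "D \<in> \<J>" unfolding \<J>_def by blast
    fix J K assume J: "J \<in> \<J>" and K: "K \<in> \<J>"
    obtain m n where mn: "\<forall>M\<in>Y. unif M ^ m \<in> loc J M" "\<forall>M\<in>Y. unif M ^ n \<in> loc K M"
      using J K unfolding \<J>_def by blast
    have "unif M ^ (m + n) \<in> loc (mprod J K) M" if "M \<in> Y" for M
      using loc_mult[OF Y_Spec[OF that]] mn that by (simp add: power_add)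
    moreover have "mprod J K \<subseteq> D"
      using J K by (intro mprod_subset_D D_closed(4)) (auto simp: \<J>_def)
    moreover have "invY (mprod J K)" using J K by (intro invY_mprod) (simp_all add: \<J>_def)
    ultimately have "mprod J K \<in> \<J>" unfolding \<J>_def by blast
    then show "\<exists>L\<in>\<J>. L \<subseteq> mprod J K" by blast
  qed
  then obtain J n where "J \<subseteq> I" "\<forall>M\<in>Y. unif M ^ n \<in> loc J M" unfolding \<J>_def by blast
  then show ?thesis using loc_mono[of J I] by blast
qed

lemma nu_bounded_above:
  assumes I: "divY I"
  shows "\<exists>n::nat. \<forall>P\<in>Y. nu I P \<le> int n"
proof -
  obtain n where n: "\<forall>M\<in>Y. unif M ^ n \<in> loc (I \<inter> D) M"
    using contains_unif_power[OF divY_Int_D[OF I]] by blast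
  have "nu I P \<le> int n" if P: "P \<in> Y" for P
  proof -
    have "unif P powi int n \<in> loc I P" using n P loc_mono[of "I \<inter> D" I P] by auto
    then show ?thesis using nu_le_iff[OF P I] by simp
  qed
  then show ?thesis by blast
qed

lemma finite_range_nu:
  assumes I: "divY I"
  shows "finite (range (nu I))"
proof -
  obtain m n :: nat where m: "\<forall>P\<in>Y. nu I P \<le> int m" and n: "\<forall>P\<in>Y. nu (colon D I) P \<le> int n"
    using nu_bounded_above[OF I] nu_bounded_above[OF divY_colon[OF I]] by blast
  have "nu I P \<in> {- int n..int m}" for P
  proof (cases "P \<in> Y")
    case True
    then show ?thesis using m n nu_colon_nonneg[OF I, of P] by fastforce
  qed (simp add: nu_outside)
  then show ?thesis by (meson finite_atLeastAtMost_int finite_subset image_subsetI)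
qed

text \<open>
At each zero of \<open>L\<close> the factors are divisible by the uniformizer, so their product is divisible by its \<open>n\<close>-th power,
which lies in \<open>L\<close> locally.  At the other primes \<open>L\<close> is trivial.
\<close>

lemma vanishing_product_mem:
  assumes L: "proper L" and T: "\<And>t. t \<in> T \<Longrightarrow> t \<in> D" and TP: "\<And>P. P \<in> Y \<Longrightarrow> L \<subseteq> P \<Longrightarrow> T \<subseteq> P"
    and n: "\<forall>M\<in>Y. unif M ^ n \<in> loc L M"
    and ts: "set ts \<subseteq> T" "length ts = n"
  shows "prod_list ts \<in> L"
proof (rule local_global)
  have inv: "invY L" "L \<subseteq> D" using L by (simp_all add: proper_def)
  show dL: "dmod L" using inv(1) inv_mod_dmod by (simp add: invY_def)
  fix P assume P: "P \<in> Spec D"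
  have tsD: "prod_list us \<in> D" if "set us \<subseteq> T" for us
    using that T by (induction us) auto
  show "prod_list ts \<in> loc L P"
  proof (cases "L \<subseteq> P")
    case False
    then have "1 \<in> loc L P" using loc_one_iff[OF P dL inv(2)] by simp
    then show ?thesis
      using loc_smult[OF P dL, of "prod_list ts" 1] tsD[OF ts(1)] subset_loc[OF P, of D] by auto
  next
    case True
    then have PY: "P \<in> Y" using invY_not_subset[OF inv, of P] P by blast
    have "\<exists>v\<in>loc D P. prod_list us = v * unif P ^ length us" if "set us \<subseteq> T" for us
      using that
    proof (induction us)
      case Nil
      then show ?case using loc_D_closed(3)[OF P] by simp
    next
      case (Cons u us)
      then obtain v where v: "v \<in> loc D P" "prod_list us = v * unif P ^ length us" by auto
      have "u \<in> P" using Cons.prems TP[OF PY True] by auto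
      then have "u / unif P \<in> loc D P" using unif(3)[OF PY] subset_loc[OF P, of P] by blast
      from loc_D_closed(1)[OF P this v(1)] show ?case
        using unif(2)[OF PY] v(2) by (intro bexI[of _ "u / unif P * v"]) simp_all
    qed
    from this[OF ts(1)] obtain v where "v \<in> loc D P" "prod_list ts = v * unif P ^ n" using ts(2) by blast
    then show ?thesis using loc_smult[OF P dL] n PY by simp
  qed
qed

text \<open>
Let \<open>T = I (D:I)\<close>, so that \<open>(D:T) = D\<close>.  If \<open>T\<close> vanished at all zeros of \<open>L\<close>, a power \<open>T\<^sup>n\<close> would lie in \<open>L\<close>; then
every \<open>x \<in> (D:L)\<close> satisfies \<open>x T\<^sup>n \<subseteq> D\<close>, and cancelling the factors one at a time gives \<open>x \<in> D\<close>, hence \<open>L = D\<close>.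
So some \<open>t \<in> T\<close> is a unit at a zero of \<open>L\<close>, and \<open>L\<^sub>1 = {y \<in> D. t\<^sup>n y \<in> L}\<close> removes from the zeros of \<open>L\<close> exactly those of \<open>t\<close>:
where \<open>t\<close> vanishes, \<open>t\<^sup>n\<close> already lies in \<open>L\<close> locally.
\<close>

lemma noninvertible_locus_small:
  assumes I: "divY I"
  shows "small {P\<in>Y. mprod I (colon D I) \<subseteq> P}"
  unfolding small_def
proof (intro allI impI)
  fix L assume L: "proper L"
  then have inv: "invY L" "L \<subseteq> D" "L \<noteq> D" by (simp_all add: proper_def)
  have inv_L: "inv_mod L" and dL: "dmod L" using inv(1) inv_mod_dmod by (simp_all add: invY_def)
  define T where "T = mprod I (colon D I)"
  have TD: "T \<subseteq> D" unfolding T_def by (rule mprod_colon_subset)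
  have colT: "colon D T = D" unfolding T_def by (rule divYD(7)[OF I])
  obtain n where n: "\<forall>M\<in>Y. unif M ^ n \<in> loc L M"
    using contains_unif_power[OF dL inv(2) invY_not_subset[OF inv(1,2)]] by blast
  have "\<exists>P\<in>Y. L \<subseteq> P \<and> \<not> T \<subseteq> P"
  proof (rule ccontr)
    assume "\<not> ?thesis"
    then have TP: "\<And>P. P \<in> Y \<Longrightarrow> L \<subseteq> P \<Longrightarrow> T \<subseteq> P" by blast
    have cancel: "x \<in> D" if "\<And>ts. set ts \<subseteq> T \<Longrightarrow> length ts = k \<Longrightarrow> x * prod_list ts \<in> D" for k x
      using that
    proof (induction k arbitrary: x)
      case 0
      from 0[of "[]"] show ?case by simp
    next
      case (Suc k)
      have "x * t \<in> D" if t: "t \<in> T" for t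
      proof (rule Suc.IH)
        fix ts assume "set ts \<subseteq> T" "length ts = k"
        with Suc.prems[of "t # ts"] t show "x * t * prod_list ts \<in> D" by (simp add: mult.assoc)
      qed
      then have "x \<in> colon D T" by (simp add: colon_def)
      then show ?case using colT by simp
    qed
    have "colon D L \<subseteq> D"
    proof
      fix x assume x: "x \<in> colon D L"
      show "x \<in> D"
      proof (rule cancel[of n])
        fix ts assume ts: "set ts \<subseteq> T" "length ts = n"
        have "prod_list ts \<in> L" by (rule vanishing_product_mem[OF L _ TP n ts]) (use TD in blast)
        then show "x * prod_list ts \<in> D" using x by (simp add: colon_def)
      qed
    qed
    then have "colon D D \<subseteq> colon D (colon D L)" by (rule colon_antimono)
    then have "D \<subseteq> L" using colon_D inv_mod_divisorial[OF inv_L] by (simp add: v_closure_def)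
    then show False using inv by blast
  qed
  then obtain P0 t where P0: "P0 \<in> Y" "L \<subseteq> P0" and t: "t \<in> T" "t \<notin> P0" by blast
  have tD: "t \<in> D" using t TD by blast
  have t0: "t \<noteq> 0" using t(2) dmod_0[OF Spec_dmod[OF Y_Spec[OF P0(1)]]] by blast
  define L1 where "L1 = D \<inter> (*) (inverse (t ^ n)) ` L"
  have L1_iff: "y \<in> L1 \<longleftrightarrow> y \<in> D \<and> t ^ n * y \<in> L" for y
  proof -
    have "y \<in> (*) (inverse (t ^ n)) ` L \<longleftrightarrow> t ^ n * y \<in> L"
    proof
      assume "t ^ n * y \<in> L"
      moreover have "y = inverse (t ^ n) * (t ^ n * y)" using t0 by (simp add: mult.assoc[symmetric])
      ultimately show "y \<in> (*) (inverse (t ^ n)) ` L" by (rule rev_image_eqI)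
    next
      assume "y \<in> (*) (inverse (t ^ n)) ` L"
      then obtain z where z: "y = inverse (t ^ n) * z" "z \<in> L" by blast
      then have "t ^ n * y = z" using t0 by (simp add: mult.assoc[symmetric])
      then show "t ^ n * y \<in> L" using z(2) by simp
    qed
    then show ?thesis by (simp add: L1_def)
  qed
  have inv_L1: "inv_mod L1" unfolding L1_def
    by (rule inv_mod_isum_Int(2)[OF inv_mod_D inv_mod_scale[OF inv_L]]) (use t0 in simp)
  have LL1: "L \<subseteq> L1"
    using inv(2) dmod_mult[OF dL D_power[OF tD]] by (auto simp: L1_iff)
  have L1D: "L1 \<subseteq> D" by (auto simp: L1_def)
  have "invY L1"
    by (rule invY_integralI[OF inv_L1 L1D]) (use LL1 invY_not_subset[OF inv(1,2)] in blast)
  moreover have "L1 \<noteq> D"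
  proof
    assume "L1 = D"
    then have "t ^ n \<in> P0" using L1_iff[of 1] P0(2) by auto
    then show False using Spec_power[OF Y_Spec[OF P0(1)] tD] t(2) by blast
  qed
  ultimately have "proper L1" using L1D by (simp add: proper_def)
  moreover have "L \<subseteq> P \<and> P \<notin> {P\<in>Y. T \<subseteq> P}" if P: "P \<in> Y" "L1 \<subseteq> P" for P
  proof -
    note PS = Y_Spec[OF P(1)]
    have "t \<notin> P"
    proof
      assume tP: "t \<in> P"
      then have "t / unif P \<in> loc D P" using unif(3)[OF P(1)] subset_loc[OF PS, of P] by blast
      then have "(t / unif P) ^ n \<in> loc D P"
      proof (induction n)
        case (Suc n)
        then show ?case using loc_D_closed(1)[OF PS, of "t / unif P" "(t / unif P) ^ n"] by (simp only: power_Suc)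
      qed (simp add: loc_D_closed(3)[OF PS])
      then have "(t / unif P) ^ n * unif P ^ n \<in> loc L P" using loc_smult[OF PS dL] n P(1) by blast
      then have "t ^ n \<in> loc L P" using unif(2)[OF P(1)] by (simp add: power_divide)
      then obtain s where s: "s \<in> D" "s \<notin> P" "s * t ^ n \<in> L" by (rule locE)
      then have "s \<in> L1" using L1_iff by (simp add: mult.commute)
      then show False using P(2) s(2) by blast
    qed
    then show ?thesis using P(2) LL1 t(1) by blast
  qed
  ultimately show "\<exists>L'. proper L' \<and> (\<forall>P\<in>Y. L' \<subseteq> P \<longrightarrow> L \<subseteq> P \<and> P \<notin> {P \<in> Y. mprod I (colon D I) \<subseteq> P})"
    unfolding T_def by blast
qed

text \<open>
The inclusions \<open>I J \<subseteq> (I J)\<^sup>v\<close> and \<open>(I J)\<^sup>v (D:I)(D:J) \<subseteq> D\<close> bound the value of the product from above and from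
below, and the two bounds agree wherever \<open>I (D:I)\<close> and \<open>J (D:J)\<close> are locally trivial.
\<close>

lemma nu_mult_small:
  assumes I: "divY I" and J: "divY J"
  shows "small {P\<in>Y. nu (v_closure D (mprod I J)) P \<noteq> nu I P + nu J P}"
proof (rule small_subset[OF small_Un[OF noninvertible_locus_small[OF I] noninvertible_locus_small[OF J]]], rule subsetI, rule ccontr)
  let ?L = "v_closure D (mprod I J)"
  note L = divY_mult[OF I J]
  fix P assume P: "P \<in> {P\<in>Y. nu ?L P \<noteq> nu I P + nu J P}"
    and no: "P \<notin> {P\<in>Y. mprod I (colon D I) \<subseteq> P} \<union> {P\<in>Y. mprod J (colon D J) \<subseteq> P}"
  then have PY: "P \<in> Y" by blast
  have inv: "nu (colon D I) P = - nu I P" "nu (colon D J) P = - nu J P"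
    using nu_colon_zero[OF I PY] nu_colon_zero[OF J PY] no PY by blast+
  note dI = divYD(1)[OF I] and dJ = divYD(1)[OF J]
  have "loc (mprod I J) P = pw P (nu I P + nu J P)"
    by (rule loc_mprod_pw[OF PY dI dJ loc_nu[OF PY I] loc_nu[OF PY J]])
  then have "pw P (nu I P + nu J P) \<subseteq> pw P (nu ?L P)"
    using loc_mono[OF subset_v_closure, of "mprod I J" P D] loc_nu[OF PY L] by simp
  then have le: "nu ?L P \<le> nu I P + nu J P" using pw_subset_iff[OF PY] by simp
  have "loc (mprod (colon D I) (colon D J)) P = pw P (- nu I P + - nu J P)"
    using loc_mprod_pw[OF PY dmod_colon dmod_colon loc_nu[OF PY divY_colon[OF I]] loc_nu[OF PY divY_colon[OF J]]]
      inv by simp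
  then have "loc (mprod ?L (mprod (colon D I) (colon D J))) P = pw P (nu ?L P + (- nu I P + - nu J P))"
    by (rule loc_mprod_pw[OF PY dmod_v_closure dmod_mprod[OF dmod_colon dmod_colon] loc_nu[OF PY L]])
  moreover have "mprod ?L (mprod (colon D I) (colon D J)) \<subseteq> D"
    using mprod_mono[OF subset_refl mprod_colon_subset_colon_mprod[OF dI dJ], of ?L]
      mprod_colon_subset[of ?L] by (simp add: colon_v_closure)
  ultimately have "pw P (nu ?L P + (- nu I P + - nu J P)) \<subseteq> pw P 0"
    using loc_mono[of "mprod ?L (mprod (colon D I) (colon D J))" D P] pw_0[OF PY] by simp
  then have "0 \<le> nu ?L P + (- nu I P + - nu J P)" using pw_subset_iff[OF PY] by simp
  then show False using le P by simp
qed

text \<open>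
If \<open>x \<in> I\<close> is not in \<open>D\<close>, then \<open>L = {d \<in> D. d x \<in> D}\<close> is a proper invertible ideal, and it vanishes only where
\<open>x\<close> is not in \<open>D\<^sub>P\<close>, in particular only where \<open>I\<close> has a nonzero value.  So the support of \<open>nu I\<close> contains the nonempty
zero set of \<open>L\<close> and is not small.
\<close>

lemma small_support_integral:
  assumes I: "divY I" and small: "small {P\<in>Y. nu I P \<noteq> 0}"
  shows "I \<subseteq> D"
proof (rule ccontr)
  assume "\<not> I \<subseteq> D"
  then obtain x where x: "x \<in> I" "x \<notin> D" by blast
  have x0: "x \<noteq> 0" using x by auto
  define L where "L = D \<inter> (*) (inverse x) ` D"
  have L_iff: "y \<in> L \<longleftrightarrow> y \<in> D \<and> y * x \<in> D" for y
  proof -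
    have "y \<in> (*) (inverse x) ` D \<longleftrightarrow> y * x \<in> D"
    proof
      assume "y * x \<in> D"
      moreover have "y = inverse x * (y * x)" using x0 by (simp add: mult_ac)
      ultimately show "y \<in> (*) (inverse x) ` D" by (rule rev_image_eqI)
    next
      assume "y \<in> (*) (inverse x) ` D"
      then obtain z where z: "y = inverse x * z" "z \<in> D" by blast
      then have "y * x = z" using x0 by (simp add: mult_ac)
      then show "y * x \<in> D" using z(2) by simp
    qed
    then show ?thesis by (simp add: L_def)
  qed
  have inv_L: "inv_mod L" unfolding L_def by (rule inv_mod_isum_Int(2)[OF inv_mod_D inv_mod_scale[OF inv_mod_D]]) (use x0 in simp)
  have avoid: "\<not> L \<subseteq> P" if P: "P \<in> Spec D" "loc I P \<subseteq> loc D P" for P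
  proof -
    have "x \<in> loc D P" using x(1) P subset_loc[OF P(1), of I] by blast
    then obtain s where "s \<in> D" "s \<notin> P" "s * x \<in> D" by (rule locE)
    then show ?thesis using L_iff by blast
  qed
  have "invY L"
  proof (rule invY_integralI[OF inv_L])
    fix P assume P: "P \<in> Spec D - Y"
    then have "P \<in> Spec D" by blast
    moreover from this have "loc I P \<subseteq> loc D P"
      by (rule loc_subset_of_colon_unit[OF _ divYD(1)[OF I] divYD(5)[OF I P]])
    ultimately show "\<not> L \<subseteq> P" by (rule avoid)
  qed (simp add: L_def)
  moreover have "L \<noteq> D" using L_iff[of 1] x(2) by auto
  ultimately have "proper L" by (simp add: proper_def L_def)
  then obtain L' where L': "proper L'" "\<forall>P\<in>Y. L' \<subseteq> P \<longrightarrow> L \<subseteq> P \<and> P \<notin> {P\<in>Y. nu I P \<noteq> 0}"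
    using small unfolding small_def by blast
  obtain P where P: "P \<in> Y" "L' \<subseteq> P" using proper_point[OF L'(1)] by blast
  then have "L \<subseteq> P" "nu I P = 0" using L'(2) by blast+
  moreover have "loc I P = loc D P" using loc_nu[OF P(1) I] pw_0[OF P(1)] \<open>nu I P = 0\<close> by simp
  ultimately show False using avoid[OF Y_Spec[OF P(1)]] by simp
qed

lemma small_support_trivial:
  assumes I: "divY I" and small: "small {P\<in>Y. nu I P \<noteq> 0}"
  shows "I = D"
proof
  show "I \<subseteq> D" by (rule small_support_integral[OF assms])
  have "{P\<in>Y. nu (colon D I) P \<noteq> 0} \<subseteq> {P\<in>Y. nu I P \<noteq> 0} \<union> {P\<in>Y. mprod I (colon D I) \<subseteq> P}"
  proof (rule subsetI, rule ccontr)
    fix P assume P: "P \<in> {P\<in>Y. nu (colon D I) P \<noteq> 0}"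
      and no: "P \<notin> {P\<in>Y. nu I P \<noteq> 0} \<union> {P\<in>Y. mprod I (colon D I) \<subseteq> P}"
    then show False using nu_colon_zero[OF I, of P] by simp
  qed
  then have "small {P\<in>Y. nu (colon D I) P \<noteq> 0}"
    by (rule small_subset[OF small_Un[OF small noninvertible_locus_small[OF I]]])
  then have "colon D I \<subseteq> D" by (rule small_support_integral[OF divY_colon[OF I]])
  then have "colon D D \<subseteq> colon D (colon D I)" by (rule colon_antimono)
  then show "D \<subseteq> I" using colon_D divYD(6)[OF I] by simp
qed

end

section \<open>Freeness of the two groups\<close>

text \<open>
A map that is additive modulo \<open>M\<close> and whose kernel modulo \<open>M\<close> is \<open>H\<close> induces an embedding of \<open>G Mod H\<close> modulo \<open>M\<close>:
another choice of representatives of the cosets changes its values by members of \<open>M\<close> only.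
\<close>

lemma quotient_representatives:
  fixes \<phi> :: "'g \<Rightarrow> 'b::ab_group_add" and G (structure)
  assumes G: "comm_group G" and H: "subgroup H G" and M: "diff_closed M"
    and hom': "\<forall>x\<in>carrier G. \<forall>y\<in>carrier G. \<phi> (x \<otimes> y) - (\<phi> x + \<phi> y) \<in> M"
    and HM': "\<forall>h\<in>H. \<phi> h \<in> M"
    and ker': "\<forall>x\<in>carrier G. \<phi> x \<in> M \<longrightarrow> x \<in> H"
  defines "\<psi> \<equiv> \<lambda>c. \<phi> (SOME x. x \<in> c)"
  shows "comm_group (G Mod H)"
    and "\<And>a. a \<in> carrier (G Mod H) \<Longrightarrow> \<exists>x\<in>carrier G. \<psi> a = \<phi> x"
    and "\<And>a b. a \<in> carrier (G Mod H) \<Longrightarrow> b \<in> carrier (G Mod H) \<Longrightarrow>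
      \<psi> (a \<otimes>\<^bsub>G Mod H\<^esub> b) - (\<psi> a + \<psi> b) \<in> M"
    and "\<And>a. a \<in> carrier (G Mod H) \<Longrightarrow> \<psi> a \<in> M \<Longrightarrow> a = \<one>\<^bsub>G Mod H\<^esub>"
proof -
  interpret G: comm_group G by (rule G)
  interpret H: normal H G using H G.normal_iff_subgroup by blast
  note hom = hom'[rule_format] and HM = HM'[rule_format] and ker = ker'[rule_format]
  show "comm_group (G Mod H)" by (rule G.abelian_FactGroup[OF H])
  define rep where "rep c = (SOME x. x \<in> c)" for c :: "'g set"
  have \<psi>: "\<psi> c = \<phi> (rep c)" for c by (simp add: \<psi>_def rep_def)
  have rep: "rep c \<in> carrier G" "H #> rep c = c" if "c \<in> carrier (G Mod H)" for c
  proof -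
    obtain x where x: "x \<in> carrier G" "c = H #> x"
      using \<open>c \<in> carrier (G Mod H)\<close> by (auto simp: FactGroup_def RCOSETS_def)
    have "x \<in> c" using x G.rcos_self[OF x(1) H] by simp
    then have c: "rep c \<in> H #> x" unfolding x(2)[symmetric] rep_def by (rule someI)
    show "rep c \<in> carrier G" using c G.r_coset_subset_G[OF H.subset x(1)] by blast
    show "H #> rep c = c" using G.repr_independence[OF c x(1) H] x(2) by simp
  qed
  show "\<exists>x\<in>carrier G. \<psi> a = \<phi> x" if "a \<in> carrier (G Mod H)" for a
    using rep(1)[OF that] \<psi> by blast
  show "a = \<one>\<^bsub>G Mod H\<^esub>" if a: "a \<in> carrier (G Mod H)" "\<psi> a \<in> M" for a
  proof -
    have "rep a \<in> H" using ker[OF rep(1)[OF a(1)]] a(2) \<psi> by simp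
    then have "H #> rep a = H" by (rule H.rcos_const[OF G.is_group])
    then show ?thesis using rep(2)[OF a(1)] by (simp add: FactGroup_def)
  qed
  fix a b assume a: "a \<in> carrier (G Mod H)" and b: "b \<in> carrier (G Mod H)"
  note ra = rep(1)[OF a] and rb = rep(1)[OF b]
  have ab: "a \<otimes>\<^bsub>G Mod H\<^esub> b = H #> (rep a \<otimes> rep b)"
    using H.rcos_sum[OF ra rb] rep(2)[OF a] rep(2)[OF b] by (simp add: FactGroup_def)
  have rab: "rep a \<otimes> rep b \<in> carrier G" using ra rb by simp
  have "rep (H #> (rep a \<otimes> rep b)) \<in> H #> (rep a \<otimes> rep b)"
    unfolding rep_def[of "H #> _"] by (rule someI) (rule G.rcos_self[OF rab H])
  then obtain h where h: "h \<in> H" "rep (H #> (rep a \<otimes> rep b)) = h \<otimes> (rep a \<otimes> rep b)"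
    by (auto simp: r_coset_def)
  have hG: "h \<in> carrier G" using h(1) H.subset by blast
  have 1: "\<phi> (h \<otimes> (rep a \<otimes> rep b)) - (\<phi> h + \<phi> (rep a \<otimes> rep b)) \<in> M" by (rule hom[OF hG rab])
  have 2: "\<phi> (rep a \<otimes> rep b) - (\<phi> (rep a) + \<phi> (rep b)) \<in> M" by (rule hom[OF ra rb])
  from diff_closed_add[OF M diff_closed_add[OF M 1 2] HM[OF h(1)]]
  have "\<phi> (h \<otimes> (rep a \<otimes> rep b)) - (\<phi> (rep a) + \<phi> (rep b)) \<in> M" by (simp add: algebra_simps)
  then show "\<psi> (a \<otimes>\<^bsub>G Mod H\<^esub> b) - (\<psi> a + \<psi> b) \<in> M"
    unfolding \<psi> ab h(2) .
qed

context prufer_bdd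
begin

definition negligible :: "'a set set set" where
  "negligible = {S. S \<subseteq> Y \<and> small S}"

lemma negligible:
  "{} \<in> negligible" "S \<in> negligible \<Longrightarrow> T \<subseteq> S \<Longrightarrow> T \<in> negligible"
  "S \<in> negligible \<Longrightarrow> T \<in> negligible \<Longrightarrow> S \<union> T \<in> negligible"
  using small_empty small_subset small_Un unfolding negligible_def by blast+

definition nulls :: "('a set \<Rightarrow> int) set" where
  "nulls = {f. {P. f P \<noteq> 0} \<in> negligible}"

lemma diff_closed_nulls: "diff_closed nulls"
proof -
  have "f - g \<in> nulls" if "f \<in> nulls" "g \<in> nulls" for f g
  proof -
    have "{P. (f - g) P \<noteq> 0} \<subseteq> {P. f P \<noteq> 0} \<union> {P. g P \<noteq> 0}" by auto
    then show ?thesis using negligible(2)[OF negligible(3)] that unfolding nulls_def by blast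
  qed
  moreover have "0 \<in> nulls" using negligible(1) by (simp add: nulls_def)
  ultimately show ?thesis unfolding diff_closed_def by blast
qed

lemma nu_hom:
  assumes "divY I" "divY J"
  shows "nu (v_closure D (mprod I J)) - (nu I + nu J) \<in> nulls"
proof -
  have "{P. (nu (v_closure D (mprod I J)) - (nu I + nu J)) P \<noteq> 0}
      = {P\<in>Y. nu (v_closure D (mprod I J)) P \<noteq> nu I P + nu J P}"
    using nu_outside by auto
  moreover have "small {P\<in>Y. nu (v_closure D (mprod I J)) P \<noteq> nu I P + nu J P}"
    by (rule nu_mult_small[OF assms])
  ultimately show ?thesis by (simp add: nulls_def negligible_def)
qed

lemma nu_kernel:
  assumes "divY I" "nu I \<in> nulls"
  shows "I = D"
proof (rule small_support_trivial[OF assms(1)])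
  have "{P\<in>Y. nu I P \<noteq> 0} \<subseteq> {P. nu I P \<noteq> 0}" by blast
  then show "small {P\<in>Y. nu I P \<noteq> 0}"
    using assms(2) small_subset unfolding nulls_def negligible_def by blast
qed

text \<open>
The empty set is not an ideal; it serves as the extra point \<open>p0\<close> of \<open>free_abelian_modulo_sets\<close>.
\<close>

lemma empty_notin_Y: "{} \<notin> Y"
  using dmod_0[OF Spec_dmod[OF Y_Spec]] by blast

theorem free_abelian_Div_on: "free_abelian (Div_on D Y)"
proof -
  have M: "zspan (ind ` {} \<union> {f. {P. f P \<noteq> 0} \<in> negligible}) = nulls"
    using zspan_of_diff_closed[OF diff_closed_nulls] by (simp add: nulls_def[symmetric])
  show ?thesis
  proof (rule free_abelian_modulo_sets[where \<phi> = nu and \<N> = negligible and \<C> = "{}" and ?p0.0 = "{}"];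
      (unfold M)?)
    show "comm_group (Div_on D Y)" by (rule comm_group_Div_on)
    show "{} \<in> negligible" by (rule negligible(1))
    show "T \<in> negligible" if "S \<in> negligible" "T \<subseteq> S" for S T using that by (rule negligible(2))
    show "S \<union> T \<in> negligible" if "S \<in> negligible" "T \<in> negligible" for S T using that by (rule negligible(3))
    show "{} \<notin> S" if "S \<in> negligible \<union> {}" for S
      using that empty_notin_Y unfolding negligible_def by blast
    show "finite (range (nu I))" if "I \<in> carrier (Div_on D Y)" for I
      using that finite_range_nu carrier_Div_on by simp
    show "nu (I \<otimes>\<^bsub>Div_on D Y\<^esub> J) - (nu I + nu J) \<in> nulls"
      if "I \<in> carrier (Div_on D Y)" "J \<in> carrier (Div_on D Y)" for I J
      using that nu_hom unfolding carrier_Div_on mult_Div_on by blast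
    show "I = \<one>\<^bsub>Div_on D Y\<^esub>" if "I \<in> carrier (Div_on D Y)" "nu I \<in> nulls" for I
      using that nu_kernel unfolding carrier_Div_on one_Div_on by blast
  qed simp
qed

end

locale prufer_rad = prufer_disc +
  assumes radical_cover: "P \<in> Y \<Longrightarrow>
    \<exists>J. invY J \<and> J \<subseteq> D \<and> J \<subseteq> P \<and> (\<forall>M\<in>Y. unif M \<in> loc J M)"

sublocale prufer_rad \<subseteq> prufer_bdd
proof
  fix P assume "P \<in> Y"
  then obtain J where "invY J" "J \<subseteq> D" "J \<subseteq> P" "\<forall>M\<in>Y. unif M \<in> loc J M" using radical_cover by blast
  then show "\<exists>J n. invY J \<and> J \<subseteq> D \<and> J \<subseteq> P \<and> (\<forall>M\<in>Y. unif M ^ n \<in> loc J M)"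
    by (intro exI[of _ J] exI[of _ 1]) simp
qed

context prufer_disc
begin

definition rad :: "'a set \<Rightarrow> bool" where
  "rad J \<longleftrightarrow> invY J \<and> J \<subseteq> D \<and> (\<forall>M\<in>Y. unif M \<in> loc J M)"

definition zeros :: "'a set \<Rightarrow> 'a set set" where
  "zeros J = {P\<in>Y. J \<subseteq> P}"

lemma invY_D: "invY D"
  using inv_mod_D loc_D_closed(3) by (simp add: invY_def colon_D)

lemma invYD:
  assumes "invY I"
  shows "inv_mod I" "dmod I" "divY I"
  using assms inv_mod_dmod invY_divY by (auto simp: invY_def)

lemma nu_eq_0_iff:
  assumes "invY I" "I \<subseteq> D" "P \<in> Y"
  shows "nu I P = 0 \<longleftrightarrow> \<not> I \<subseteq> P"
proof -
  have "nu I P = 0 \<longleftrightarrow> loc I P = loc D P"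
    using loc_nu[OF assms(3) invYD(3)[OF assms(1)]] pw_0[OF assms(3)] pw_inject[OF assms(3), of "nu I P" 0]
    by auto
  then show ?thesis using loc_eq_D_iff[OF Y_Spec[OF assms(3)] invYD(2)[OF assms(1)] assms(2)] by simp
qed

lemma nu_rad:
  assumes "rad J"
  shows "nu J = ind (zeros J)"
proof
  fix P
  have J: "invY J" "J \<subseteq> D" using assms by (simp_all add: rad_def)
  show "nu J P = ind (zeros J) P"
  proof (cases "P \<in> Y")
    case True
    have "unif P powi 1 \<in> loc J P" using assms True by (simp add: rad_def)
    then have "nu J P \<le> 1" using nu_le_iff[OF True invYD(3)[OF J(1)]] by blast
    moreover have "0 \<le> nu J P" by (rule divY_integral_nonneg[OF invYD(3)[OF J(1)] J(2) True])
    moreover have "nu J P = 0 \<longleftrightarrow> \<not> J \<subseteq> P" by (rule nu_eq_0_iff[OF J True])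
    ultimately show ?thesis using True by (auto simp: ind_def zeros_def)
  qed (simp add: nu_outside ind_def zeros_def)
qed

lemma nu_invY_mprod:
  assumes "invY I" "invY J"
  shows "nu (mprod I J) = nu I + nu J"
proof
  fix P
  show "nu (mprod I J) P = (nu I + nu J) P"
  proof (cases "P \<in> Y")
    case True
    have "loc (mprod I J) P = pw P (nu I P + nu J P)"
      by (rule loc_mprod_pw[OF True invYD(2)[OF assms(1)] invYD(2)[OF assms(2)]
            loc_nu[OF True invYD(3)[OF assms(1)]] loc_nu[OF True invYD(3)[OF assms(2)]]])
    then show ?thesis using nu_eqI[OF True] by simp
  qed (simp add: nu_outside)
qed

lemma nu_invY_colon:
  assumes "invY I"
  shows "nu (colon D I) = - nu I"
proof
  fix P
  show "nu (colon D I) P = (- nu I) P"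
  proof (cases "P \<in> Y")
    case True
    have "\<not> D \<subseteq> P" using Spec_1[OF Y_Spec[OF True]] D_closed(2) by blast
    then show ?thesis
      using nu_colon_zero[OF invYD(3)[OF assms] True] mprod_colon_eq[OF invYD(1)[OF assms]] by simp
  qed (simp add: nu_outside)
qed

lemma integral_of_nu_nonneg:
  assumes I: "invY I" and nn: "\<And>P. P \<in> Y \<Longrightarrow> 0 \<le> nu I P"
  shows "I \<subseteq> D"
proof (rule local_subset[OF dmod_D])
  fix P assume P: "P \<in> Spec D"
  show "loc I P \<subseteq> loc D P"
  proof (cases "P \<in> Y")
    case True
    then show ?thesis
      using loc_nu[OF True invYD(3)[OF I]] pw_0[OF True] pw_subset_iff[OF True, of "nu I P" 0] nn by simp
  next
    case False
    then have "1 \<in> loc (colon D I) P" using I P by (simp add: invY_def)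
    then show ?thesis by (rule loc_subset_of_colon_unit[OF P invYD(2)[OF I]])
  qed
qed

lemma rad_D: "rad D"
  using invY_D unif_D subset_loc[OF Y_Spec, of _ D] by (auto simp: rad_def)

lemma isum_subset_iff:
  assumes "dmod I" "dmod J" "P \<in> Spec D"
  shows "isum I J \<subseteq> P \<longleftrightarrow> I \<subseteq> P \<and> J \<subseteq> P"
  using isum_upper[OF assms(1,2)] isum_least[OF Spec_dmod[OF assms(3)], of I J] by blast

lemma rad_isum:
  assumes "rad J" "invY I" "I \<subseteq> D"
  shows "rad (isum I J)"
proof -
  have J: "invY J" "J \<subseteq> D" using assms(1) by (simp_all add: rad_def)
  have S: "isum I J \<subseteq> D" by (rule isum_least[OF dmod_D assms(3) J(2)])
  have "invY (isum I J)"
  proof (rule invY_integralI[OF inv_mod_isum_Int(1)[OF invYD(1)[OF assms(2)] invYD(1)[OF J(1)]] S])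
    fix P assume P: "P \<in> Spec D - Y"
    then show "\<not> isum I J \<subseteq> P"
      using invY_not_subset[OF assms(2,3) P] isum_upper(1)[OF invYD(2)[OF assms(2)] invYD(2)[OF J(1)]] by blast
  qed
  moreover have "unif M \<in> loc (isum I J) M" if "M \<in> Y" for M
    using assms(1) that loc_mono[OF isum_upper(2)[OF invYD(2)[OF assms(2)] invYD(2)[OF J(1)]], of M]
    by (auto simp: rad_def)
  ultimately show ?thesis using S by (simp add: rad_def)
qed

lemma invY_Int_D:
  assumes "invY I"
  shows "invY (I \<inter> D)"
  by (rule invY_integralI[OF inv_mod_isum_Int(2)[OF invYD(1)[OF assms] inv_mod_D]])
    (use divY_Int_D[OF invYD(3)[OF assms]] in blast)+

lemma rad_Int:
  assumes "rad I" "rad J"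
  shows "rad (I \<inter> J)"
proof -
  have I: "invY I" "I \<subseteq> D" and J: "invY J" "J \<subseteq> D" using assms by (simp_all add: rad_def)
  note loc_Int' = loc_Int[OF _ invYD(2)[OF I(1)] invYD(2)[OF J(1)]]
  have S: "I \<inter> J \<subseteq> D" using I(2) by blast
  have "invY (I \<inter> J)"
  proof (rule invY_integralI[OF inv_mod_isum_Int(2)[OF invYD(1)[OF I(1)] invYD(1)[OF J(1)]] S])
    fix P assume P: "P \<in> Spec D - Y"
    then have "1 \<in> loc I P \<inter> loc J P" using I(1) J(1) by (simp add: invY_def)
    moreover have PS: "P \<in> Spec D" using P by blast
    ultimately have "1 \<in> loc (I \<inter> J) P" using loc_Int'[OF PS] by simp
    then show "\<not> I \<inter> J \<subseteq> P"
      using loc_one_iff[OF PS dmod_Int[OF invYD(2)[OF I(1)] invYD(2)[OF J(1)]] S] by simp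
  qed
  moreover have "unif M \<in> loc (I \<inter> J) M" if "M \<in> Y" for M
    using assms that loc_Int'[OF Y_Spec[OF that]] by (simp add: rad_def)
  ultimately show ?thesis using S by (simp add: rad_def)
qed

end

context prufer_rad
begin

text \<open>
The invertible ideals whose zeros are zeros of some radical ideal form a multiplicative family, because the radical
ideals are closed under intersection.  So \<open>I\<close> contains a member of it, whence all zeros of \<open>I\<close> are zeros of a radical
\<open>J\<close>, and \<open>I + J\<close> is as required.
\<close>

lemma exists_radical:
  assumes I: "invY I" "I \<subseteq> D"
  obtains K where "rad K" "zeros K = zeros I"
proof -
  define \<J> where "\<J> = {K. invY K \<and> K \<subseteq> D \<and> (\<exists>J. rad J \<and> zeros K \<subseteq> zeros J)}"
  have "\<exists>K\<in>\<J>. K \<subseteq> I"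
  proof (rule exists_in_family_below[OF _ _ _ _ invYD(2)[OF I(1)] I(2) invY_not_subset[OF I]])
    show "invY K \<and> K \<subseteq> D" if "K \<in> \<J>" for K using that by (simp add: \<J>_def)
    show "D \<in> \<J>" using rad_D invY_D unfolding \<J>_def by blast
    show "\<exists>J\<in>\<J>. J \<subseteq> P" if P: "P \<in> Y" for P
    proof -
      obtain J where J: "invY J" "J \<subseteq> D" "J \<subseteq> P" "\<forall>M\<in>Y. unif M \<in> loc J M"
        using radical_cover[OF P] by blast
      then have "rad J" by (simp add: rad_def)
      then have "J \<in> \<J>" using J(1,2) unfolding \<J>_def by blast
      then show ?thesis using J(3) by blast
    qed
    fix K1 K2 assume K: "K1 \<in> \<J>" "K2 \<in> \<J>"
    then obtain J1 J2 where J: "rad J1" "zeros K1 \<subseteq> zeros J1" "rad J2" "zeros K2 \<subseteq> zeros J2"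
      unfolding \<J>_def by blast
    have KD: "invY K1" "invY K2" "K1 \<subseteq> D" "K2 \<subseteq> D" using K by (simp_all add: \<J>_def)
    have "zeros (mprod K1 K2) \<subseteq> zeros (J1 \<inter> J2)"
    proof
      fix P assume "P \<in> zeros (mprod K1 K2)"
      then have P: "P \<in> Y" "mprod K1 K2 \<subseteq> P" by (simp_all add: zeros_def)
      have "K1 \<subseteq> P \<or> K2 \<subseteq> P"
      proof (rule ccontr)
        assume "\<not> ?thesis"
        then obtain x y where xy: "x \<in> K1" "x \<notin> P" "y \<in> K2" "y \<notin> P" by blast
        then have "x * y \<in> P" using P(2) mprod_prod[of x K1 y K2] by blast
        then show False using Spec_prime[OF Y_Spec[OF P(1)], of x y] xy KD by blast
      qed
      then have "P \<in> zeros J1 \<or> P \<in> zeros J2" using P(1) J(2,4) unfolding zeros_def by blast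
      then show "P \<in> zeros (J1 \<inter> J2)" unfolding zeros_def by blast
    qed
    moreover have "mprod K1 K2 \<subseteq> D"
      using KD by (intro mprod_subset_D D_closed(4)) blast+
    ultimately have "mprod K1 K2 \<in> \<J>"
      using invY_mprod[OF KD(1,2)] rad_Int[OF J(1,3)] unfolding \<J>_def by blast
    then show "\<exists>L\<in>\<J>. L \<subseteq> mprod K1 K2" by blast
  qed
  then obtain K J where KJ: "K \<subseteq> I" "rad J" "zeros K \<subseteq> zeros J" unfolding \<J>_def by blast
  have J: "dmod J" using KJ(2) invYD(2) by (simp add: rad_def)
  have "zeros I \<subseteq> zeros J" using KJ(1,3) unfolding zeros_def by blast
  then have "zeros (isum I J) = zeros I"
    using isum_subset_iff[OF invYD(2)[OF I(1)] J Y_Spec] unfolding zeros_def by blast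
  then show thesis using that[of "isum I J"] rad_isum[OF KJ(2) I] by blast
qed

definition zero_sets :: "'a set set set" where
  "zero_sets = zeros ` {J. rad J}"

lemma zero_sets_Int: "S \<in> zero_sets \<Longrightarrow> T \<in> zero_sets \<Longrightarrow> S \<inter> T \<in> zero_sets"
proof -
  assume "S \<in> zero_sets" "T \<in> zero_sets"
  then obtain I J where IJ: "rad I" "rad J" "S = zeros I" "T = zeros J" unfolding zero_sets_def by blast
  have inv: "invY I" "I \<subseteq> D" "invY J" using IJ by (simp_all add: rad_def)
  have "zeros (isum I J) = S \<inter> T"
    using isum_subset_iff[OF invYD(2)[OF inv(1)] invYD(2)[OF inv(3)] Y_Spec] IJ(3,4) unfolding zeros_def by blast
  moreover have "rad (isum I J)" by (rule rad_isum[OF IJ(2) inv(1,2)])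
  ultimately show ?thesis unfolding zero_sets_def by blast
qed

text \<open>
Dividing \<open>I\<close> by a radical ideal with the same zeros subtracts \<open>1\<close> from \<open>nu I\<close> wherever it is positive.
\<close>

lemma nu_integral_in_span:
  assumes "invY I" "I \<subseteq> D" "\<forall>P\<in>Y. nu I P \<le> int n"
  shows "nu I \<in> zspan (ind ` zero_sets)"
  using assms
proof (induction n arbitrary: I)
  case 0
  have "nu I P = 0" for P
    using 0(3) divY_integral_nonneg[OF invYD(3)[OF 0(1)] 0(2), of P] nu_outside by (cases "P \<in> Y") force+
  then have "nu I = 0" by (simp add: fun_eq_iff)
  then show ?case by (simp only: zspan_0)
next
  case (Suc n)
  obtain K where K: "rad K" "zeros K = zeros I" using exists_radical[OF Suc.prems(1,2)] .
  have invK: "invY K" using K(1) by (simp add: rad_def)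
  define I' where "I' = mprod I (colon D K)"
  have inv': "invY I'" unfolding I'_def by (rule invY_mprod[OF Suc.prems(1) invY_colon[OF invK]])
  have eq: "nu I' P = nu I P - ind (zeros I) P" for P
    using nu_invY_mprod[OF Suc.prems(1) invY_colon[OF invK]] nu_invY_colon[OF invK] nu_rad[OF K(1)] K(2)
    by (simp add: I'_def)
  have bounds: "0 \<le> nu I' P \<and> nu I' P \<le> int n" if P: "P \<in> Y" for P
    using eq[of P] nu_eq_0_iff[OF Suc.prems(1,2) P] divY_integral_nonneg[OF invYD(3)[OF Suc.prems(1)] Suc.prems(2) P]
      bspec[OF Suc.prems(3) P] P by (auto simp: ind_def zeros_def)
  have "I' \<subseteq> D" by (rule integral_of_nu_nonneg[OF inv']) (use bounds in blast)
  from Suc.IH[OF inv' this] bounds have 1: "nu I' \<in> zspan (ind ` zero_sets)" by blast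
  have 2: "ind (zeros I) \<in> zspan (ind ` zero_sets)"
    by (rule zspan_base, rule imageI) (use K in \<open>auto simp: zero_sets_def\<close>)
  have "nu I = nu I' + ind (zeros I)" by (simp add: eq fun_eq_iff)
  then show ?case using zspan_add[OF 1 2] by metis
qed

lemma nu_in_span:
  assumes I: "invY I"
  shows "nu I \<in> zspan (ind ` zero_sets)"
proof -
  have pos: "nu (J \<inter> D) \<in> zspan (ind ` zero_sets)" if J: "invY J" for J
  proof -
    note JD = invY_Int_D[OF J]
    obtain n where "\<forall>P\<in>Y. nu (J \<inter> D) P \<le> int n" using nu_bounded_above[OF invYD(3)[OF JD]] by blast
    then show ?thesis by (rule nu_integral_in_span[OF JD Int_lower2])
  qed
  have max: "nu (J \<inter> D) P = max (nu J P) 0" if J: "invY J" and P: "P \<in> Y" for J P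
  proof (rule nu_eqI[OF P])
    have "loc (J \<inter> D) P = pw P (nu J P) \<inter> pw P 0"
      using loc_Int[OF Y_Spec[OF P] invYD(2)[OF J] dmod_D] loc_nu[OF P invYD(3)[OF J]] pw_0[OF P] by simp
    also have "\<dots> = pw P (max (nu J P) 0)"
      using pw_subset_iff[OF P, of "nu J P" 0] pw_subset_iff[OF P, of 0 "nu J P"]
      by (cases "nu J P \<le> 0") (auto simp: max_def)
    finally show "loc (J \<inter> D) P = pw P (max (nu J P) 0)" .
  qed
  have "nu I = nu (I \<inter> D) - nu (colon D I \<inter> D)"
  proof
    fix P
    show "nu I P = (nu (I \<inter> D) - nu (colon D I \<inter> D)) P"
      using max[OF I, of P] max[OF invY_colon[OF I], of P] nu_invY_colon[OF I] nu_outside[of P]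
      by (cases "P \<in> Y") auto
  qed
  then show ?thesis using zspan_diff[OF pos[OF I] pos[OF invY_colon[OF I]]] by metis
qed

lemma span_realised: "zspan (ind ` zero_sets) \<subseteq> nu ` {I. invY I}"
proof (rule zspan_least)
  have "nu D = 0" using nu_D by (simp add: fun_eq_iff)
  then have "0 \<in> nu ` {I. invY I}" using invY_D by (metis imageI mem_Collect_eq)
  moreover have "f - g \<in> nu ` {I. invY I}" if fg: "f \<in> nu ` {I. invY I}" "g \<in> nu ` {I. invY I}" for f g
  proof -
    obtain I J where IJ: "invY I" "invY J" "f = nu I" "g = nu J" using fg by blast
    have "f - g = nu (mprod I (colon D J))"
      using nu_invY_mprod[OF IJ(1) invY_colon[OF IJ(2)]] nu_invY_colon[OF IJ(2)] IJ(3,4) by simp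
    moreover have "invY (mprod I (colon D J))" by (rule invY_mprod[OF IJ(1) invY_colon[OF IJ(2)]])
    ultimately show ?thesis by blast
  qed
  ultimately show "diff_closed (nu ` {I. invY I})" unfolding diff_closed_def by blast
  have "ind (zeros J) \<in> nu ` {I. invY I}" if "rad J" for J
    using nu_rad[OF that] that unfolding rad_def by (metis imageI mem_Collect_eq)
  then show "ind ` zero_sets \<subseteq> nu ` {I. invY I}" unfolding zero_sets_def by blast
qed

lemma subgroup_Inv_on: "subgroup (Inv_on D Y) (Div_on D Y)"
proof -
  interpret G: comm_group "Div_on D Y" by (rule comm_group_Div_on)
  have inv: "inv\<^bsub>Div_on D Y\<^esub> I = colon D I" if I: "invY I" for I
  proof (rule G.inv_equality)
    show "colon D I \<otimes>\<^bsub>Div_on D Y\<^esub> I = \<one>\<^bsub>Div_on D Y\<^esub>"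
      unfolding mult_Div_on one_Div_on using divYD(3)[OF invYD(3)[OF I]] mprod_commute by metis
  qed (simp_all add: carrier_Div_on invYD(3)[OF I] divY_colon)
  show ?thesis
  proof (rule G.subgroupI)
    show "Inv_on D Y \<subseteq> carrier (Div_on D Y)"
      using carrier_Div_on Inv_on_iff invYD(3) by blast
    show "Inv_on D Y \<noteq> {}" using invY_D Inv_on_iff by blast
    fix I assume I: "I \<in> Inv_on D Y"
    then show "inv\<^bsub>Div_on D Y\<^esub> I \<in> Inv_on D Y" using inv Inv_on_iff invY_colon by metis
    fix J assume J: "J \<in> Inv_on D Y"
    have IJ: "invY I" "invY J" using I J Inv_on_iff by blast+
    have "I \<otimes>\<^bsub>Div_on D Y\<^esub> J = mprod I J"
      unfolding mult_Div_on by (rule inv_mod_divisorial[OF inv_mod_mprod(1)[OF invYD(1)[OF IJ(1)] invYD(1)[OF IJ(2)]]])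
    then show "I \<otimes>\<^bsub>Div_on D Y\<^esub> J \<in> Inv_on D Y" using invY_mprod[OF IJ] Inv_on_iff by simp
  qed
qed

theorem free_abelian_Div_Mod_Inv: "free_abelian (Div_on D Y Mod Inv_on D Y)"
proof -
  define M where "M = zspan (ind ` zero_sets \<union> nulls)"
  have M: "diff_closed M" by (simp add: M_def diff_closed_zspan)
  have nullsM: "nulls \<subseteq> M" by (auto simp: M_def intro: zspan_base)
  have hom: "\<forall>I\<in>carrier (Div_on D Y). \<forall>J\<in>carrier (Div_on D Y).
      nu (I \<otimes>\<^bsub>Div_on D Y\<^esub> J) - (nu I + nu J) \<in> M"
    using nu_hom nullsM carrier_Div_on unfolding mult_Div_on by blast
  have "zspan (ind ` zero_sets) \<subseteq> M" unfolding M_def by (rule zspan_mono) simp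
  then have HM: "\<forall>I\<in>Inv_on D Y. nu I \<in> M" using nu_in_span Inv_on_iff by blast
  have ker: "\<forall>I\<in>carrier (Div_on D Y). nu I \<in> M \<longrightarrow> I \<in> Inv_on D Y"
  proof (intro ballI impI)
    fix I assume IG: "I \<in> carrier (Div_on D Y)" and nuI: "nu I \<in> M"
    have I: "divY I" using IG carrier_Div_on by simp
    obtain c f where cf: "c \<in> zspan (ind ` zero_sets)" "f \<in> zspan nulls" "nu I = c + f"
      by (rule zspan_UnD[OF nuI[unfolded M_def]])
    obtain h where h: "invY h" "c = nu h" using span_realised cf(1) by blast
    note h' = invY_colon[OF h(1)]
    let ?z = "v_closure D (mprod I (colon D h))"
    have "nu ?z - (nu I + nu (colon D h)) \<in> nulls" by (rule nu_hom[OF I invYD(3)[OF h']])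
    moreover have "f \<in> nulls" using cf(2) zspan_of_diff_closed[OF diff_closed_nulls] by simp
    ultimately have "(nu ?z - (nu I + nu (colon D h))) + f \<in> nulls" by (rule diff_closed_add[OF diff_closed_nulls])
    then have "nu ?z \<in> nulls" using cf(3) h(2) nu_invY_colon[OF h(1)] by simp
    then have z: "?z = D" by (rule nu_kernel[OF divY_mult[OF I invYD(3)[OF h']]])
    have "v_closure D (mprod ?z h) = v_closure D (mprod I (mprod (colon D h) h))"
      by (simp add: v_closure_mprod_v_closure mprod_assoc)
    moreover have "mprod (colon D h) h = D" using mprod_colon_eq[OF invYD(1)[OF h(1)]] mprod_commute by metis
    ultimately have "v_closure D h = v_closure D I"
      using z mprod_D[OF invYD(2)[OF h(1)]] mprod_D[OF divYD(1)[OF I]] by (simp add: mprod_commute[of D])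
    then have "I = h" using divYD(2)[OF I] divYD(2)[OF invYD(3)[OF h(1)]] by simp
    then show "I \<in> Inv_on D Y" using h(1) Inv_on_iff by simp
  qed
  define \<psi> where "\<psi> c = nu (SOME I. I \<in> c)" for c
  note Q = quotient_representatives[where \<phi> = nu, OF comm_group_Div_on subgroup_Inv_on M hom HM ker, folded \<psi>_def]
  show ?thesis
  proof (rule free_abelian_modulo_sets[where \<phi> = \<psi> and \<N> = negligible and \<C> = zero_sets and ?p0.0 = "{}"];
      (unfold nulls_def[symmetric] M_def[symmetric])?)
    show "comm_group (Div_on D Y Mod Inv_on D Y)" by (rule Q(1))
    show "{} \<notin> S" if "S \<in> negligible \<union> zero_sets" for S
      using that empty_notin_Y unfolding negligible_def zero_sets_def zeros_def by blast
    show "finite (range (\<psi> a))" if a: "a \<in> carrier (Div_on D Y Mod Inv_on D Y)" for a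
    proof -
      obtain I where "I \<in> carrier (Div_on D Y)" "\<psi> a = nu I" using Q(2)[OF a] by blast
      then show ?thesis using finite_range_nu carrier_Div_on by simp
    qed
    show "{} \<in> negligible" by (rule negligible(1))
    show "T \<in> negligible" if "S \<in> negligible" "T \<subseteq> S" for S T using that by (rule negligible(2))
    show "S \<union> T \<in> negligible" if "S \<in> negligible" "T \<in> negligible" for S T using that by (rule negligible(3))
    show "S \<inter> T \<in> zero_sets" if "S \<in> zero_sets" "T \<in> zero_sets" for S T using that by (rule zero_sets_Int)
    show "\<psi> (a \<otimes>\<^bsub>Div_on D Y Mod Inv_on D Y\<^esub> b) - (\<psi> a + \<psi> b) \<in> M"
      if "a \<in> carrier (Div_on D Y Mod Inv_on D Y)" "b \<in> carrier (Div_on D Y Mod Inv_on D Y)" for a b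
      using that by (rule Q(3))
    show "a = \<one>\<^bsub>Div_on D Y Mod Inv_on D Y\<^esub>"
      if "a \<in> carrier (Div_on D Y Mod Inv_on D Y)" "\<psi> a \<in> M" for a
      using that by (rule Q(4))
  qed
qed

end

section \<open>The ideal function\<close>

definition coset :: "'a::field set \<Rightarrow> 'a \<Rightarrow> 'a set" where
  "coset N x = (\<lambda>n. n + x) ` N"

lemma a_r_coset_eq: "N +>\<^bsub>ring_on A\<^esub> x = coset N x" "N +>\<^bsub>fld\<^esub> x = coset N x"
  by (auto simp: a_r_coset_def r_coset_def coset_def)

lemma cosets_of_eq: "cosets_of N A = coset N ` A"
  by (simp add: cosets_of_def a_r_coset_eq)

lemma ideal_prod_ring_on: "ideal_prod (ring_on A) I J = mprod I J"
proof
  show "ideal_prod (ring_on A) I J \<subseteq> mprod I J"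
  proof
    fix x assume "x \<in> ideal_prod (ring_on A) I J"
    then show "x \<in> mprod I J"
      by (induction rule: ideal_prod.induct) (simp_all add: mprod_prod mprod_add)
  qed
  show "mprod I J \<subseteq> ideal_prod (ring_on A) I J"
  proof (rule mprod_least)
    show "x * y \<in> ideal_prod (ring_on A) I J" if "x \<in> I" "y \<in> J" for x y
      using ideal_prod.prod[OF that, of "ring_on A"] by simp
    show "x + y \<in> ideal_prod (ring_on A) I J"
      if "x \<in> ideal_prod (ring_on A) I J" "y \<in> ideal_prod (ring_on A) I J" for x y
      using ideal_prod.sum[OF that] by simp
  qed
qed

lemma coset_eq_iff:
  assumes N: "0 \<in> N" "\<And>x y. x \<in> N \<Longrightarrow> y \<in> N \<Longrightarrow> x - y \<in> N"
  shows "coset N x = coset N y \<longleftrightarrow> x - y \<in> N"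
proof
  assume "coset N x = coset N y"
  moreover have "x \<in> coset N x" using N(1) by (auto simp: coset_def intro: image_eqI[of _ _ 0])
  ultimately obtain n where "n \<in> N" "x = n + y" by (auto simp: coset_def)
  then show "x - y \<in> N" by simp
next
  assume xy: "x - y \<in> N"
  have neg: "- z \<in> N" if "z \<in> N" for z using N(2)[OF N(1) that] by simp
  have add: "z + w \<in> N" if "z \<in> N" "w \<in> N" for z w using N(2)[OF that(1) neg[OF that(2)]] by simp
  show "coset N x = coset N y"
  proof
    show "coset N x \<subseteq> coset N y"
    proof
      fix z assume "z \<in> coset N x"
      then obtain n where "n \<in> N" "z = n + x" by (auto simp: coset_def)
      then have "n + (x - y) \<in> N" "z = n + (x - y) + y" using add xy by simp_all
      then show "z \<in> coset N y" unfolding coset_def by blast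
    qed
    show "coset N y \<subseteq> coset N x"
    proof
      fix z assume "z \<in> coset N y"
      then obtain n where "n \<in> N" "z = n + y" by (auto simp: coset_def)
      then have "n - (x - y) \<in> N" "z = n - (x - y) + x" using N(2) xy by simp_all
      then show "z \<in> coset N x" unfolding coset_def by blast
    qed
  qed
qed

lemma rcoset_mult_coset:
  assumes N: "0 \<in> N" "\<And>x y. x \<in> N \<Longrightarrow> y \<in> N \<Longrightarrow> x - y \<in> N"
    and mult: "\<And>n w. n \<in> N \<Longrightarrow> w \<in> W \<Longrightarrow> n * w \<in> N" and NW: "N \<subseteq> W"
    and x: "x \<in> W" and y: "y \<in> W"
  shows "rcoset_mult (ring_on A) N (coset N x) (coset N y) = coset N (x * y)"
proof -
  have add: "z + w \<in> N" if "z \<in> N" "w \<in> N" for z w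
    using N(2)[OF that(1) N(2)[OF N(1) that(2)]] by simp
  have "coset N (a * b) = coset N (x * y)" if ab: "a \<in> coset N x" "b \<in> coset N y" for a b
  proof -
    obtain n m where nm: "n \<in> N" "m \<in> N" "a = n + x" "b = m + y" using ab by (auto simp: coset_def)
    have "n * m + n * y + m * x \<in> N" using nm mult x y NW by (intro add) auto
    moreover have "a * b - x * y = n * m + n * y + m * x" by (simp add: nm algebra_simps)
    ultimately show ?thesis using coset_eq_iff[OF N] by simp
  qed
  moreover have "x \<in> coset N x" "y \<in> coset N y"
    using N(1) by (auto simp: coset_def intro: image_eqI[of _ _ 0])
  ultimately have "(\<Union>a\<in>coset N x. \<Union>b\<in>coset N y. coset N (a * b)) = coset N (x * y)" by blast
  then show ?thesis by (simp add: rcoset_mult_def a_r_coset_eq)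
qed

lemma set_add_coset:
  assumes N: "0 \<in> N" "\<And>x y. x \<in> N \<Longrightarrow> y \<in> N \<Longrightarrow> x - y \<in> N"
  shows "coset N x <+>\<^bsub>ring_on A\<^esub> coset N y = coset N (x + y)"
proof -
  have add: "z + w \<in> N" if "z \<in> N" "w \<in> N" for z w
    using N(2)[OF that(1) N(2)[OF N(1) that(2)]] by simp
  have "{a + b |a b. a \<in> coset N x \<and> b \<in> coset N y} = coset N (x + y)"
  proof
    show "{a + b |a b. a \<in> coset N x \<and> b \<in> coset N y} \<subseteq> coset N (x + y)"
    proof
      fix z assume "z \<in> {a + b |a b. a \<in> coset N x \<and> b \<in> coset N y}"
      then obtain n m where "n \<in> N" "m \<in> N" "z = (n + x) + (m + y)" by (auto simp: coset_def)
      then have "n + m \<in> N" "z = (n + m) + (x + y)" using add by (simp_all add: algebra_simps)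
      then show "z \<in> coset N (x + y)" unfolding coset_def by blast
    qed
    show "coset N (x + y) \<subseteq> {a + b |a b. a \<in> coset N x \<and> b \<in> coset N y}"
    proof
      fix z assume "z \<in> coset N (x + y)"
      then obtain n where "n \<in> N" "z = n + (x + y)" by (auto simp: coset_def)
      moreover from this have "n + x \<in> coset N x" unfolding coset_def by blast
      moreover have "0 + y \<in> coset N y" unfolding coset_def using N(1) by blast
      moreover have "n + (x + y) = (n + x) + (0 + y)" by (simp add: add.assoc)
      ultimately have "z = (n + x) + (0 + y)" "n + x \<in> coset N x" "0 + y \<in> coset N y" by simp_all
      then show "z \<in> {a + b |a b. a \<in> coset N x \<and> b \<in> coset N y}" by blast
    qed
  qed
  moreover have "coset N x <+>\<^bsub>ring_on A\<^esub> coset N y = {a + b |a b. a \<in> coset N x \<and> b \<in> coset N y}"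
    unfolding set_add_def set_mult_def by auto
  ultimately show ?thesis by simp
qed

lemma carrier_Quot_ring_on: "carrier (ring_on A Quot N) = coset N ` A"
  by (auto simp: FactRing_def A_RCOSETS_def RCOSETS_def r_coset_def coset_def)

context prufer_disc
begin

context
  fixes P assumes PY: "P \<in> Y"
begin

lemma loc_P_pw: "loc P P = pw P 1"
proof
  note PS = Y_Spec[OF PY] and dP = Spec_dmod[OF Y_Spec[OF PY]]
  show "loc P P \<subseteq> pw P 1"
    using unif(3)[OF PY] by (auto simp: pw_def power_int_minus divide_inverse)
  show "pw P 1 \<subseteq> loc P P"
  proof
    fix x assume "x \<in> pw P 1"
    then obtain v where v: "v \<in> loc D P" "x = v * unif P powi 1" using pw_generated[OF PY] by blast
    then show "x \<in> loc P P"
      using loc_smult[OF PS dP v(1), of "unif P"] subset_loc[OF PS, of P] unif(1)[OF PY] by auto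
  qed
qed

text \<open>
The powers of \<open>P\<close> are determined locally: \<open>P\<close> is maximal, so they are trivial at every other prime.
\<close>

lemma ideal_power_eq:
  "ideal_power (ring_on D) P n = {x\<in>D. x \<in> pw P (int n)}"
proof -
  note PS = Y_Spec[OF PY] and dP = Spec_dmod[OF Y_Spec[OF PY]]
  define A where "A n = ((\<lambda>A. mprod A P) ^^ n) D" for n
  have P_not: "\<not> P \<subseteq> P'" if P': "P' \<in> Spec D" "P' \<noteq> P" for P'
  proof
    assume "P \<subseteq> P'"
    then obtain a where a: "a \<in> P'" "a \<notin> P" using P' by blast
    then obtain p t where "p \<in> P" "t \<in> D" "p + t * a = 1"
      using MaxSpec_comax[of P a] PY Y_max Spec_subset[OF P'(1)] by blast
    then have "1 \<in> P'"
      using dmod_add[OF Spec_dmod[OF P'(1)] _ dmod_mult[OF Spec_dmod[OF P'(1)] _ a(1)]] \<open>P \<subseteq> P'\<close>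
      by (metis subsetD)
    then show False using Spec_1[OF P'(1)] by blast
  qed
  have A: "dmod (A n) \<and> A n \<subseteq> D \<and> loc (A n) P = pw P (int n) \<and>
      (\<forall>P'\<in>Spec D. P' \<noteq> P \<longrightarrow> \<not> A n \<subseteq> P')" for n
  proof (induction n)
    case 0
    have "\<not> D \<subseteq> P'" if "P' \<in> Spec D" for P' using Spec_1[OF that] D_closed(2) by blast
    then show ?case using dmod_D pw_0[OF PY] by (simp add: A_def)
  next
    case (Suc n)
    have step: "A (Suc n) = mprod (A n) P" by (simp add: A_def)
    have "mprod (A n) P \<subseteq> D"
      using Suc Spec_subset[OF PS] by (intro mprod_subset_D D_closed(4)) blast+
    moreover have "loc (mprod (A n) P) P = pw P (int n + 1)"
      by (rule loc_mprod_pw[OF PY _ dP _ loc_P_pw]) (use Suc in blast)+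
    moreover have "\<not> mprod (A n) P \<subseteq> P'" if P': "P' \<in> Spec D" "P' \<noteq> P" for P'
    proof
      assume sub: "mprod (A n) P \<subseteq> P'"
      obtain x y where xy: "x \<in> A n" "x \<notin> P'" "y \<in> P" "y \<notin> P'" using Suc P_not[OF P'] P' by blast
      then have "x * y \<in> P'" using sub mprod_prod[of x "A n" y P] by blast
      then show False using Spec_prime[OF P'(1), of x y] xy Suc Spec_subset[OF PS] by blast
    qed
    ultimately show ?case using Suc dmod_mprod[OF _ dP, of "A n"] by (simp add: step add.commute)
  qed
  have "ideal_power (ring_on D) P n = A n"
    by (simp add: ideal_power_def A_def ideal_prod_ring_on)
  also have "\<dots> = {x\<in>D. x \<in> pw P (int n)}"
  proof
    show "A n \<subseteq> {x\<in>D. x \<in> pw P (int n)}" using A[of n] subset_loc[OF PS, of "A n"] by blast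
    show "{x\<in>D. x \<in> pw P (int n)} \<subseteq> A n"
    proof
      fix x assume x: "x \<in> {x\<in>D. x \<in> pw P (int n)}"
      show "x \<in> A n"
      proof (rule local_global)
        show dA: "dmod (A n)" using A by blast
        fix P' assume P': "P' \<in> Spec D"
        show "x \<in> loc (A n) P'"
        proof (cases "P' = P")
          case True
          then show ?thesis using A[of n] x by blast
        next
          case False
          then have "loc (A n) P' = loc D P'" using loc_eq_D_iff[OF P' dA] A[of n] P' by blast
          then show ?thesis using x subset_loc[OF P', of D] by blast
        qed
      qed
    qed
  qed
  finally show ?thesis .
qed

lemma prime_below_eq: "prime_below D P = {x\<in>D. \<forall>n::nat. x \<in> pw P (int n)}"
proof -
  have "x \<in> pw P (int 0)" if "x \<in> D" for x
    using that pw_0[OF PY] subset_loc[OF Y_Spec[OF PY], of D] by auto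
  then have "(\<forall>n\<ge>1. x \<in> D \<and> x \<in> pw P (int n)) \<longleftrightarrow> x \<in> D \<and> (\<forall>n. x \<in> pw P (int n))" for x
    by (metis le_refl less_one not_le)
  then show ?thesis by (auto simp: prime_below_def ideal_power_eq)
qed

text \<open>
Both the ring \<open>R = D\<^sub>P/QD\<^sub>P\<close> and \<open>F = D\<^sub>Q/QD\<^sub>P\<close> consist of cosets of \<open>N = QD\<^sub>P\<close>, the intersection of all \<open>\<pi>\<^sup>n D\<^sub>P\<close>, and
\<open>N\<close> is even a \<open>D\<^sub>Q\<close>-module.  So the \<open>n\<close>-th power of the maximal ideal of \<open>R\<close> is the set of cosets of elements of
\<open>\<pi>\<^sup>n D\<^sub>P\<close>, and membership in \<open>\<pi>\<^sup>n D\<^sub>P\<close> can be read off from the coset.  Negative exponents are excluded since the corresponding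
power contains the coset of \<open>1/\<pi>\<close>, whereas \<open>I D\<^sub>P \<subseteq> D\<^sub>P\<close>.
\<close>

lemma w_val_eq:
  assumes I: "divY I" "I \<subseteq> D"
  shows "w_val D P I = nu I P"
proof -
  note PS = Y_Spec[OF PY] and dP = Spec_dmod[OF Y_Spec[OF PY]]
  define Q where "Q = prime_below D P"
  have Q_eq: "Q = {x\<in>D. \<forall>n::nat. x \<in> pw P (int n)}" unfolding Q_def by (rule prime_below_eq)
  have QS: "Q \<in> Spec D" unfolding Q_eq by (rule prime_below_Spec(1)[OF PY])
  define N where "N = {x. \<forall>n::nat. x \<in> pw P (int n)}"
  define V where "V = loc D P"
  define W where "W = loc D Q"
  define R where "R = ring_on V Quot N"
  define F where "F = ring_on W Quot N"
  have V0: "V = pw P 0" using pw_0[OF PY] by (simp add: V_def)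
  have NV: "N \<subseteq> pw P (int n)" for n by (auto simp: N_def)
  have QP: "Q \<subseteq> P"
  proof
    fix x assume x: "x \<in> Q"
    then have "x \<in> pw P (int 1)" unfolding Q_eq by blast
    then have "x \<in> loc P P" using loc_P_pw by simp
    then show "x \<in> P" using loc_prime_iff[OF PS] x unfolding Q_eq by blast
  qed
  have VW: "V \<subseteq> W" unfolding V_def W_def loc_def using QP by blast
  have N_eq: "mprod Q (localization D P) = N"
  proof -
    have "loc Q P = N"
    proof
      show "loc Q P \<subseteq> N"
      proof
        fix x assume "x \<in> loc Q P"
        then obtain s where s: "s \<in> D" "s \<notin> P" "s * x \<in> Q" by (rule locE)
        have "x \<in> pw P (int n)" for n
        proof -
          have "s * x \<in> pw P (int n)" using s(3) unfolding Q_eq by blast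
          then have "inverse s * (s * x) \<in> pw P (int n)"
            by (rule pw_smult[OF PY inverse_loc_D[OF PS s(1,2)]])
          moreover have "inverse s * (s * x) = x" using loc_nonzero[OF PS s(1,2)] by simp
          ultimately show ?thesis by metis
        qed
        then show "x \<in> N" by (simp add: N_def)
      qed
      show "N \<subseteq> loc Q P"
      proof
        fix x assume x: "x \<in> N"
        then have "x \<in> loc D P" using NV[of 0] pw_0[OF PY] by auto
        then obtain s where s: "s \<in> D" "s \<notin> P" "s * x \<in> D" by (rule locE)
        have "s * x \<in> pw P (int n)" for n
          using pw_smult[OF PY, of s x] x s(1) subset_loc[OF PS, of D] by (auto simp: N_def)
        then have "s * x \<in> Q" using s(3) unfolding Q_eq by blast
        then show "x \<in> loc Q P" by (rule locI[OF s(1,2)])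
      qed
    qed
    then show ?thesis using mprod_loc[OF PS Spec_dmod[OF QS]] by simp
  qed
  have N0: "0 \<in> N" using loc_D_closed(4)[OF PS] by (simp add: N_def pw_def)
  have Nmult: "n * w \<in> N" if n: "n \<in> N" and w: "w \<in> W" for n w
  proof -
    obtain s where s: "s \<in> D" "s \<notin> Q" "s * w \<in> D" using locE[OF w[unfolded W_def]] .
    then obtain a where a: "s \<notin> pw P (int a)" unfolding Q_eq by blast
    have s0: "s \<noteq> 0" using loc_nonzero[OF QS s(1,2)] .
    have "s * unif P powi (- int a) \<notin> loc D P" using a by (simp add: pw_def)
    then have inv: "unif P powi int a * inverse s \<in> loc D P"
      using loc_valuation[OF PS, of "s * unif P powi (- int a)"] unif(2)[OF PY] s0
      by (simp add: power_int_minus mult.commute)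
    have "n * w \<in> pw P (int k)" for k
    proof -
      have "n \<in> pw P (int (k + a))" using n unfolding N_def by blast
      moreover have "unif P powi (- int a) \<in> pw P (- int a)" using unif_powi_pw_iff[OF PY] by blast
      ultimately have "n * unif P powi (- int a) \<in> pw P (int (k + a) + - int a)" by (rule pw_mult[OF PY])
      then have 1: "n * unif P powi (- int a) \<in> pw P (int k)" by simp
      have "s * w * (unif P powi int a * inverse s) \<in> loc D P"
        using loc_D_closed(1)[OF PS _ inv] s(3) subset_loc[OF PS, of D] by blast
      from pw_smult[OF PY this 1]
      have "s * w * (unif P powi int a * inverse s) * (n * unif P powi (- int a)) \<in> pw P (int k)" .
      moreover have "s * w * (unif P powi int a * inverse s) * (n * unif P powi (- int a)) = n * w"
        using s0 unif(2)[OF PY] by (simp add: power_int_minus field_simps)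
      ultimately show ?thesis by metis
    qed
    then show ?thesis by (simp add: N_def)
  qed
  have Nadd: "x + y \<in> N" if "x \<in> N" "y \<in> N" for x y
    using that pw_add[OF PY, of x _ y] unfolding N_def by blast
  have NW: "N \<subseteq> W" using NV[of 0] V0 VW by auto
  have W1: "- 1 \<in> W" unfolding W_def using subset_loc[OF QS, of D] D_closed(5)[OF D_closed(2)] by blast
  have Ndiff: "x - y \<in> N" if "x \<in> N" "y \<in> N" for x y
    using Nadd[OF that(1) Nmult[OF that(2) W1]] by simp
  have coset_mult: "rcoset_mult (ring_on A) N (coset N x) (coset N y) = coset N (x * y)"
    if "x \<in> W" "y \<in> W" for A x y
    by (rule rcoset_mult_coset[OF N0 Ndiff Nmult NW that])
  have coset_add: "coset N x <+>\<^bsub>ring_on A\<^esub> coset N y = coset N (x + y)" for A x y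
    by (rule set_add_coset[OF N0 Ndiff])
  have coset_eq: "coset N x = coset N y \<longleftrightarrow> x - y \<in> N" for x y
    by (rule coset_eq_iff[OF N0 Ndiff])
  have carrier_R: "carrier R = coset N ` V" and carrier_F: "carrier F = coset N ` W"
    by (simp_all add: R_def F_def carrier_Quot_ring_on)
  have pw_W: "pw P (int n) \<subseteq> W" for n using pw_subset_iff[OF PY, of "int n" 0] V0 VW by simp
  have mult_R: "x \<otimes>\<^bsub>R\<^esub> y = rcoset_mult (ring_on V) N x y" and mult_F: "x \<otimes>\<^bsub>F\<^esub> y = rcoset_mult (ring_on W) N x y"
    and add_R: "x \<oplus>\<^bsub>R\<^esub> y = x <+>\<^bsub>ring_on V\<^esub> y" for x y
    by (simp_all add: R_def F_def FactRing_def)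
  define m where "m = coset N ` pw P 1"
  have power: "ideal_power R m n = coset N ` pw P (int n)" for n
  proof (induction n)
    case 0
    then show ?case by (simp add: ideal_power_def carrier_R V0)
  next
    case (Suc n)
    have "ideal_power R m (Suc n) = ideal_prod R (coset N ` pw P (int n)) m"
      using Suc by (simp add: ideal_power_def)
    also have "\<dots> = coset N ` pw P (int (Suc n))"
    proof
      show "ideal_prod R (coset N ` pw P (int n)) m \<subseteq> coset N ` pw P (int (Suc n))"
      proof
        fix z assume "z \<in> ideal_prod R (coset N ` pw P (int n)) m"
        then show "z \<in> coset N ` pw P (int (Suc n))"
        proof (induction rule: ideal_prod.induct)
          case (prod i j)
          then obtain x y where xy: "i = coset N x" "x \<in> pw P (int n)" "j = coset N y" "y \<in> pw P 1"
            unfolding m_def by blast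
          have "x \<in> W" "y \<in> W" using xy pw_W[of n] pw_W[of 1] by auto
          then have "i \<otimes>\<^bsub>R\<^esub> j = coset N (x * y)" unfolding mult_R xy by (rule coset_mult)
          moreover have "x * y \<in> pw P (int (Suc n))"
            using pw_mult[OF PY xy(2,4)] by (simp add: add.commute)
          ultimately show ?case by blast
        next
          case (sum s t)
          then obtain x y where xy: "s = coset N x" "x \<in> pw P (int (Suc n))" "t = coset N y" "y \<in> pw P (int (Suc n))"
            by blast
          have "s \<oplus>\<^bsub>R\<^esub> t = coset N (x + y)" unfolding add_R xy by (rule coset_add)
          then show ?case using pw_add[OF PY xy(2,4)] by blast
        qed
      qed
      show "coset N ` pw P (int (Suc n)) \<subseteq> ideal_prod R (coset N ` pw P (int n)) m"
      proof
        fix z assume "z \<in> coset N ` pw P (int (Suc n))"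
        then obtain x where x: "z = coset N x" "x \<in> pw P (int (Suc n))" by blast
        obtain v where v: "v \<in> loc D P" "x = v * unif P powi int (Suc n)"
          using pw_generated[OF PY x(2)] .
        have "unif P powi int (Suc n) = unif P powi int n * unif P powi 1"
          using unif_add[OF PY, of "int n" 1] by (simp add: add.commute)
        then have x_eq: "x = (v * unif P powi int n) * unif P powi 1" using v(2) by (simp only: mult.assoc)
        have a: "v * unif P powi int n \<in> pw P (int n)"
          by (rule pw_smult[OF PY v(1) iffD2[OF unif_powi_pw_iff[OF PY] order_refl]])
        have b: "unif P powi 1 \<in> pw P 1" using unif_powi_pw_iff[OF PY, of 1 1] by simp
        have "coset N (v * unif P powi int n) \<otimes>\<^bsub>R\<^esub> coset N (unif P powi 1) = coset N x"
          unfolding mult_R x_eq by (rule coset_mult) (use a b pw_W[of n] pw_W[of 1] in auto)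
        moreover have "coset N (v * unif P powi int n) \<otimes>\<^bsub>R\<^esub> coset N (unif P powi 1)
            \<in> ideal_prod R (coset N ` pw P (int n)) m"
          by (rule ideal_prod.prod) (use a b in \<open>auto simp: m_def\<close>)
        ultimately show "z \<in> ideal_prod R (coset N ` pw P (int n)) m" using x(1) by simp
      qed
    qed
    finally show ?case .
  qed
  have pull: "x \<in> pw P (int n)" if xn: "coset N x \<in> coset N ` pw P (int n)" for x n
  proof -
    obtain y where y: "y \<in> pw P (int n)" "coset N x = coset N y" using xn by blast
    then have "x - y \<in> pw P (int n)" using coset_eq[of x y] NV[of n] by blast
    from pw_add[OF PY this y(1)] show ?thesis by simp
  qed
  define k where "k = nat (nu I P)"
  have nonneg: "0 \<le> nu I P" by (rule divY_integral_nonneg[OF I PY])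
  have lhs: "cosets_of N (mprod I (localization D P)) = coset N ` pw P (int k)"
    using mprod_loc[OF PS divYD(1)[OF I(1)]] loc_nu[OF PY I(1)] nonneg by (simp add: cosets_of_eq k_def)
  have "(THE n. cosets_of N (mprod I (localization D P)) = int_power F R m n) = nu I P"
    unfolding lhs
  proof (rule the_equality)
    show "coset N ` pw P (int k) = int_power F R m (nu I P)"
      using nonneg by (simp add: int_power_def power k_def)
    fix j assume j: "coset N ` pw P (int k) = int_power F R m j"
    show "j = nu I P"
    proof (cases "j \<ge> 0")
      case True
      then have eq: "coset N ` pw P (int k) = coset N ` pw P (int (nat j))"
        using j by (simp add: int_power_def power)
      have "pw P (int k) = pw P (int (nat j))"
      proof (intro subset_antisym subsetI)
        fix x assume "x \<in> pw P (int k)"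
        then have "coset N x \<in> coset N ` pw P (int (nat j))" unfolding eq[symmetric] by (rule imageI)
        then show "x \<in> pw P (int (nat j))" by (rule pull)
      next
        fix x assume "x \<in> pw P (int (nat j))"
        then have "coset N x \<in> coset N ` pw P (int k)" unfolding eq by (rule imageI)
        then show "x \<in> pw P (int k)" by (rule pull)
      qed
      then have "int k = int (nat j)" by (rule pw_inject[OF PY])
      then show ?thesis using True nonneg by (simp add: k_def)
    next
      case False
      define i where "i = nat (- j)"
      have i: "i \<ge> 1" using False by (simp add: i_def)
      have "unif P \<notin> pw P (int 2)" using unif_powi_pw_iff[OF PY, of 1 2] by simp
      then have "unif P \<notin> Q" unfolding Q_eq by blast
      then have uW: "inverse (unif P) \<in> W" unfolding W_def by (rule inverse_loc_D[OF QS unif_D[OF PY]])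
      have "coset N (inverse (unif P)) \<in> int_power F R m j"
      proof -
        have "coset N (inverse (unif P)) \<otimes>\<^bsub>F\<^esub> y \<in> carrier R" if "y \<in> ideal_power R m i" for y
        proof -
          have "y \<in> coset N ` pw P (int i)" using that unfolding power .
          then obtain z where z: "y = coset N z" "z \<in> pw P (int i)" by blast
          have "unif P powi (- 1) \<in> pw P (- 1)" using unif_powi_pw_iff[OF PY] by blast
          from pw_mult[OF PY this z(2)] have "inverse (unif P) * z \<in> pw P (- 1 + int i)"
            by (simp add: power_int_minus)
          then have "inverse (unif P) * z \<in> V" using pw_subset_iff[OF PY, of "- 1 + int i" 0] i V0 by auto
          moreover have "coset N (inverse (unif P)) \<otimes>\<^bsub>F\<^esub> y = coset N (inverse (unif P) * z)"
            unfolding mult_F z(1) by (rule coset_mult[OF uW]) (use z(2) pw_W in blast)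
          ultimately show ?thesis unfolding carrier_R by (metis imageI)
        qed
        moreover have "coset N (inverse (unif P)) \<in> carrier F" unfolding carrier_F using uW by (rule imageI)
        ultimately show ?thesis using False unfolding int_power_def i_def by simp
      qed
      then have "coset N (inverse (unif P)) \<in> coset N ` pw P (int k)" unfolding j .
      then have "inverse (unif P) \<in> pw P (int k)" by (rule pull)
      then have "inverse (unif P) \<in> loc D P" using pw_subset_iff[OF PY, of "int k" 0] pw_0[OF PY] by auto
      then show ?thesis using inverse_unif[OF PY] by blast
    qed
  qed
  moreover have "m = cosets_of N (mprod P (localization D P))"
    using mprod_loc[OF PS dP] loc_P_pw by (simp add: cosets_of_eq m_def)
  ultimately show ?thesis
    unfolding w_val_def Let_def Q_def[symmetric] N_eq R_def F_def V_def W_def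
    by (simp add: loc_D_eq[OF PS] loc_D_eq[OF QS])
qed

end

text \<open>
If \<open>s \<pi>\<^sup>k \<in> I\<close> with \<open>s \<notin> M\<close>, then a power of \<open>s \<pi>\<close> lies in \<open>I\<close>, so \<open>s \<pi>\<close> itself does.
\<close>

lemma radical_unif:
  assumes I: "invY I" "I \<subseteq> D" and rad: "radical_ideal D I" and M: "M \<in> Y"
  shows "unif M \<in> loc I M"
proof (cases "I \<subseteq> M")
  case False
  then have "loc I M = loc D M" using loc_eq_D_iff[OF Y_Spec[OF M] invYD(2)[OF I(1)] I(2)] by simp
  then show ?thesis using unif_D[OF M] subset_loc[OF Y_Spec[OF M], of D] by blast
next
  case True
  define k where "k = nat (nu I M)"
  have "0 \<le> nu I M" by (rule divY_integral_nonneg[OF invYD(3)[OF I(1)] I(2) M])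
  then have "unif M powi int k \<in> loc I M"
    using nu_le_iff[OF M invYD(3)[OF I(1)], of "int k"] by (simp add: k_def)
  then obtain s where s: "s \<in> D" "s \<notin> M" "s * unif M ^ k \<in> I" by (auto elim: locE)
  have "(s * unif M) ^ Suc k = s ^ k * unif M * (s * unif M ^ k)" by (simp add: power_mult_distrib mult_ac)
  also have "\<dots> \<in> I" using unif_D[OF M] s by (intro dmod_mult[OF invYD(2)[OF I(1)], of "s ^ k * unif M"]) simp_all
  finally have "(s * unif M) ^ Suc k \<in> I" .
  moreover have "s * unif M \<in> D" using s(1) unif_D[OF M] by simp
  ultimately have "s * unif M \<in> {x \<in> D. \<exists>n::nat. n \<ge> 1 \<and> x ^ n \<in> I}"
    by (intro CollectI conjI exI[of _ "Suc k"]) simp_all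
  then have "s * unif M \<in> I" using rad unfolding radical_ideal_def by blast
  then show ?thesis by (rule locI[OF s(1,2)])
qed

end

theorem theorem4p9:
  fixes D :: "'a::field set" and Y :: "'a set set"
  assumes "prufer_domain D"
    and "strongly_discrete D"
    and "Y \<subseteq> MaxSpec D"
  shows "(bounded_Crit D Y = {} \<longrightarrow> free_abelian (Div_on D Y)) \<and>
         (Crit D Y = {} \<longrightarrow> free_abelian (Div_on D Y Mod Inv_on D Y))"
proof (intro conjI impI)
  interpret prufer_max D Y by unfold_locales (rule assms)+
  have disc: "prufer_disc D Y" if "\<And>P. P \<in> Y \<Longrightarrow> \<exists>I\<in>Inv_on D Y. I \<subseteq> P"
  proof
    show "strongly_discrete D" by (rule assms)
    fix P assume "P \<in> Y"
    from that[OF this] obtain I where "I \<in> Inv_on D Y" "I \<subseteq> P" by blast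
    then have "invY I" "I \<subseteq> P" using Inv_on_iff by simp_all
    then show "P \<noteq> {0}" using invY_divY[of I] nonzero_dmod[of I] unfolding divY_def by blast
  qed
  {
    assume none: "bounded_Crit D Y = {}"
    have ex: "\<exists>I\<in>Inv_on D Y. I \<subseteq> D \<and> I \<subseteq> P \<and> (\<exists>B. \<forall>M\<in>Y. \<bar>ideal_function D I M\<bar> \<le> B)"
      if "P \<in> Y" for P
      using none that unfolding bounded_Crit_def by blast
    have "\<exists>I\<in>Inv_on D Y. I \<subseteq> P" if "P \<in> Y" for P using ex[OF that] by blast
    then interpret prufer_disc D Y by (rule disc)
    interpret prufer_bdd D Y
    proof
      fix P assume "P \<in> Y"
      from ex[OF this] obtain I B where "I \<in> Inv_on D Y" and I': "I \<subseteq> D" "I \<subseteq> P"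
        and B: "\<forall>M\<in>Y. \<bar>ideal_function D I M\<bar> \<le> B" by blast
      then have I: "invY I" "I \<subseteq> D" "I \<subseteq> P" using Inv_on_iff by simp_all
      define b where "b = nat B"
      have "unif M ^ b \<in> loc I M" if M: "M \<in> Y" for M
      proof -
        have "ideal_function D I M = nu I M"
          using w_val_eq[OF M invYD(3)[OF I(1)] I(2)] by (simp add: ideal_function_def)
        moreover have "\<bar>ideal_function D I M\<bar> \<le> B" using B M by blast
        ultimately have "nu I M \<le> int b" unfolding b_def by linarith
        then show ?thesis using nu_le_iff[OF M invYD(3)[OF I(1)], of "int b"] by simp
      qed
      then show "\<exists>J n. invY J \<and> J \<subseteq> D \<and> J \<subseteq> P \<and> (\<forall>M\<in>Y. unif M ^ n \<in> loc J M)" using I by blast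
    qed
    show "free_abelian (Div_on D Y)" by (rule free_abelian_Div_on)
  }
  {
    assume none: "Crit D Y = {}"
    have ex: "\<exists>I\<in>Inv_on D Y. I \<subseteq> D \<and> radical_ideal D I \<and> I \<subseteq> P" if "P \<in> Y" for P
      using none that unfolding Crit_def by blast
    have "\<exists>I\<in>Inv_on D Y. I \<subseteq> P" if "P \<in> Y" for P using ex[OF that] by blast
    then interpret prufer_disc D Y by (rule disc)
    interpret prufer_rad D Y
    proof
      fix P assume "P \<in> Y"
      from ex[OF this] obtain I where "I \<in> Inv_on D Y" "I \<subseteq> D" "I \<subseteq> P" and rad: "radical_ideal D I"
        by blast
      then have I: "invY I" "I \<subseteq> D" "I \<subseteq> P" using Inv_on_iff by simp_all
      have "\<forall>M\<in>Y. unif M \<in> loc I M" using radical_unif[OF I(1,2) rad] by blast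
      then show "\<exists>J. invY J \<and> J \<subseteq> D \<and> J \<subseteq> P \<and> (\<forall>M\<in>Y. unif M \<in> loc J M)" using I by blast
    qed
    show "free_abelian (Div_on D Y Mod Inv_on D Y)" by (rule free_abelian_Div_Mod_Inv)
  }
qed

end
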